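(* For every $\epsilon>0$ there is a constant $c>0$ such that for all sufficiently large $T$, (A) $\displaystyle\max_{T^{3/4}\leq t\leq T} Z^+(t) \geq c\,\exp\left(\left(\tfrac{1}{2}-\epsilon\right)\sqrt{\frac{\log T\,\log\log\log T}{\log\log T}}\right)$, and (B) $\displaystyle\max_{T^{3/4}\leq t\leq T} Z^-(t) \geq c\,\exp\left(\left(\tfrac{1}{2}-\epsilon\right)\sqrt{\frac{\log T\,\log\log\log T}{\log\log T}}\right)$.
   Context: $\zeta(s)$ is the Riemann zeta function, satisfying the functional equation $\zeta(s)=\chi(s)\zeta(1-s)$ with $\chi(s)=\frac{\Gamma(\frac{1}{2}(1-s))}{\Gamma(\frac{1}{2}s)}\pi^{s-\frac12}$. Hardy's function is $Z(t):=\zeta(\tfrac12+it)\chi^{-1/2}(\tfrac12+it)$ for real $t$; it is a smooth real-valued function with $|Z(t)|=|\zeta(\frac12+it)|$. Define $Z^+(t):=\max(0,Z(t))$ and $Z^-(t):=\max(0,-Z(t))$. *)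

theory Defs
  imports "HOL-Complex_Analysis.Complex_Analysis"
begin

(* The meromorphic continuation of the Dirichlet series; the value at the pole is fixed to 0 only
   to make the description unique. *)

definition zeta_continuation :: "(complex \<Rightarrow> complex) \<Rightarrow> bool" where
  "zeta_continuation f \<longleftrightarrow> f holomorphic_on (- {1}) \<and> f 1 = 0 \<and>
     (\<forall>s. Re s > 1 \<longrightarrow> (\<lambda>n. of_nat (Suc n) powr (- s)) sums f s)"

definition zeta :: "complex \<Rightarrow> complex" where
  "zeta = (THE f. zeta_continuation f)"

definition chi :: "complex \<Rightarrow> complex" where
  "chi s = Gamma ((1 - s) / 2) / Gamma (s / 2) * of_real pi powr (s - 1 / 2)"

abbreviation critical :: "real \<Rightarrow> complex" where
  "critical t \<equiv> 1 / 2 + \<i> * of_real t"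

(* chi^(-1/2) on the critical line is the continuous branch normalised by its value at t = 0, where
   chi (1/2) = 1.  The principal power (chi s) powr (-1/2) would jump whenever chi crosses the
   negative axis, and Z would then not be continuous. *)

definition chi_inv_sqrt :: "real \<Rightarrow> complex" where
  "chi_inv_sqrt = (THE g. continuous_on UNIV g \<and> g 0 = 1 \<and>
     (\<forall>t. g t ^ 2 = inverse (chi (critical t))))"

(* The functional equation makes the product real, so Re only serves as the coercion to real. *)

definition hardy_Z :: "real \<Rightarrow> real" where
  "hardy_Z t = Re (zeta (critical t) * chi_inv_sqrt t)"

definition Z_plus :: "real \<Rightarrow> real" where
  "Z_plus t = max 0 (hardy_Z t)"

definition Z_minus :: "real \<Rightarrow> real" where
  "Z_minus t = max 0 (- hardy_Z t)"


text \<open>Existence of the continuation.  Expanding \<open>(n + 1) powr (1 - s) - n powr (1 - s)\<close> to order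
  \<open>K\<close> and summing over \<open>n\<close> expresses \<open>(s - 1) * zeta s\<close> through the values at
  \<open>s + 1, \<dots>, s + K - 1\<close> and a remainder that is holomorphic for \<open>Re s > 1 - K\<close>.\<close>

definition zc :: "nat \<Rightarrow> complex \<Rightarrow> complex" where
  "zc i s = (\<Prod>j<i. 1 - s - of_nat j)"

definition zrem :: "nat \<Rightarrow> nat \<Rightarrow> complex \<Rightarrow> complex" where
  "zrem K n s = of_nat (Suc (Suc n)) powr (1 - s) -
     (\<Sum>i\<le>K. zc i s / fact i * of_nat (Suc n) powr (1 - s - of_nat i))"

lemma zc_Suc: "zc (Suc i) s = zc i s * (1 - s - of_nat i)"
  by (simp add: zc_def)

lemma holomorphic_zc [holomorphic_intros]: "zc i holomorphic_on A"
  unfolding zc_def by (intro holomorphic_intros)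

lemma holomorphic_zrem: "zrem K n holomorphic_on A"
  unfolding zrem_def by (intro holomorphic_intros) (auto simp del: of_nat_Suc)

lemma zrem_bound:
  assumes "Re s + real K > 0"
  shows "norm (zrem K n s) \<le> norm (zc (Suc K) s) / fact K * real (Suc n) powr (- (Re s + real K))"
proof -
  define w z :: complex where "w = of_nat (Suc n)" and "z = of_nat (Suc (Suc n))"
  define S where "S = closed_segment w z"
  define F where "F = (\<lambda>i x. zc i s * x powr (1 - s - of_nat i))"
  have zw: "z - w = 1" by (simp add: w_def z_def)
  have S: "\<exists>r\<ge>real (Suc n). x = of_real r" if "x \<in> S" for x
  proof -
    from that have "\<exists>u. x = (1 - u) *\<^sub>R w + u *\<^sub>R z \<and> 0 \<le> u \<and> u \<le> 1"
      by (simp only: S_def in_segment conj_ac)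
    then obtain u where u: "x = (1 - u) *\<^sub>R w + u *\<^sub>R z" "0 \<le> u"
      by (elim exE conjE)
    have "x = of_real (real (Suc n) + u)"
      by (simp add: u(1) w_def z_def scaleR_conv_of_real algebra_simps)
    thus ?thesis using u(2) by (intro exI[of _ "real (Suc n) + u"]) auto
  qed
  have "norm (F 0 z - (\<Sum>i\<le>K. F i w * (z - w) ^ i / fact i)) \<le>
     (norm (zc (Suc K) s) * real (Suc n) powr (- (Re s + real K))) * norm (z - w) ^ Suc K / fact K"
  proof (rule complex_Taylor[where S = S])
    show "convex S" "w \<in> S" "z \<in> S" by (auto simp: S_def)
  next
    fix i x assume "x \<in> S"
    then obtain r where r: "r \<ge> real (Suc n)" "x = of_real r" using S by blast
    have "x \<notin> \<real>\<^sub>\<le>\<^sub>0" using r by (auto simp: complex_nonpos_Reals_iff)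
    thus "(F i has_field_derivative F (Suc i) x) (at x within S)"
      unfolding F_def zc_Suc
      by (auto intro!: derivative_eq_intros simp: algebra_simps)
  next
    fix x assume "x \<in> S"
    then obtain r where r: "r \<ge> real (Suc n)" "x = of_real r" using S by blast
    have "norm (x powr (1 - s - of_nat (Suc K))) = r powr (- (Re s + real K))"
      using r by (subst norm_powr_real_powr) auto
    also have "\<dots> \<le> real (Suc n) powr (- (Re s + real K))"
      using r assms by (intro powr_mono2') auto
    finally show "norm (F (Suc K) x) \<le> norm (zc (Suc K) s) * real (Suc n) powr (- (Re s + real K))"
      unfolding F_def norm_mult by (intro mult_left_mono) auto
  qed
  thus ?thesis
    unfolding zw by (simp add: F_def zrem_def w_def z_def zc_def field_simps)
qed

lemma summable_Suc_powr: "a > 1 \<Longrightarrow> summable (\<lambda>n. real (Suc n) powr (- a))"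
  using summable_Suc_iff[of "\<lambda>n. real n powr (- a)"] by (simp add: summable_real_powr_iff)

lemma zrem_sum:
  shows "(\<lambda>s. \<Sum>n. zrem K n s) holomorphic_on {s. Re s > 1 - real K}" (is "_ holomorphic_on ?A")
    and "Re s > 1 - real K \<Longrightarrow> summable (\<lambda>n. zrem K n s)"
proof -
  have op: "open ?A" by (rule open_halfspace_Re_gt)
  have loc: "\<exists>d>0. cball s d \<subseteq> ?A \<and>
      uniform_limit (cball s d) (\<lambda>N s. \<Sum>n<N. zrem K n s) (\<lambda>s. \<Sum>n. zrem K n s) sequentially \<and>
      summable (\<lambda>n. zrem K n s)" if s: "s \<in> ?A" for s
  proof -
    define d where "d = (Re s + real K - 1) / 2"
    have d: "d > 0" using s by (simp add: d_def)
    have re: "Re y + real K \<ge> 1 + d" if "y \<in> cball s d" for y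
      using that abs_Re_le_cmod[of "s - y"] by (auto simp: d_def dist_norm field_simps)
    have "compact ((zc (Suc K)) ` cball s d)"
      by (intro compact_continuous_image holomorphic_on_imp_continuous_on holomorphic_zc) auto
    hence "bounded (zc (Suc K) ` cball s d)" by (rule compact_imp_bounded)
    then obtain M where M: "\<And>y. y \<in> cball s d \<Longrightarrow> norm (zc (Suc K) y) \<le> M"
      unfolding bounded_iff by blast
    have b: "norm (zrem K n y) \<le> M / fact K * real (Suc n) powr (- (1 + d))"
      if y: "y \<in> cball s d" for n y
    proof -
      have "norm (zrem K n y) \<le>
          norm (zc (Suc K) y) / fact K * real (Suc n) powr (- (Re y + real K))"
        using re[OF y] d by (intro zrem_bound) auto
      also have "\<dots> \<le> M / fact K * real (Suc n) powr (- (1 + d))"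
        using M[OF y] re[OF y] order_trans[OF norm_ge_zero M[OF y]]
        by (intro mult_mono divide_right_mono powr_mono) auto
      finally show ?thesis .
    qed
    have sm: "summable (\<lambda>n. M / fact K * real (Suc n) powr (- (1 + d)))"
      using d by (intro summable_mult summable_Suc_powr) auto
    have "uniform_limit (cball s d) (\<lambda>N s. \<Sum>n<N. zrem K n s) (\<lambda>s. \<Sum>n. zrem K n s) sequentially"
      by (rule Weierstrass_m_test[OF b sm])
    moreover have "cball s d \<subseteq> ?A" using re d by fastforce
    moreover have "summable (\<lambda>n. zrem K n s)"
      by (rule summable_comparison_test[OF _ sm]) (use b[of s] d in auto)
    ultimately show ?thesis using d by blast
  qed
  show "(\<lambda>s. \<Sum>n. zrem K n s) holomorphic_on ?A"
    by (rule holomorphic_uniform_sequence[OF op, where f = "\<lambda>N s. \<Sum>n<N. zrem K n s"])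
       (use loc in \<open>auto intro!: holomorphic_intros holomorphic_zrem\<close>)
  show "Re s > 1 - real K \<Longrightarrow> summable (\<lambda>n. zrem K n s)"
    using loc by blast
qed

definition zser :: "complex \<Rightarrow> complex" where
  "zser s = (\<Sum>n. of_nat (Suc n) powr (- s))"

lemma zser_sums: "Re s > 1 \<Longrightarrow> (\<lambda>n. of_nat (Suc n) powr (- s)) sums zser s"
proof -
  assume s: "Re s > 1"
  have "norm (of_nat (Suc n) powr (- s) :: complex) = real (Suc n) powr (- Re s)" for n
    using norm_powr_real_powr[of "of_nat (Suc n)" "- s"] by (simp del: of_nat_Suc)
  hence "summable (\<lambda>n. norm (of_nat (Suc n) powr (- s) :: complex))"
    by (simp only: summable_Suc_powr[OF s])
  hence "summable (\<lambda>n. of_nat (Suc n) powr (- s) :: complex)"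
    by (rule summable_norm_cancel)
  thus ?thesis unfolding zser_def by (rule summable_sums)
qed

lemma zser_relation:
  assumes s: "Re s > 1" and K: "K \<ge> 1"
  shows "(s - 1) * zser s =
     1 + (\<Sum>i=2..K. - zc (i - 1) s / fact i * ((s + of_nat (i - 1) - 1) * zser (s + of_nat (i - 1))))
       + (\<Sum>n. zrem K n s)"
proof -
  define a where "a = (\<lambda>n. of_nat (Suc n) powr (1 - s) :: complex)"
  have na: "norm (a n) = real (Suc n) powr (- (Re s - 1))" for n
    using norm_powr_real_powr[of "of_nat (Suc n)" "1 - s"] by (simp add: a_def del: of_nat_Suc)
  have "(\<lambda>n. real n powr (- (Re s - 1))) \<longlonglongrightarrow> 0"
    using s by (intro tendsto_neg_powr filterlim_real_sequentially) auto
  from filterlim_sequentially_Suc[THEN iffD2, OF this] have "(\<lambda>n. norm (a n)) \<longlonglongrightarrow> 0"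
    unfolding na .
  hence "a \<longlonglongrightarrow> 0" by (rule tendsto_norm_zero_cancel)
  from telescope_sums[OF this] have 1: "(\<lambda>n. a (Suc n) - a n) sums (- 1)"
    by (simp add: a_def)
  have 2: "(\<lambda>n. (\<Sum>i=1..K. zc i s / fact i * of_nat (Suc n) powr (- (s + of_nat (i - 1)))) + zrem K n s)
      sums ((\<Sum>i=1..K. zc i s / fact i * zser (s + of_nat (i - 1))) + (\<Sum>n. zrem K n s))"
    using s K by (intro sums_add sums_sum sums_mult zser_sums summable_sums zrem_sum(2)) auto
  have "(\<Sum>i=1..K. zc i s / fact i * of_nat (Suc n) powr (- (s + of_nat (i - 1)))) + zrem K n s
      = a (Suc n) - a n" for n
  proof -
    have "(\<Sum>i\<le>K. zc i s / fact i * of_nat (Suc n) powr (1 - s - of_nat i)) =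
       a n + (\<Sum>i=1..K. zc i s / fact i * of_nat (Suc n) powr (1 - s - of_nat i))"
      by (simp add: atMost_atLeast0 sum.atLeast_Suc_atMost[of 0] zc_def a_def)
    also have "(\<Sum>i=1..K. zc i s / fact i * of_nat (Suc n) powr (1 - s - of_nat i)) =
       (\<Sum>i=1..K. zc i s / fact i * of_nat (Suc n) powr (- (s + of_nat (i - 1))))"
      by (intro sum.cong) (auto simp: of_nat_diff algebra_simps)
    finally show ?thesis by (simp add: zrem_def a_def)
  qed
  with 1 2 have "- 1 = (\<Sum>i=1..K. zc i s / fact i * zser (s + of_nat (i - 1))) + (\<Sum>n. zrem K n s)"
    by (simp add: sums_unique2)
  also have "(\<Sum>i=1..K. zc i s / fact i * zser (s + of_nat (i - 1))) =
      (1 - s) * zser s + (\<Sum>i=2..K. zc i s / fact i * zser (s + of_nat (i - 1)))"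
    unfolding sum.atLeast_Suc_atMost[OF K] by (simp add: zc_def numeral_2_eq_2)
  also have "(\<Sum>i=2..K. zc i s / fact i * zser (s + of_nat (i - 1))) =
     (\<Sum>i=2..K. - zc (i - 1) s / fact i * ((s + of_nat (i - 1) - 1) * zser (s + of_nat (i - 1))))"
  proof (intro sum.cong refl)
    fix i assume "i \<in> {2..K}"
    then obtain j where j: "i = Suc j" by (cases i) auto
    show "zc i s / fact i * zser (s + of_nat (i - 1)) =
       - zc (i - 1) s / fact i * ((s + of_nat (i - 1) - 1) * zser (s + of_nat (i - 1)))"
      by (simp add: j zc_Suc divide_simps del: fact_Suc) (simp add: algebra_simps)
  qed
  finally show ?thesis by (simp add: algebra_simps)
qed

lemma zser_continuation_halfplane:
  "\<exists>g. g holomorphic_on {s. Re s > - real m} \<and> (\<forall>s. Re s > 1 \<longrightarrow> g s = (s - 1) * zser s)"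
proof (induction m)
  case 0
  have "(\<lambda>s. 1 + (\<Sum>n. zrem 1 n s)) holomorphic_on {s. Re s > - real 0}"
    using zrem_sum(1)[of 1] by (intro holomorphic_intros) simp
  moreover have "\<forall>s. Re s > 1 \<longrightarrow> 1 + (\<Sum>n. zrem 1 n s) = (s - 1) * zser s"
    using zser_relation[of _ 1] by simp
  ultimately show ?case by blast
next
  case (Suc m)
  then obtain g where g: "g holomorphic_on {s. Re s > - real m}"
      "\<And>s. Re s > 1 \<Longrightarrow> g s = (s - 1) * zser s" by blast
  define K where "K = m + 2"
  define h where "h = (\<lambda>s. 1 + (\<Sum>i=2..K. - zc (i - 1) s / fact i * g (s + of_nat (i - 1)))
       + (\<Sum>n. zrem K n s))"
  have "(\<lambda>s. g (s + of_nat (i - 1))) holomorphic_on {s. Re s > - real (Suc m)}"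
    if "i \<in> {2..K}" for i
  proof -
    have "(g \<circ> (\<lambda>s. s + of_nat (i - 1))) holomorphic_on {s. Re s > - real (Suc m)}"
      using that by (intro holomorphic_on_compose_gen[OF _ g(1)] holomorphic_intros) auto
    thus ?thesis by (simp add: o_def)
  qed
  moreover have "{s. Re s > - real (Suc m)} = {s. Re s > 1 - real K}" by (auto simp: K_def)
  ultimately have "h holomorphic_on {s. Re s > - real (Suc m)}"
    unfolding h_def using zrem_sum(1)[of K] by (intro holomorphic_intros) auto
  moreover have "h s = (s - 1) * zser s" if "Re s > 1" for s
  proof -
    have "g (s + of_nat (i - 1)) = (s + of_nat (i - 1) - 1) * zser (s + of_nat (i - 1))" for i
      using that by (intro g(2)) auto
    moreover have "K \<ge> 1" by (simp add: K_def)
    ultimately show ?thesis by (simp only: h_def zser_relation[OF that])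
  qed
  ultimately show ?case by blast
qed

lemma zeta_continuation_exists: "\<exists>f. zeta_continuation f"
proof -
  define H where "H = (\<lambda>m::nat. {s. Re s > - real m})"
  have H: "open (H m)" "connected (H m)" for m
    by (auto simp: H_def open_halfspace_Re_gt convex_halfspace_Re_gt intro!: convex_connected)
  obtain g where g: "\<And>m. g m holomorphic_on H m"
      "\<And>m s. Re s > 1 \<Longrightarrow> g m s = (s - 1) * zser s"
    using zser_continuation_halfplane unfolding H_def by metis
  have agree: "g m s = g m' s" if "m \<le> m'" "s \<in> H m" for m m' s
  proof (rule analytic_continuation_open[of "{s. Re s > 1}" "H m" "g m" "g m'"])
    show "open {s. Re s > 1}" by (rule open_halfspace_Re_gt)
    show "{s. Re s > 1} \<noteq> {}" by (auto intro!: exI[of _ 2])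
    show "g m' holomorphic_on H m"
      using that(1) by (intro holomorphic_on_subset[OF g(1)]) (auto simp: H_def)
  qed (use H g that in \<open>auto simp: H_def\<close>)
  define h where "h = (\<lambda>s. g (nat \<lceil>1 - Re s\<rceil>) s)"
  have in_H: "s \<in> H (nat \<lceil>1 - Re s\<rceil>)" for s
    by (simp add: H_def) linarith
  have h_eq: "h s = g m s" if "s \<in> H m" for s m
    using agree[OF _ in_H[of s], of m] agree[OF _ that, of "nat \<lceil>1 - Re s\<rceil>"]
    unfolding h_def by (metis nle_le)
  have "h holomorphic_on H m" for m
    using g(1)[of m] by (rule holomorphic_transform) (simp add: h_eq)
  hence "h holomorphic_on (\<Union>m. H m)"
    using H by (intro holomorphic_on_UN_open) auto
  moreover have "(\<Union>m. H m) = UNIV" using in_H by blast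
  ultimately have hol: "h holomorphic_on UNIV" by simp
  define f where "f = (\<lambda>s. if s = 1 then 0 else h s / (s - 1))"
  have "(\<lambda>s. h s / (s - 1)) holomorphic_on (- {1})"
    by (intro holomorphic_intros holomorphic_on_subset[OF hol]) auto
  hence "f holomorphic_on (- {1})"
    by (rule holomorphic_transform) (simp add: f_def)
  moreover have "f s = zser s" if "Re s > 1" for s
    using that g(2)[of s] by (auto simp: f_def h_def)
  ultimately have "zeta_continuation f"
    using zser_sums by (auto simp: zeta_continuation_def f_def)
  thus ?thesis by blast
qed

lemma zeta_continuation_unique:
  assumes "zeta_continuation f" "zeta_continuation f'"
  shows "f = f'"
proof
  fix s :: complex
  have "f s = f' s" if "s \<noteq> 1"
  proof (rule analytic_continuation_open[of "{s. Re s > 1}" "- {1}" f f'])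
    show "open {s. Re s > 1}" by (rule open_halfspace_Re_gt)
    show "{s. Re s > 1} \<noteq> {}" by (auto intro!: exI[of _ 2])
    show "connected (- {1::complex})" by (rule connected_punctured_universe) simp
    show "f z = f' z" if "z \<in> {s. Re s > 1}" for z
      using assms that sums_unique2 unfolding zeta_continuation_def by blast
  qed (use assms that in \<open>auto simp: zeta_continuation_def\<close>)
  thus "f s = f' s" using assms by (cases "s = 1") (auto simp: zeta_continuation_def)
qed

lemma zeta_continuation_zeta: "zeta_continuation zeta"
  unfolding zeta_def using zeta_continuation_exists zeta_continuation_unique
  by (metis theI')

lemma holomorphic_zeta: "zeta holomorphic_on (- {1})"
  and zeta_sums: "Re s > 1 \<Longrightarrow> (\<lambda>n. of_nat (Suc n) powr (- s)) sums zeta s"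
  using zeta_continuation_zeta by (auto simp: zeta_continuation_def)


text \<open>Existence and uniqueness of the branch.\<close>

definition RS_theta :: "real \<Rightarrow> real" where
  "RS_theta t = Im (ln_Gamma (1 / 4 + \<i> * of_real t / 2)) - t / 2 * ln pi"

lemma chi_critical: "chi (critical t) = exp (- 2 * \<i> * of_real (RS_theta t))"
proof -
  define u where "u = 1 / 4 + \<i> * of_real t / 2"
  define L where "L = ln_Gamma u"
  have u: "u \<notin> \<int>\<^sub>\<le>\<^sub>0"
    using nonpos_Ints_subset_nonpos_Reals by (auto simp: u_def complex_nonpos_Reals_iff)
  have G: "Gamma u = exp L" unfolding L_def using u by (simp add: Gamma_complex_altdef)
  have "Gamma (cnj u) = exp (cnj L)" by (simp add: cnj_Gamma[symmetric] G exp_cnj)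
  moreover have "(1 - critical t) / 2 = cnj u" "critical t / 2 = u"
    "critical t - 1 / 2 = \<i> * of_real t"
    by (auto simp: u_def complex_eq_iff)
  ultimately have "chi (critical t) = exp (cnj L) / exp L * of_real pi powr (\<i> * of_real t)"
    by (simp only: chi_def G)
  also have "\<dots> = exp (cnj L - L + \<i> * of_real t * of_real (ln pi))"
    by (simp add: powr_def exp_add exp_diff Ln_of_real)
  also have "cnj L - L + \<i> * of_real t * of_real (ln pi) = - 2 * \<i> * of_real (RS_theta t)"
    by (simp add: complex_eq_iff RS_theta_def L_def u_def)
  finally show ?thesis .
qed

lemma continuous_RS_theta: "continuous_on UNIV RS_theta"
proof -
  have "continuous_on UNIV (\<lambda>t::real. ln_Gamma (1 / 4 + \<i> * of_real t / 2 :: complex))"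
    by (intro continuous_intros continuous_on_compose2[OF continuous_on_ln_Gamma_complex[of "- \<real>\<^sub>\<le>\<^sub>0"]])
       (auto simp: complex_nonpos_Reals_iff)
  thus ?thesis unfolding RS_theta_def by (intro continuous_intros) auto
qed

lemma RS_theta_0: "RS_theta 0 = 0"
proof -
  have "ln_Gamma (of_real (1 / 4) :: complex) = of_real (ln_Gamma (1 / 4))"
    by (rule ln_Gamma_complex_of_real) simp
  thus ?thesis by (simp add: RS_theta_def)
qed

lemma chi_inv_sqrt_eq: "chi_inv_sqrt t = exp (\<i> * of_real (RS_theta t))"
proof -
  define e where "e = (\<lambda>t. exp (\<i> * of_real (RS_theta t)))"
  have sq: "e t ^ 2 = inverse (chi (critical t))" for t
    by (simp add: e_def chi_critical exp_minus flip: exp_double) (simp add: mult_ac)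
  have cont: "continuous_on UNIV e"
    unfolding e_def by (intro continuous_intros continuous_RS_theta)
  have nz: "e t \<noteq> 0" for t by (simp add: e_def)
  have e0: "e 0 = 1" by (simp add: e_def RS_theta_0)
  have "chi_inv_sqrt = e" unfolding chi_inv_sqrt_def
  proof (rule the_equality)
    show "continuous_on UNIV e \<and> e 0 = 1 \<and> (\<forall>t. e t ^ 2 = inverse (chi (critical t)))"
      using cont e0 sq by blast
  next
    fix g assume g: "continuous_on UNIV g \<and> g 0 = 1 \<and> (\<forall>t. g t ^ 2 = inverse (chi (critical t)))"
    have q: "(g t / e t) ^ 2 = 1" for t
      using g nz[of t] by (simp add: power_divide sq[symmetric])
    have "(\<lambda>t. g t / e t) constant_on UNIV"
    proof (rule continuous_finite_range_constant)
      show "finite (range (\<lambda>t. g t / e t))"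
        by (rule finite_subset[of _ "{1, -1}"]) (use q[unfolded power2_eq_1_iff] in blast, simp)
      show "continuous_on UNIV (\<lambda>t. g t / e t)"
        using g cont nz by (intro continuous_intros) auto
    qed auto
    then obtain c where c: "\<And>t. g t / e t = c" unfolding constant_on_def by blast
    with c[of 0] g e0 have "g t / e t = 1" for t by auto
    thus "g = e" using nz by (auto simp: fun_eq_iff divide_simps)
  qed
  from fun_cong[OF this, of t] show ?thesis unfolding e_def .
qed

lemma continuous_hardy_Z: "continuous_on UNIV hardy_Z"
proof -
  have "continuous_on UNIV (\<lambda>t. zeta (critical t))"
    by (intro continuous_on_compose2[OF holomorphic_on_imp_continuous_on[OF holomorphic_zeta]]
        continuous_intros) (auto simp: complex_eq_iff)
  moreover have "continuous_on UNIV chi_inv_sqrt"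
    unfolding chi_inv_sqrt_eq by (intro continuous_intros continuous_RS_theta)
  ultimately show ?thesis unfolding hardy_Z_def by (intro continuous_intros) auto
qed

lemma continuous_Z_plus_minus: "continuous_on A Z_plus" "continuous_on A Z_minus"
  unfolding Z_plus_def Z_minus_def
  by (intro continuous_intros continuous_on_subset[OF continuous_hardy_Z]; simp)+

text \<open>On a nonempty compact interval the supremum is an attained maximum.\<close>

lemma SUP_attained:
  assumes "continuous_on {a..b} f" "a \<le> (b::real)"
  obtains t where "t \<in> {a..b}" "f t = (SUP t\<in>{a..b}. f t :: real)"
    "\<And>u. u \<in> {a..b} \<Longrightarrow> f u \<le> f t"
proof -
  obtain t where t: "t \<in> {a..b}" "\<And>u. u \<in> {a..b} \<Longrightarrow> f u \<le> f t"
    using continuous_attains_sup[of "{a..b}" f] assms by auto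
  have "(SUP t\<in>{a..b}. f t) = f t" by (rule cSup_eq_maximum) (use t in auto)
  with t show ?thesis using that by metis
qed

end

theory Submission
  imports Defs "HOL-Number_Theory.Number_Theory" "HOL-Real_Asymp.Real_Asymp"
begin

text \<open>
  The proof is the resonance method. Let \<open>R\<close> be a Dirichlet polynomial with at most \<open>T powr \<kappa>\<close> terms,
  \<open>\<kappa> < 1 / 4\<close>, and put \<open>w t = 1 - t / T\<close>. Up to a small error, \<open>Z\<close> is a sum of terms oscillating with
  phase \<open>theta t - t * ln n\<close>. Since \<open>theta''\<close> is of order \<open>1 / t\<close>, van der Corput's second derivative test
  bounds the integral of \<open>Z |R|\<^sup>2 w\<close> over \<open>{T powr (3 / 4)..T}\<close> by \<open>T powr (3 / 4) * ln T\<close> times the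
  number of terms of \<open>R\<close> times the sum of the squares of its coefficients. On the other hand, the integral of
  \<open>|Z| |R|\<^sup>2 w\<close> dominates that of \<open>\<zeta> |R|\<^sup>2 w\<close>; the cosine transform of \<open>w\<close> is the nonnegative Fejer kernel,
  so no pair of frequencies contributes negatively and the latter integral is large for a resonator built from
  products of distinct primes. Hence both \<open>Z\<^sup>+\<close> and \<open>Z\<^sup>-\<close> must be large somewhere.

  The primes are taken from the windows \<open>exp (B * k) * ln T * ln (ln T) < p \<le> exp (B * (k + 1)) * ln T * ln (ln T)\<close>.
  Limiting the number of primes from each window keeps the number of terms below \<open>T powr \<kappa>\<close>; an elementary
  form of Mertens' theorem on these windows gives the size of the gain, and Rankin's trick controls the truncations.
\<close>

section \<open>Oscillatory integrals\<close>

text \<open>The constant 1/2 is the square root of 1/4 = 1 - 3/4. The n up to about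
  \<open>sqrt T\<close> have a stationary phase and cost \<open>sqrt T / sqrt n\<close> each,
  \<open>T powr (3 / 4)\<close> in all, so the error stays below \<open>T\<close> only for
  \<open>\<kappa> < 1 / 4\<close>. In the window parameters the number of terms is about
  \<open>exp (a * B * \<gamma> * ln T)\<close>, the gain has the coefficient
  \<open>\<beta> * B * \<gamma>\<close>, and the caps force \<open>\<beta>^2 * B \<le> a\<close>;
  for \<open>\<gamma>\<close> near 1 the best coefficient is \<open>sqrt \<kappa>\<close>.
  Logarithms of products of primes can be closer together than \<open>1 / T\<close>, and their
  exponentials are then far from orthogonal on an interval of length \<open>T\<close>. The
  frequencies of \<open>R\<close> are therefore rounded to multiples of \<open>1 / T\<close>, which
  makes the mean square exact over a period; a difference of frequencies moves by at most
  \<open>1 / T\<close>, where the Fejer kernel is still of order \<open>T\<close>. That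
  \<open>hardy_Z\<close> has the modulus of zeta depends on the functional equation, obtained by
  evaluating one Mellin integral in two ways on a real interval and continuing analytically.\<close>

lemma first_derivative_test:
  fixes \<phi> \<phi>' \<phi>'' :: "real \<Rightarrow> real"
  assumes ab: "a \<le> b"
    and d1: "\<And>t. t \<in> {a..b} \<Longrightarrow> (\<phi> has_real_derivative \<phi>' t) (at t)"
    and d2: "\<And>t. t \<in> {a..b} \<Longrightarrow> (\<phi>' has_real_derivative \<phi>'' t) (at t)"
    and pos: "\<And>t. t \<in> {a..b} \<Longrightarrow> \<phi>'' t \<ge> 0"
    and m: "m > 0" "(\<forall>t\<in>{a..b}. \<phi>' t \<ge> m) \<or> (\<forall>t\<in>{a..b}. \<phi>' t \<le> - m)"
  shows "norm (integral {a..b} (\<lambda>t. cis (\<phi> t))) \<le> 3 / m"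
proof -
  have nz: "\<phi>' t \<noteq> 0" if "t \<in> {a..b}" for t using m that by force
  have ge: "\<bar>\<phi>' t\<bar> \<ge> m" if "t \<in> {a..b}" for t using m that by force
  have c1: "continuous_on {a..b} \<phi>" "continuous_on {a..b} \<phi>'"
    using d1 d2 by (meson DERIV_isCont continuous_at_imp_continuous_on)+
  \<comment> \<open>Integration by parts: \<open>F\<close> is the boundary term, \<open>G\<close>
    the remainder, and the derivative of \<open>F\<close> is
    \<open>cis (\<phi> t) - G t\<close>.\<close>
  define F where "F = (\<lambda>t. (cis (\<phi> t) * of_real (1 / \<phi>' t)) * (1 / \<i>))"
  define G where "G = (\<lambda>t. cis (\<phi> t) * of_real (\<phi>'' t / (\<phi>' t)\<^sup>2) / \<i>)"
  have F': "(F has_vector_derivative (cis (\<phi> t) - G t)) (at t within {a..b})" if t: "t \<in> {a..b}" for t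
  proof -
    have 1: "((\<lambda>t. cis (\<phi> t)) has_vector_derivative (\<phi>' t *\<^sub>R (\<i> * cis (\<phi> t)))) (at t within {a..b})"
      using d1[OF t] has_derivative_at_withinI
      by (auto intro!: derivative_eq_intros simp: has_vector_derivative_def has_field_derivative_def
           mult_ac scaleR_conv_of_real)
    have 2: "((\<lambda>t. complex_of_real (1 / \<phi>' t)) has_vector_derivative of_real (- \<phi>'' t / (\<phi>' t)\<^sup>2)) (at t within {a..b})"
    proof -
      have "((\<lambda>t. 1 / \<phi>' t) has_real_derivative (- \<phi>'' t / (\<phi>' t)\<^sup>2)) (at t within {a..b})"
        by (rule has_field_derivative_at_within)
           (use nz[OF t] in \<open>auto intro!: derivative_eq_intros d2[OF t] simp: power2_eq_square\<close>)
      thus ?thesis by (intro has_vector_derivative_of_real) (auto simp: has_real_derivative_iff_has_vector_derivative)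
    qed
    have "((\<lambda>t. cis (\<phi> t) * of_real (1 / \<phi>' t)) has_vector_derivative
       (cis (\<phi> t) * of_real (- \<phi>'' t / (\<phi>' t)\<^sup>2) + (\<phi>' t *\<^sub>R (\<i> * cis (\<phi> t))) * of_real (1 / \<phi>' t))) (at t within {a..b})"
      by (rule has_vector_derivative_mult[OF 1 2])
    hence "((\<lambda>t. (cis (\<phi> t) * of_real (1 / \<phi>' t)) * (1 / \<i>)) has_vector_derivative
       (cis (\<phi> t) * of_real (- \<phi>'' t / (\<phi>' t)\<^sup>2) + (\<phi>' t *\<^sub>R (\<i> * cis (\<phi> t))) * of_real (1 / \<phi>' t)) * (1 / \<i>)) (at t within {a..b})"
      by (rule has_vector_derivative_mult_left)
    thus ?thesis
      unfolding F_def by (rule has_vector_derivative_eq_rhs)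
        (use nz[OF t] in \<open>simp add: G_def scaleR_conv_of_real field_simps power2_eq_square\<close>)
  qed
  have I1: "((\<lambda>t. cis (\<phi> t) - G t) has_integral (F b - F a)) {a..b}"
    by (rule fundamental_theorem_of_calculus[OF ab F'])
  have ig: "(\<lambda>t. cis (\<phi> t)) integrable_on {a..b}"
    using c1(1) by (intro integrable_continuous_interval continuous_intros)
  have IG: "G integrable_on {a..b}"
    using integrable_diff[OF ig has_integral_integrable[OF I1]] by simp
  \<comment> \<open>Since \<open>\<phi>''\<close> is nonnegative, the modulus of \<open>G\<close> is
    itself the derivative of \<open>- 1 / \<phi>'\<close>. Its integral is a difference of two end
    values, hence at most \<open>1 / m\<close> for either sign of \<open>\<phi>'\<close>.\<close>
  have I2: "((\<lambda>t. \<phi>'' t / (\<phi>' t)\<^sup>2) has_integral (- 1 / \<phi>' b - (- 1 / \<phi>' a))) {a..b}"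
  proof (rule fundamental_theorem_of_calculus[OF ab])
    fix t assume t: "t \<in> {a..b}"
    show "((\<lambda>t. - 1 / \<phi>' t) has_vector_derivative (\<phi>'' t / (\<phi>' t)\<^sup>2)) (at t within {a..b})"
      unfolding has_real_derivative_iff_has_vector_derivative[symmetric]
      by (rule has_field_derivative_at_within)
         (use nz[OF t] in \<open>auto intro!: derivative_eq_intros d2[OF t] simp: power2_eq_square\<close>)
  qed
  have "norm (integral {a..b} G) \<le> integral {a..b} (\<lambda>t. \<phi>'' t / (\<phi>' t)\<^sup>2)"
    by (rule integral_norm_bound_integral[OF IG has_integral_integrable[OF I2]])
       (use pos in \<open>auto simp: G_def norm_mult norm_divide norm_power\<close>)
  also have "\<dots> = 1 / \<phi>' a - 1 / \<phi>' b" using integral_unique[OF I2] by simp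
  also have "\<dots> \<le> 1 / m"
    using m(2)
  proof
    assume h: "\<forall>t\<in>{a..b}. \<phi>' t \<ge> m"
    have "1 / \<phi>' a \<le> 1 / m" "1 / \<phi>' b > 0" using bspec[OF h, of a] bspec[OF h, of b] ab m(1) by (auto simp: frac_le)
    thus ?thesis by linarith
  next
    assume h: "\<forall>t\<in>{a..b}. \<phi>' t \<le> - m"
    have "\<phi>' a < 0" "- \<phi>' b \<ge> m" using h ab m(1) by force+
    hence "- (1 / \<phi>' b) \<le> 1 / m" "1 / \<phi>' a \<le> 0" using m(1) frac_le[of 1 1 m "- \<phi>' b"] by (auto simp: divide_le_0_iff)
    thus ?thesis by linarith
  qed
  finally have gb: "norm (integral {a..b} G) \<le> 1 / m" .
  have Fb: "norm (F t) \<le> 1 / m" if "t \<in> {a..b}" for t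
    using ge[OF that] m(1) by (auto simp: F_def norm_divide norm_mult intro!: divide_left_mono mult_pos_pos)
  have "integral {a..b} (\<lambda>t. cis (\<phi> t)) - integral {a..b} G = F b - F a"
    using integral_unique[OF I1] integral_diff[OF ig IG] by simp
  hence "integral {a..b} (\<lambda>t. cis (\<phi> t)) = (F b - F a) + integral {a..b} G"
    by (simp only: diff_eq_eq)
  also have "norm \<dots> \<le> norm (F b) + norm (F a) + norm (integral {a..b} G)"
    by (meson add_right_mono norm_triangle_ineq norm_triangle_ineq4 order_trans)
  also have "\<dots> \<le> 1/m + 1/m + 1/m" using Fb[of a] Fb[of b] gb ab by simp
  finally show ?thesis by simp
qed

text \<open>The derivative grows at rate at least \<open>\<rho>\<close>, so it reaches
  \<open>sqrt \<rho>\<close> in modulus once \<open>t\<close> is \<open>1 / sqrt \<rho>\<close> away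
  from its zero. The stretch around the zero costs its length, at most
  \<open>2 / sqrt \<rho>\<close>, and each side costs \<open>3 / sqrt \<rho>\<close> by the first
  derivative test.\<close>

lemma second_derivative_test:
  fixes \<phi> \<phi>' \<phi>'' :: "real \<Rightarrow> real"
  assumes ab: "a \<le> b"
    and d1: "\<And>t. t \<in> {a..b} \<Longrightarrow> (\<phi> has_real_derivative \<phi>' t) (at t)"
    and d2: "\<And>t. t \<in> {a..b} \<Longrightarrow> (\<phi>' has_real_derivative \<phi>'' t) (at t)"
    and pos: "\<And>t. t \<in> {a..b} \<Longrightarrow> \<phi>'' t \<ge> \<rho>"
    and \<rho>: "\<rho> > 0"
  shows "norm (integral {a..b} (\<lambda>t. cis (\<phi> t))) \<le> 8 / sqrt \<rho>"
proof -
  have c1: "continuous_on {a..b} \<phi>" "continuous_on {a..b} \<phi>'"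
    using d1 d2 by (meson DERIV_isCont continuous_at_imp_continuous_on)+
  have ig: "(\<lambda>t. cis (\<phi> t)) integrable_on {c..d}" if "a \<le> c" "d \<le> b" for c d
    using c1(1) that by (intro integrable_continuous_interval continuous_intros) (auto elim: continuous_on_subset)
  have inc: "\<phi>' t - \<phi>' s \<ge> \<rho> * (t - s)" if st: "a \<le> s" "s \<le> t" "t \<le> b" for s t
  proof -
    have "(\<lambda>u. \<phi>' u - \<rho> * u) s \<le> (\<lambda>u. \<phi>' u - \<rho> * u) t"
    proof (rule DERIV_nonneg_imp_nondecreasing[OF st(2)])
      fix x assume x: "s \<le> x" "x \<le> t"
      show "\<exists>y. ((\<lambda>u. \<phi>' u - \<rho> * u) has_real_derivative y) (at x) \<and> 0 \<le> y"
        by (rule exI[of _ "\<phi>'' x - \<rho>"]) (use x st pos[of x] in \<open>auto intro!: derivative_eq_intros d2\<close>)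
    qed
    thus ?thesis by (simp add: algebra_simps)
  qed
  \<comment> \<open>The sign change of \<open>\<phi>'\<close>, or an end point if there is none;
    each disjunction says that the corresponding side is empty or has the right sign.\<close>
  have "\<exists>c\<in>{a..b}. (c = a \<or> \<phi>' c \<le> 0) \<and> (c = b \<or> \<phi>' c \<ge> 0)"
  proof (cases "\<phi>' a \<ge> 0 \<or> \<phi>' b \<le> 0")
    case True thus ?thesis using ab by auto
  next
    case False
    then obtain c where "a \<le> c" "c \<le> b" "\<phi>' c = 0"
      using IVT'[of \<phi>' a 0 b] ab c1 by auto
    thus ?thesis by (intro bexI[of _ c]) auto
  qed
  then obtain c where c: "c \<in> {a..b}" "c = a \<or> \<phi>' c \<le> 0" "c = b \<or> \<phi>' c \<ge> 0" by blast
  define h where "h = 1 / sqrt \<rho>"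
  have h: "h > 0" "\<rho> * h = sqrt \<rho>" "3 / sqrt \<rho> = 3 * h"
    using \<rho> by (auto simp: h_def real_div_sqrt)
  define p q where "p = max a (c - h)" and "q = min b (c + h)"
  have pq: "a \<le> p" "p \<le> c" "c \<le> q" "q \<le> b" "q - p \<le> 2 * h" using c(1) h by (auto simp: p_def q_def)
  have 1: "norm (integral {a..p} (\<lambda>t. cis (\<phi> t))) \<le> 3 / sqrt \<rho>"
  proof (cases "p = a")
    case False
    hence p: "p = c - h" "c \<noteq> a" using h c by (auto simp: p_def max_def split: if_splits)
    have "\<phi>' t \<le> - sqrt \<rho>" if "t \<in> {a..p}" for t
    proof -
      have "\<rho> * h \<le> \<rho> * (c - t)" using that p \<rho> by (intro mult_left_mono) auto
      thus ?thesis using inc[of t c] that p c h pq by auto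
    qed
    thus ?thesis using pq \<rho> order_trans[OF less_imp_le[OF \<rho>] pos]
      by (intro first_derivative_test[where \<phi>' = \<phi>' and \<phi>'' = \<phi>''] d1 d2) auto
  qed (use \<rho> in auto)
  have 2: "norm (integral {q..b} (\<lambda>t. cis (\<phi> t))) \<le> 3 / sqrt \<rho>"
  proof (cases "q = b")
    case False
    hence p: "q = c + h" "c \<noteq> b" using h c by (auto simp: q_def min_def split: if_splits)
    have "\<phi>' t \<ge> sqrt \<rho>" if "t \<in> {q..b}" for t
    proof -
      have "\<rho> * h \<le> \<rho> * (t - c)" using that p \<rho> by (intro mult_left_mono) auto
      thus ?thesis using inc[of c t] that p c h pq by auto
    qed
    thus ?thesis using pq \<rho> order_trans[OF less_imp_le[OF \<rho>] pos]
      by (intro first_derivative_test[where \<phi>' = \<phi>' and \<phi>'' = \<phi>''] d1 d2) auto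
  qed (use \<rho> in auto)
  have 3: "norm (integral {p..q} (\<lambda>t. cis (\<phi> t))) \<le> 2 * h"
    using integral_bound[of p q "\<lambda>t. cis (\<phi> t)" 1] pq ig[of p q] continuous_on_subset[OF c1(1), of "{p..q}"]
    by (force intro!: continuous_intros)
  have "integral {a..b} (\<lambda>t. cis (\<phi> t)) =
     integral {a..p} (\<lambda>t. cis (\<phi> t)) + integral {p..q} (\<lambda>t. cis (\<phi> t)) + integral {q..b} (\<lambda>t. cis (\<phi> t))"
    using pq by (subst Henstock_Kurzweil_Integration.integral_combine ig | simp)+
  also have "norm \<dots> \<le> 3 / sqrt \<rho> + 2 * h + 3 / sqrt \<rho>"
    using 1 2 3 by (meson add_mono norm_triangle_le)
  finally show ?thesis by (simp add: h_def)
qed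

text \<open>Integration by parts: the boundary value carries \<open>1 - b / T\<close>, the
  derivative of the weight carries \<open>(b - a) / T\<close>, and these add up to
  \<open>1 - a / T\<close>. The weight therefore costs no constant.\<close>

lemma norm_integral_mult_decreasing_le:
  fixes F :: "real \<Rightarrow> complex"
  assumes ab: "a \<le> b" "b \<le> T" "0 \<le> a" and F: "continuous_on {a..b} F"
    and Q: "\<And>x. x \<in> {a..b} \<Longrightarrow> norm (integral {a..x} F) \<le> Q"
  shows "norm (integral {a..b} (\<lambda>t. F t * of_real (1 - t / T))) \<le> Q"
proof (cases "T = 0")
  case True
  thus ?thesis using ab Q[of b] by auto
next
  case False
  hence T: "T > 0" using ab by auto
  define G where "G = (\<lambda>x. integral {a..x} F)"
  have G': "(G has_vector_derivative F x) (at x within {a..b})" if "x \<in> {a..b}" for x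
    unfolding G_def using integral_has_vector_derivative[OF F that] .
  have cG: "continuous_on {a..b} G"
    using G' by (meson continuous_on_eq_continuous_within has_vector_derivative_continuous)
  have "((\<lambda>t. G t * of_real (1 - t / T)) has_vector_derivative
     (G x * of_real (- 1 / T) + F x * of_real (1 - x / T))) (at x within {a..b})" if "x \<in> {a..b}" for x
    using T by (intro has_vector_derivative_mult G' that has_vector_derivative_of_real)
       (auto intro!: derivative_eq_intros simp: has_real_derivative_iff_has_vector_derivative[symmetric])
  from fundamental_theorem_of_calculus[OF ab(1) this]
  have 1: "((\<lambda>x. G x * of_real (- 1 / T) + F x * of_real (1 - x / T)) has_integral
     (G b * of_real (1 - b / T))) {a..b}" by (simp add: G_def)
  have 2: "((\<lambda>x. G x * of_real (- 1 / T)) has_integral (integral {a..b} G * of_real (- 1 / T))) {a..b}"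
    using cG by (intro has_integral_mult_left integrable_integral integrable_continuous_interval)
  from has_integral_diff[OF 1 2]
  have "integral {a..b} (\<lambda>t. F t * of_real (1 - t / T)) = G b * of_real (1 - b / T) + integral {a..b} G / of_real T"
    by (simp add: integral_unique algebra_simps)
  also have "norm \<dots> \<le> Q * (1 - b / T) + Q * (b - a) / T"
  proof (rule norm_triangle_mono)
    show "norm (G b * of_real (1 - b / T)) \<le> Q * (1 - b / T)"
      unfolding norm_mult norm_of_real
    proof (intro mult_mono)
      show "norm (G b) \<le> Q" using Q[of b] ab by (simp add: G_def)
      thus "0 \<le> Q" using norm_ge_zero order_trans by blast
    qed (use ab T in auto)
    show "norm (integral {a..b} G / of_real T) \<le> Q * (b - a) / T"
      unfolding norm_divide using integral_bound[OF ab(1) cG, of Q] Q T by (auto simp: G_def divide_right_mono)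
  qed
  also have "\<dots> = Q * (1 - a / T)" using T by (simp add: field_simps)
  also have "\<dots> \<le> Q * 1" using ab T Q[of a] by (intro mult_left_mono) auto
  finally show ?thesis by simp
qed

section \<open>The derivatives of the Riemann-Siegel theta function\<close>

definition theta_arg :: "real \<Rightarrow> complex" where
  "theta_arg t = 1 / 4 + \<i> * of_real t / 2"

definition theta' :: "real \<Rightarrow> real" where
  "theta' t = Re (Digamma (theta_arg t)) / 2 - ln pi / 2"

definition theta'' :: "real \<Rightarrow> real" where
  "theta'' t = - Im (Polygamma 1 (theta_arg t)) / 4"

lemma theta_arg_notin [simp]: "theta_arg t \<notin> \<real>\<^sub>\<le>\<^sub>0" "theta_arg t \<notin> \<int>\<^sub>\<le>\<^sub>0" "theta_arg t \<noteq> 0"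
proof -
  show "theta_arg t \<notin> \<real>\<^sub>\<le>\<^sub>0" by (simp add: theta_arg_def complex_nonpos_Reals_iff)
  thus "theta_arg t \<notin> \<int>\<^sub>\<le>\<^sub>0" "theta_arg t \<noteq> 0"
    using nonpos_Ints_subset_nonpos_Reals by auto
qed

lemma has_vector_derivative_Im:
  assumes "(f has_vector_derivative D) F" shows "((\<lambda>x. Im (f x)) has_vector_derivative Im D) F"
  using bounded_linear.has_vector_derivative[OF bounded_linear_Im assms] by simp

lemma has_vector_derivative_Re:
  assumes "(f has_vector_derivative D) F" shows "((\<lambda>x. Re (f x)) has_vector_derivative Re D) F"
  using bounded_linear.has_vector_derivative[OF bounded_linear_Re assms] by simp

lemma theta_arg_deriv: "(theta_arg has_vector_derivative \<i> / 2) (at t)"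
  unfolding theta_arg_def by (auto intro!: derivative_eq_intros simp: has_vector_derivative_def scaleR_conv_of_real)

lemma RS_theta_deriv: "(RS_theta has_real_derivative theta' t) (at t)"
proof -
  have "((ln_Gamma \<circ> theta_arg) has_vector_derivative (\<i> / 2) * Digamma (theta_arg t)) (at t)"
    by (rule field_vector_diff_chain_at[OF theta_arg_deriv has_field_derivative_ln_Gamma_complex]) simp
  from has_vector_derivative_Im[OF this]
  have "((\<lambda>t. Im (ln_Gamma (theta_arg t))) has_real_derivative Re (Digamma (theta_arg t)) / 2) (at t)"
    by (simp add: has_real_derivative_iff_has_vector_derivative o_def)
  moreover have "((\<lambda>t. t / 2 * ln pi) has_real_derivative ln pi / 2) (at t)"
    by (auto intro!: derivative_eq_intros)
  ultimately show ?thesis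
    unfolding RS_theta_def[abs_def] theta'_def theta_arg_def by (rule DERIV_diff)
qed

lemma theta'_deriv: "(theta' has_real_derivative theta'' t) (at t)"
proof -
  have "((Digamma \<circ> theta_arg) has_vector_derivative (\<i> / 2) * Polygamma 1 (theta_arg t)) (at t)"
    using has_field_derivative_Polygamma[of "theta_arg t" 0 UNIV]
    by (intro field_vector_diff_chain_at[OF theta_arg_deriv]) simp
  from has_vector_derivative_Re[OF this]
  have "((\<lambda>t. Re (Digamma (theta_arg t))) has_real_derivative - Im (Polygamma 1 (theta_arg t)) / 2) (at t)"
    by (simp add: has_real_derivative_iff_has_vector_derivative o_def)
  from DERIV_diff[OF DERIV_cdivide[OF this, of 2] DERIV_const[of "ln pi / 2"]]
  show ?thesis unfolding theta'_def[abs_def] theta''_def by simp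
qed

text \<open>The trigamma series, separated into imaginary parts. For positive \<open>t\<close> all
  terms are positive, so any block of them bounds \<open>theta''\<close> from below.\<close>

lemma theta''_sums:
  "(\<lambda>n. (real n + 1/4) * t / (4 * ((real n + 1/4)\<^sup>2 + (t / 2)\<^sup>2)\<^sup>2)) sums theta'' t"
proof -
  have "(\<lambda>k. inverse ((theta_arg t + of_nat k)\<^sup>2)) sums Polygamma 1 (theta_arg t)"
    using Polygamma_LIMSEQ[of "theta_arg t" 1] by (simp add: numeral_2_eq_2)
  hence "(\<lambda>k. - Im (inverse ((theta_arg t + of_nat k)\<^sup>2)) / 4) sums theta'' t"
    unfolding theta''_def by (intro sums_divide sums_minus sums_Im)
  moreover have "- Im (inverse ((theta_arg t + of_nat k)\<^sup>2)) / 4 =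
     (real k + 1/4) * t / (4 * ((real k + 1/4)\<^sup>2 + (t / 2)\<^sup>2)\<^sup>2)" for k
  proof -
    have "(Re ((theta_arg t + of_nat k)\<^sup>2))\<^sup>2 + (Im ((theta_arg t + of_nat k)\<^sup>2))\<^sup>2 = 
       ((real k + 1/4)\<^sup>2 + (t / 2)\<^sup>2)\<^sup>2"
      by (simp add: theta_arg_def power2_eq_square algebra_simps)
    moreover have "Im ((theta_arg t + of_nat k)\<^sup>2) = (real k + 1/4) * t"
      by (simp add: theta_arg_def power2_eq_square algebra_simps)
    ultimately show ?thesis by simp
  qed
  ultimately show ?thesis by simp
qed

text \<open>Only the block of n comparable with \<open>t\<close> is kept. It has at least
  \<open>t\<close> terms, each at least \<open>1 / (1600 * t^2)\<close>, which is already the true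
  order \<open>1 / t\<close>. The constant is \<open>4 * 20^2\<close>, where \<open>20 * t^2\<close>
  bounds \<open>(n + 1/4)^2 + (t / 2)^2\<close> on the block.\<close>

lemma theta''_ge:
  assumes t: "t \<ge> 1"
  shows "theta'' t \<ge> 1 / (1600 * t)"
proof -
  define m where "m = nat \<lceil>t\<rceil>"
  have m: "real m \<ge> t" "real m \<le> t + 1" "real m \<ge> 1" using t by (unfold m_def, linarith+)
  let ?f = "\<lambda>n. (real n + 1/4) * t / (4 * ((real n + 1/4)\<^sup>2 + (t / 2)\<^sup>2)\<^sup>2)"
  have tm: "?f n \<ge> 1 / (1600 * t\<^sup>2)" if n: "n \<in> {m..<2*m}" for n
  proof -
    have n': "t \<le> real n + 1/4" "real n + 1/4 \<le> 4 * t"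
    proof -
      have "real m \<le> real n" using n by simp
      moreover have "real (n + 1) \<le> real (2 * m)" using n by (subst of_nat_le_iff) auto
      ultimately show "t \<le> real n + 1/4" "real n + 1/4 \<le> 4 * t" using m t by auto
    qed
    have "(real n + 1/4)\<^sup>2 \<le> (4 * t)\<^sup>2" using n' t by (intro power_mono) auto
    also have "(4 * t)\<^sup>2 = 16 * t\<^sup>2" by (simp add: power_mult_distrib)
    finally have "(real n + 1/4)\<^sup>2 \<le> 16 * t\<^sup>2" .
    moreover have "(t / 2)\<^sup>2 = t\<^sup>2 / 4" by (simp add: power_divide)
    ultimately have "(real n + 1/4)\<^sup>2 + (t / 2)\<^sup>2 \<le> 20 * t\<^sup>2"
      using zero_le_power2[of t] by linarith
    hence "((real n + 1/4)\<^sup>2 + (t / 2)\<^sup>2)\<^sup>2 \<le> (20 * t\<^sup>2)\<^sup>2" by (intro power_mono) auto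
    hence 1: "4 * ((real n + 1/4)\<^sup>2 + (t / 2)\<^sup>2)\<^sup>2 \<le> 1600 * t\<^sup>2 * t\<^sup>2"
      by (simp only: power_mult_distrib) (simp add: power2_eq_square)
    have 2: "t\<^sup>2 \<le> (real n + 1/4) * t" using n' t by (auto simp: power2_eq_square intro!: mult_right_mono)
    have 3: "4 * ((real n + 1/4)\<^sup>2 + (t / 2)\<^sup>2)\<^sup>2 > 0"
      using t by (simp add: add_nonneg_pos zero_less_power)
    have "1 / (1600 * t\<^sup>2) = t\<^sup>2 / (1600 * t\<^sup>2 * t\<^sup>2)" using t by simp
    also have "\<dots> \<le> ?f n" using 1 2 3 t by (intro frac_le) auto
    finally show ?thesis .
  qed
  have nn: "?f n \<ge> 0" for n using t by (auto intro!: divide_nonneg_nonneg mult_nonneg_nonneg)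
  have "1 / (1600 * t) \<le> real m * (1 / (1600 * t\<^sup>2))"
    using m t by (simp add: field_simps power2_eq_square)
  also have "\<dots> = (\<Sum>n\<in>{m..<2*m}. 1 / (1600 * t\<^sup>2))" by simp
  also have "\<dots> \<le> (\<Sum>n\<in>{m..<2*m}. ?f n)" by (intro sum_mono tm)
  also have "\<dots> \<le> suminf ?f"
    using theta''_sums[of t] nn by (intro sum_le_suminf) (auto simp: sums_iff)
  also have "\<dots> = theta'' t" using theta''_sums[of t] by (simp add: sums_iff)
  finally show ?thesis .
qed

text \<open>This locates the stationary points: the phase \<open>theta t - t * ln k\<close> has none
  on \<open>{1..T}\<close> once \<open>k\<close> exceeds a constant times \<open>sqrt T\<close>. The
  sum in the limit formula for \<open>Digamma\<close> is compared with an integral.\<close>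

lemma theta'_le:
  assumes t: "t \<ge> 1"
  shows "theta' t \<le> ln t / 2 + 1"
proof -
  define b where "b = t / 2"
  have b: "b > 0" using t by (simp add: b_def)
  \<comment> \<open>\<open>h\<close> decreases only from \<open>b\<close> on, so the comparison with
    its primitive \<open>H\<close> starts at \<open>m\<close>; the earlier terms are nonnegative and
    are dropped.\<close>
  define m where "m = nat \<lceil>b\<rceil>"
  have m: "real m \<ge> b" "real m \<le> b + 1" using t by (unfold m_def b_def, linarith+)
  define h where "h = (\<lambda>x. x / (x\<^sup>2 + b\<^sup>2))"
  define H where "H = (\<lambda>x. ln (x\<^sup>2 + b\<^sup>2) / 2)"
  have pos: "x\<^sup>2 + b\<^sup>2 > 0" for x using b by (simp add: add_nonneg_pos)
  have Hd: "(H has_real_derivative h x) (at x)" for x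
  proof -
    have "((\<lambda>x. ln (x\<^sup>2 + b\<^sup>2)) has_real_derivative 2 * x / (x\<^sup>2 + b\<^sup>2)) (at x)"
      using pos[of x] by (auto intro!: derivative_eq_intros)
    from DERIV_cdivide[OF this, of 2] have "(H has_real_derivative 2 * x / (x\<^sup>2 + b\<^sup>2) / 2) (at x)"
      by (simp only: H_def)
    moreover have "2 * x / (x\<^sup>2 + b\<^sup>2) / 2 = h x" unfolding h_def by (metis divide_divide_eq_left mult.commute mult_divide_mult_cancel_left zero_neq_numeral)
    ultimately show ?thesis by simp
  qed
  have mono: "h y \<le> h x" if "b \<le> x" "x \<le> y" for x y
  proof -
    have "y * (x\<^sup>2 + b\<^sup>2) \<le> x * (y\<^sup>2 + b\<^sup>2)"
    proof -
      have "b\<^sup>2 \<le> x * y" using that b by (auto simp: power2_eq_square intro!: mult_mono)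
      hence "(y - x) * b\<^sup>2 \<le> (y - x) * (x * y)" using that by (intro mult_left_mono) auto
      thus ?thesis by (simp add: algebra_simps power2_eq_square)
    qed
    thus ?thesis unfolding h_def using pos by (simp add: divide_simps)
  qed
  have step: "H (real n + 5/4) - H (real n + 1/4) \<le> h (real n + 1/4)" if "n \<ge> m" for n
  proof -
    obtain z where z: "real n + 1/4 < z" "z < real n + 5/4" 
      "H (real n + 5/4) - H (real n + 1/4) = (real n + 5/4 - (real n + 1/4)) * h z"
      using MVT2[of "real n + 1/4" "real n + 5/4" H h] Hd by auto
    have "b \<le> real n + 1/4" using of_nat_mono[OF that, where 'a = real] m by simp
    thus ?thesis using z mono[of "real n + 1/4" z] by simp
  qed
  have hre: "Re (inverse (theta_arg t + of_nat n)) = h (real n + 1/4)" for n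
    by (simp add: theta_arg_def h_def b_def add_ac)
  have hnn: "h (real n + 1/4) \<ge> 0" for n unfolding h_def using b by (intro divide_nonneg_nonneg) auto
  have lower: "(\<Sum>n<N. h (real n + 1/4)) \<ge> H (real N + 1/4) - H (real m + 1/4)" if "N \<ge> m" for N
    using that
  proof (induction N rule: dec_induct)
    case base
    show ?case using hnn by (simp add: sum_nonneg)
  next
    case (step n)
    have "H (real (Suc n) + 1/4) - H (real n + 1/4) \<le> h (real n + 1/4)"
      using \<open>\<And>n. m \<le> n \<Longrightarrow> _\<close>[of n] step(1) by (simp add: algebra_simps)
    thus ?case using step.IH by simp
  qed
  have "(\<lambda>N. Re (of_real (ln (real N)) - (\<Sum>n<N. inverse (theta_arg t + of_nat n)))) \<longlonglongrightarrow> Re (Digamma (theta_arg t))"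
    by (intro tendsto_Re Digamma_LIMSEQ) simp
  hence lim: "(\<lambda>N. ln (real N) - (\<Sum>n<N. h (real n + 1/4))) \<longlonglongrightarrow> Re (Digamma (theta_arg t))"
    by (simp add: hre del: of_real_of_nat_eq inverse_complex.sel)
  have "Re (Digamma (theta_arg t)) \<le> H (real m + 1/4)"
  proof (rule tendsto_upperbound[OF lim])
    show "\<forall>\<^sub>F N in sequentially. ln (real N) - (\<Sum>n<N. h (real n + 1/4)) \<le> H (real m + 1/4)"
      using eventually_ge_at_top[of "max 1 m"]
    proof eventually_elim
      case (elim N)
      have "ln (real N) = ln ((real N)\<^sup>2) / 2" using elim by (simp add: ln_realpow)
      also have "\<dots> \<le> H (real N + 1/4)" unfolding H_def using elim
      proof (intro divide_right_mono, subst ln_le_cancel_iff)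
        have "(real N)\<^sup>2 \<le> (real N + 1/4)\<^sup>2" by (intro power_mono) auto
        thus "(real N)\<^sup>2 \<le> (real N + 1/4)\<^sup>2 + b\<^sup>2" using zero_le_power2[of b] by linarith
      qed (use pos elim in auto)
      finally show ?case using lower[of N] elim by simp
    qed
  qed simp
  also have "\<dots> \<le> ln (6 * t\<^sup>2) / 2" unfolding H_def
  proof (intro divide_right_mono, subst ln_le_cancel_iff)
    have "(real m + 1/4)\<^sup>2 \<le> (7/4 * t)\<^sup>2" using m t by (intro power_mono) (auto simp: b_def)
    hence "(real m + 1/4)\<^sup>2 \<le> 49/16 * t\<^sup>2" by (simp add: power_mult_distrib power_divide)
    moreover have "b\<^sup>2 = t\<^sup>2 / 4" by (simp add: b_def power_divide)
    ultimately show "(real m + 1/4)\<^sup>2 + b\<^sup>2 \<le> 6 * t\<^sup>2" using zero_le_power2[of t] by linarith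
  qed (use pos t in auto)
  also have "\<dots> = ln t + ln 6 / 2" using t by (simp add: ln_mult ln_realpow)
  finally have "theta' t \<le> (ln t + ln 6 / 2) / 2 - ln pi / 2" by (simp add: theta'_def)
  moreover have "ln 6 \<le> (4::real)"
  proof -
    have "ln (6::real) = ln 2 + ln 3" using ln_mult[of 2 "3::real"] by simp
    moreover have "ln (2::real) \<le> 2 - 1" "ln (3::real) \<le> 3 - 1" by (rule ln_le_minus_one; simp)+
    ultimately show ?thesis by simp
  qed
  moreover have "ln pi > 0" using pi_gt3 by simp
  ultimately show ?thesis by argo
qed

section \<open>Approximation of zeta by a Dirichlet polynomial\<close>

text \<open>\<open>1 - s\<close> times the error of the trapezoidal rule for
  \<open>x powr (- s)\<close> on the interval from \<open>n + 1\<close> to \<open>n + 2\<close>.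
  Written through \<open>zrem\<close>, it inherits holomorphy and decay from there.\<close>

definition em_err :: "nat \<Rightarrow> complex \<Rightarrow> complex" where
  "em_err n s = (1 - s) / 2 * zrem 1 n (s + 1) - zrem 2 n s"

lemma em_err_eq:
  "em_err n s = (1 - s) * (of_nat (Suc n) powr (- s) + of_nat (Suc (Suc n)) powr (- s)) / 2 -
     (of_nat (Suc (Suc n)) powr (1 - s) - of_nat (Suc n) powr (1 - s))"
proof -
  define w z where "w = (of_nat (Suc n) :: complex)" and "z = (of_nat (Suc (Suc n)) :: complex)"
  have zr: "zrem K n s = z powr (1 - s) - (\<Sum>i\<le>K. zc i s / fact i * w powr (1 - s - of_nat i))" for K s
    by (simp only: zrem_def w_def z_def)
  have 1: "zrem 1 n (s + 1) = z powr (- s) - (w powr (- s) - s * w powr (- s - 1))"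
    unfolding zr by (simp add: zc_def)
  have e: "- 1 - s = - s - 1" by simp
  have "{..2::nat} = {0, 1, 2}" by auto
  hence 2: "zrem 2 n s = z powr (1 - s) -
     (w powr (1 - s) + (1 - s) * w powr (- s) - (1 - s) * s / 2 * w powr (- s - 1))"
    unfolding zr by (simp add: zc_def numeral_2_eq_2 lessThan_Suc e)
  show ?thesis unfolding em_err_def 1 2 w_def[symmetric] z_def[symmetric] by (simp add: field_simps)
qed

lemma em_err_bound:
  assumes s: "Re s > -1"
  shows "norm (em_err n s) \<le> norm ((1 - s) * s * (s + 1)) * real (Suc n) powr (- (Re s + 2))"
proof -
  have z: "zc (Suc 1) (s + 1) = s * (s + 1)" "zc (Suc 2) s = (1 - s) * s * (s + 1)"
    by (simp_all add: zc_def numeral_2_eq_2 algebra_simps)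
  have 1: "norm (zrem 1 n (s + 1)) \<le> norm (s * (s + 1)) * real (Suc n) powr (- (Re s + 2))"
    using zrem_bound[of "s + 1" 1 n] s unfolding z by (simp add: add_ac)
  have 2: "norm (zrem 2 n s) \<le> norm ((1 - s) * s * (s + 1)) / 2 * real (Suc n) powr (- (Re s + 2))"
    using zrem_bound[of s 2 n] s unfolding z by (simp add: add_ac)
  have "norm (em_err n s) \<le> norm ((1 - s) / 2) * norm (zrem 1 n (s + 1)) + norm (zrem 2 n s)"
    unfolding em_err_def by (metis norm_mult norm_triangle_ineq4)
  also have "\<dots> \<le> norm ((1 - s) / 2) * (norm (s * (s + 1)) * real (Suc n) powr (- (Re s + 2))) +
     norm ((1 - s) * s * (s + 1)) / 2 * real (Suc n) powr (- (Re s + 2))"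
    by (intro add_mono mult_left_mono 1 2) auto
  also have "\<dots> = norm ((1 - s) * s * (s + 1)) * real (Suc n) powr (- (Re s + 2))"
    by (simp add: norm_mult norm_divide del: of_nat_Suc)
  finally show ?thesis .
qed

text \<open>For \<open>Re s > 1\<close> the series can be summed directly; both sides are
  holomorphic for \<open>Re s > -1\<close> away from 1, so the identity persists there. The
  half-plane contains the critical line and also the interval from -1 to 0, on which the functional
  equation is proved.\<close>

lemma em_err_sums:
  assumes "Re s > -1" "s \<noteq> 1"
  shows "(\<lambda>n. em_err n s) sums ((1 - s) * (zeta s - 1 / 2) + 1)"
proof -
  define U where "U = {s. Re s > -1}"
  define H where "H = (\<lambda>s. \<Sum>n. em_err n s)"
  have sm: "summable (\<lambda>n. em_err n s)" and H_eq: "H s = (1 - s) / 2 * (\<Sum>n. zrem 1 n (s + 1)) - (\<Sum>n. zrem 2 n s)"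
    if "s \<in> U" for s
  proof -
    have 1: "summable (\<lambda>n. zrem 1 n (s + 1))" "summable (\<lambda>n. zrem 2 n s)"
      using that by (auto simp: U_def intro!: zrem_sum(2))
    show "summable (\<lambda>n. em_err n s)" unfolding em_err_def
      using 1 by (intro summable_diff summable_mult)
    show "H s = (1 - s) / 2 * (\<Sum>n. zrem 1 n (s + 1)) - (\<Sum>n. zrem 2 n s)"
      unfolding H_def em_err_def
      by (intro sums_unique[symmetric] sums_diff sums_mult summable_sums 1)
  qed
  have hol: "H holomorphic_on U"
  proof -
    have "((\<lambda>s. \<Sum>n. zrem 1 n s) \<circ> (\<lambda>s. s + 1)) holomorphic_on U"
      by (rule holomorphic_on_compose_gen[OF _ zrem_sum(1)]) (auto simp: U_def intro!: holomorphic_intros)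
    hence "(\<lambda>s. (1 - s) / 2 * (\<Sum>n. zrem 1 n (s + 1)) - (\<Sum>n. zrem 2 n s)) holomorphic_on U"
      using zrem_sum(1)[of 2] by (intro holomorphic_intros) (auto simp: o_def U_def)
    thus ?thesis by (rule holomorphic_transform) (simp add: H_eq)
  qed
  have eq1: "H z = (1 - z) * (zeta z - 1 / 2) + 1" if "z \<in> {s. Re s > 1}" for z
  proof -
    have z: "Re z > 1" using that by simp
    define a where "a = (\<lambda>n. of_nat (Suc n) powr (1 - z) :: complex)"
    have na: "norm (a n) = real (Suc n) powr (- (Re z - 1))" for n
      using norm_powr_real_powr[of "of_nat (Suc n)" "1 - z"] by (simp add: a_def del: of_nat_Suc)
    have "(\<lambda>n. real n powr (- (Re z - 1))) \<longlonglongrightarrow> 0"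
      using z by (intro tendsto_neg_powr filterlim_real_sequentially) auto
    from filterlim_sequentially_Suc[THEN iffD2, OF this] have "(\<lambda>n. norm (a n)) \<longlonglongrightarrow> 0"
      unfolding na .
    hence "a \<longlonglongrightarrow> 0" by (rule tendsto_norm_zero_cancel)
    from telescope_sums[OF this] have 1: "(\<lambda>n. a (Suc n) - a n) sums (- 1)" by (simp add: a_def)
    have one: "complex_of_nat (Suc 0) powr (- z) = 1" by simp
    have 2: "(\<lambda>n. of_nat (Suc (Suc n)) powr (- z)) sums (zeta z - 1)"
      using sums_split_initial_segment[OF zeta_sums[OF z], of 1] one by (simp del: of_nat_Suc add: of_nat_Suc[of 0])
    have "(\<lambda>n. (1 - z) * (of_nat (Suc n) powr (- z) + of_nat (Suc (Suc n)) powr (- z)) / 2 -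
       (a (Suc n) - a n)) sums ((1 - z) * (zeta z + (zeta z - 1)) / 2 - (- 1))"
      by (intro sums_diff 1 sums_divide sums_mult sums_add 2 zeta_sums z)
    hence "(\<lambda>n. em_err n z) sums ((1 - z) * (zeta z + (zeta z - 1)) / 2 - (- 1))"
      unfolding em_err_eq a_def .
    thus ?thesis unfolding H_def by (simp add: sums_iff field_simps)
  qed
  have "H s = (1 - s) * (zeta s - 1 / 2) + 1"
  proof (rule analytic_continuation_open[of "{s. Re s > 1}" "U - {1}" H "\<lambda>s. (1 - s) * (zeta s - 1 / 2) + 1"])
    show "connected (U - {1})"
      by (rule connected_open_delete) (auto simp: U_def open_halfspace_Re_gt convex_halfspace_Re_gt intro!: convex_connected)
    show "open (U - {1})" by (auto simp: U_def open_halfspace_Re_gt)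
    show "{s. Re s > 1} \<noteq> {}" by (auto intro!: exI[of _ 2])
    show "(\<lambda>s. (1 - s) * (zeta s - 1 / 2) + 1) holomorphic_on U - {1}"
      by (intro holomorphic_intros holomorphic_on_subset[OF holomorphic_zeta]) auto
    show "H holomorphic_on U - {1}" by (rule holomorphic_on_subset[OF hol]) auto
  qed (use eq1 assms in \<open>auto simp: U_def open_halfspace_Re_gt\<close>)
  thus ?thesis using sm[of s] assms unfolding H_def U_def by (simp add: sums_iff)
qed

lemma sum_em_err:
  "(\<Sum>n<N. em_err n s) = (1 - s) * ((\<Sum>k=1..Suc N. of_nat k powr (- s)) - 1 / 2 - of_nat (Suc N) powr (- s) / 2)
     - of_nat (Suc N) powr (1 - s) + 1"
proof (induction N)
  case (Suc N)
  show ?case unfolding sum.lessThan_Suc Suc.IH by (simp add: em_err_eq field_simps del: of_nat_Suc)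
qed (simp add: field_simps)

definition dsum :: "nat \<Rightarrow> real \<Rightarrow> complex" where
  "dsum X t = (\<Sum>k=1..X. of_nat k powr (- critical t))"

text \<open>By the mean value theorem each term is at most 4 times the drop of
  \<open>m powr (- (3/2))\<close>, and the drops telescope. The 4 is 6 divided by 3/2, with 6 a
  bound for \<open>2 powr (5/2)\<close>.\<close>

lemma powr_five_halves_tail:
  shows "summable (\<lambda>n. real (Suc (n + N)) powr (- (5/2)))"
    and "(\<Sum>n. real (Suc (n + N)) powr (- (5/2))) \<le> 4 * real (Suc N) powr (- (3/2))"
proof -
  show s: "summable (\<lambda>n. real (Suc (n + N)) powr (- (5/2)))"
    using summable_ignore_initial_segment[OF summable_Suc_powr[of "5/2"], of N] by simp
  define c where "c = (\<lambda>n. real (Suc (n + N)) powr (- (3/2)))"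
  have "(\<lambda>n. real n powr (- (3/2))) \<longlonglongrightarrow> 0"
    by (intro tendsto_neg_powr filterlim_real_sequentially) auto
  from LIMSEQ_ignore_initial_segment[OF this, of "Suc N"] have "c \<longlonglongrightarrow> 0"
    unfolding c_def by simp
  from telescope_sums'[OF this] have t: "(\<lambda>n. c n - c (Suc n)) sums c 0" by simp
  have step: "real (Suc (n + N)) powr (- (5/2)) \<le> 4 * (c n - c (Suc n))" for n
  proof -
    define m where "m = real (Suc (n + N))"
    have m: "m \<ge> 1" by (simp add: m_def)
    have "\<exists>z. m < z \<and> z < m + 1 \<and> (m + 1) powr (- (3/2)) - m powr (- (3/2)) = (m + 1 - m) * (- (3/2) * z powr (- (3/2) - 1))"
      using m by (intro MVT2) (auto intro!: derivative_eq_intros)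
    then obtain z where z: "m < z" "z < m + 1" "(m + 1) powr (- (3/2)) - m powr (- (3/2)) = - (3/2) * z powr (- (5/2))" by auto
    have "m powr (- (5/2)) = 2 powr (5/2) * (2 * m) powr (- (5/2))"
      using m by (simp add: powr_mult powr_minus field_simps)
    also have "\<dots> \<le> 2 powr (5/2) * z powr (- (5/2))" using z m by (intro mult_left_mono powr_mono2') auto
    also have "2 powr (5/2) \<le> (6::real)"
    proof -
      have "2 powr (5/2) = (2::real) powr 2 * 2 powr (1/2)" using powr_add[of "2::real" 2 "1/2"] by simp
      also have "\<dots> = 4 * sqrt 2" by (simp add: powr_half_sqrt)
      also have "sqrt 2 \<le> 3/2" by (rule real_le_lsqrt) (auto simp: power2_eq_square)
      finally show ?thesis by simp
    qed
    hence "2 powr (5/2) * z powr (- (5/2)) \<le> 6 * z powr (- (5/2))" by (rule mult_right_mono) simp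
    finally have "m powr (- (5/2)) \<le> 6 * z powr (- (5/2))" .
    thus ?thesis using z(3) by (simp add: c_def m_def add_ac)
  qed
  have "(\<Sum>n. real (Suc (n + N)) powr (- (5/2))) \<le> (\<Sum>n. 4 * (c n - c (Suc n)))"
    by (intro suminf_le s step summable_mult sums_summable[OF t])
  also have "\<dots> = 4 * c 0" using sums_mult[OF t, of 4] by (simp add: sums_iff)
  finally show "(\<Sum>n. real (Suc (n + N)) powr (- (5/2))) \<le> 4 * real (Suc N) powr (- (3/2))"
    by (simp add: c_def)
qed

text \<open>Euler-Maclaurin summation with a cut-off \<open>X\<close> independent of
  \<open>t\<close>. The middle term, coming from \<open>X powr (1 - s) / (1 - s)\<close>, need not
  be small for an individual \<open>t\<close>, but it decays like \<open>1 / t\<close>, so its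
  integral up to \<open>T\<close> is only of order \<open>sqrt X * ln T\<close>.\<close>

lemma zeta_approx:
  assumes t: "\<bar>t\<bar> \<le> T" "T \<ge> 1" and X: "X \<ge> 1"
  shows "norm (zeta (critical t) - dsum X t) \<le>
    real X powr (- (1/2)) / 2 + real X powr (1/2) / norm (1 / 2 - \<i> * of_real t) + 16 * T\<^sup>2 * real X powr (- (3/2))"
proof -
  define s where "s = critical t"
  define N where "N = X - 1"
  have N: "X = Suc N" using X by (simp add: N_def)
  have s: "Re s = 1/2" "s \<noteq> 1" "1 - s = 1 / 2 - \<i> * of_real t" by (auto simp: s_def complex_eq_iff)
  have sm: "(\<lambda>n. em_err n s) sums ((1 - s) * (zeta s - 1 / 2) + 1)" by (rule em_err_sums) (use s in auto)
  have "(\<lambda>n. em_err (n + N) s) sums ((1 - s) * (zeta s - 1 / 2) + 1 - (\<Sum>n<N. em_err n s))"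
    by (rule sums_split_initial_segment[OF sm])
  also have "(1 - s) * (zeta s - 1 / 2) + 1 - (\<Sum>n<N. em_err n s) =
     (1 - s) * (zeta s - dsum X t + of_nat X powr (- s) / 2) + of_nat X powr (1 - s)" (is "_ = ?E")
    unfolding sum_em_err dsum_def N s_def[symmetric] by (simp add: algebra_simps del: of_nat_Suc)
  finally have E: "(\<lambda>n. em_err (n + N) s) sums ?E" .
  define K where "K = norm ((1 - s) * s * (s + 1))"
  have b: "norm (em_err (n + N) s) \<le> K * real (Suc (n + N)) powr (- (5/2))" for n
    using em_err_bound[of s "n + N"] s unfolding K_def by simp
  have sum5: "summable (\<lambda>n. K * real (Suc (n + N)) powr (- (5/2)))"
    by (intro summable_mult powr_five_halves_tail(1))
  have sumE: "summable (\<lambda>n. norm (em_err (n + N) s))"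
    by (rule summable_comparison_test'[OF sum5, of 0]) (use b in auto)
  have "norm ?E \<le> (\<Sum>n. norm (em_err (n + N) s))"
    using summable_norm[OF sumE] sums_unique[OF E] by simp
  also have "\<dots> \<le> (\<Sum>n. K * real (Suc (n + N)) powr (- (5/2)))"
    by (intro suminf_le b sumE sum5)
  also have "\<dots> = K * (\<Sum>n. real (Suc (n + N)) powr (- (5/2)))"
    by (intro suminf_mult powr_five_halves_tail(1))
  also have "\<dots> \<le> K * (4 * real X powr (- (3/2)))"
    unfolding N by (intro mult_left_mono powr_five_halves_tail(2)) (auto simp: K_def)
  finally have nE: "norm ?E \<le> K * (4 * real X powr (- (3/2)))" .
  \<comment> \<open>The factor \<open>norm (1 - s)\<close> is kept apart because the whole identity
    is divided by \<open>1 - s\<close> below.\<close>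
  have K: "K \<le> norm (1 - s) * (4 * T\<^sup>2)"
  proof -
    have "norm s \<le> 1/2 + \<bar>t\<bar>" unfolding s_def by (rule norm_triangle_le) (simp add: norm_mult)
    moreover have "norm (s + 1) \<le> 3/2 + \<bar>t\<bar>"
    proof -
      have "norm (3/2 + \<i> * of_real t) \<le> 3/2 + \<bar>t\<bar>" by (rule norm_triangle_le) (simp add: norm_mult)
      thus ?thesis by (simp add: s_def add_ac)
    qed
    ultimately have "norm s * norm (s + 1) \<le> (1/2 + T) * (3/2 + T)"
      using t by (intro mult_mono) auto
    also have "\<dots> \<le> 4 * T\<^sup>2"
    proof -
      have "0 \<le> (T - 1) * (3 * T + 1)" using t by (intro mult_nonneg_nonneg) auto
      moreover have "(T - 1) * (3 * T + 1) = 3 * T\<^sup>2 - 2 * T - 1"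
        "(1/2 + T) * (3/2 + T) = T\<^sup>2 + 2 * T + 3/4" by (simp_all add: power2_eq_square field_simps)
      ultimately show ?thesis by linarith
    qed
    finally show ?thesis unfolding K_def norm_mult mult.assoc by (intro mult_left_mono) auto
  qed
  have s1: "norm (1 - s) > 0" using s(2) by simp
  have "zeta s - dsum X t = ?E / (1 - s) - of_nat X powr (1 - s) / (1 - s) - of_nat X powr (- s) / 2"
    using s1 by (simp add: add_divide_distrib)
  also have "norm \<dots> \<le> norm ?E / norm (1 - s) + norm (of_nat X powr (1 - s) :: complex) / norm (1 - s) + norm (of_nat X powr (- s) :: complex) / 2"
  proof -
    have "norm (a - b - c) \<le> norm a + norm b + norm c" for a b c :: complex
      using norm_triangle_ineq4[of "a - b" c] norm_triangle_ineq4[of a b] by linarith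
    from this[of "?E / (1 - s)" "of_nat X powr (1 - s) / (1 - s)" "of_nat X powr (- s) / 2"]
    show ?thesis by (simp only: norm_divide norm_numeral)
  qed
  also have "norm (of_nat X powr (1 - s) :: complex) = real X powr (1/2)"
    using X norm_powr_real_powr[of "of_nat X" "1 - s"] by (simp add: s(1))
  also have "norm (of_nat X powr (- s) :: complex) = real X powr (- (1/2))"
    using X norm_powr_real_powr[of "of_nat X" "- s"] by (simp add: s(1))
  also have "norm ?E / norm (1 - s) \<le> 16 * T\<^sup>2 * real X powr (- (3/2))"
  proof -
    have "norm ?E \<le> norm (1 - s) * (4 * T\<^sup>2) * (4 * real X powr (- (3/2)))"
      using nE mult_right_mono[OF K, of "4 * real X powr (- (3/2))"] by simp
    thus ?thesis using s1 by (simp add: pos_divide_le_eq mult_ac)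
  qed
  finally show ?thesis unfolding s(3) s_def by simp
qed

section \<open>Mertens' theorem on short windows\<close>

abbreviation Lam :: "nat \<Rightarrow> real" where "Lam \<equiv> mangoldt"

text \<open>Passing from \<open>N\<close> to \<open>Suc N\<close>, the quotient by \<open>d\<close>
  jumps exactly at the divisors of \<open>Suc N\<close>, and the Mangoldt function sums to
  \<open>ln (Suc N)\<close> over these.\<close>

lemma ln_fact_eq_sum_mangoldt: "ln (fact N) = (\<Sum>d=1..N. Lam d * real (N div d))"
proof (induction N)
  case (Suc N)
  have "(\<Sum>d=1..Suc N. Lam d * real (Suc N div d)) =
     (\<Sum>d=1..Suc N. Lam d * real (N div d) + (if d dvd Suc N then Lam d else 0))"
    by (intro sum.cong refl) (auto simp: div_Suc dvd_eq_mod_eq_0 distrib_left)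
  also have "\<dots> = (\<Sum>d=1..N. Lam d * real (N div d)) + (\<Sum>d=1..Suc N. if d dvd Suc N then Lam d else 0)"
    by (simp add: sum.distrib)
  also have "(\<Sum>d=1..Suc N. if d dvd Suc N then Lam d else 0) = (\<Sum>d | d dvd Suc N. Lam d)"
    by (subst sum.inter_filter[symmetric]) (auto intro!: sum.cong dest: dvd_imp_le simp: Suc_le_eq intro: Nat.gr0I)
  also have "\<dots> = of_real (ln (real (Suc N)))" by (rule mangoldt_sum) simp
  finally show ?case using Suc.IH by (simp add: ln_mult algebra_simps del: of_nat_Suc)
qed auto

lemma ln_fact_le: "ln (fact N) \<le> real N * ln (real N)"
proof (cases "N = 0")
  case False
  have "(fact N :: real) \<le> real (N ^ N)" by (rule fact_le_power)
  hence "ln (fact N :: real) \<le> ln (real N ^ N)" by (subst ln_le_cancel_iff) (use False in auto)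
  thus ?thesis using False by (simp add: ln_realpow)
qed auto

lemma ln_fact_ge: "real N * ln (real N) - real N \<le> ln (fact N)"
proof (induction N)
  case (Suc N)
  show ?case
  proof (cases "N = 0")
    case False
    have "ln (real (Suc N)) - ln (real N) = ln (1 + 1 / real N)"
    proof -
      have "real (Suc N) = real N * (1 + 1 / real N)" using False by (simp add: field_simps)
      moreover have "1 + 1 / real N > 0" by (simp add: add_pos_nonneg)
      ultimately show ?thesis using False ln_mult[of "real N" "1 + 1 / real N"] by auto
    qed
    also have "\<dots> \<le> 1 / real N" by (rule ln_add_one_self_le_self) simp
    finally have "real N * (ln (real (Suc N)) - ln (real N)) \<le> 1"
      using False by (simp add: field_simps)
    moreover have "ln (fact (Suc N) :: real) = ln (real (Suc N)) + ln (fact N)"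
      by (simp add: ln_mult del: of_nat_Suc)
    moreover have "real (Suc N) * ln (real (Suc N)) = real N * ln (real (Suc N)) + ln (real (Suc N))"
      by (simp add: distrib_right)
    ultimately show ?thesis using Suc.IH by (simp add: right_diff_distrib)
  qed auto
qed auto

text \<open>Chebyshev's argument: the Mangoldt mass between \<open>m\<close> and
  \<open>2 * m\<close> is at most the logarithm of the central binomial coefficient, hence at most
  \<open>2 * m * ln 2\<close>; repeated halving of \<open>N\<close> adds up these pieces.\<close>

lemma sum_mangoldt_le: "(\<Sum>d=1..N. Lam d) \<le> 3 * real N"
proof (induction N rule: less_induct)
  case (less N)
  have dbl: "(\<Sum>d=Suc m..2*m. Lam d) \<le> 3/2 * real m" for m
  proof -
    have "(\<Sum>d=Suc m..2*m. Lam d) = (\<Sum>d=1..2*m. if d > m then Lam d else 0)"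
      by (subst sum.inter_filter[symmetric]) (auto intro!: sum.cong)
    also have "\<dots> \<le> (\<Sum>d=1..2*m. Lam d * (real (2 * m div d) - 2 * real (m div d)))"
    proof (intro sum_mono)
      fix d assume d: "d \<in> {1..2*m}"
      have "2 * (m div d) \<le> 2 * m div d"
        by (metis div_mult1_eq le_add1 mult.commute)
      hence "2 * real (m div d) \<le> real (2 * m div d)" by (metis of_nat_mono of_nat_mult of_nat_numeral)
      moreover have "m div d = 0 \<and> 2 * m div d \<ge> 1" if "d > m" 
        using that d by (auto simp: div_greater_zero_iff Suc_le_eq)
      ultimately show "(if d > m then Lam d else 0) \<le> Lam d * (real (2 * m div d) - 2 * real (m div d))"
        using mangoldt_nonneg[of d] mult_left_mono[of 1 "real (2 * m div d)" "Lam d"]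
        by (cases "d > m") auto
    qed
    also have "\<dots> = ln (fact (2 * m)) - 2 * (\<Sum>d=1..2*m. Lam d * real (m div d))"
      unfolding ln_fact_eq_sum_mangoldt by (simp add: algebra_simps sum_subtractf sum_distrib_left)
    also have "(\<Sum>d=1..2*m. Lam d * real (m div d)) = (\<Sum>d=1..m. Lam d * real (m div d))"
      by (intro sum.mono_neutral_right) auto
    also have "\<dots> = ln (fact m)" by (simp add: ln_fact_eq_sum_mangoldt)
    also have "ln (fact (2 * m)) - 2 * ln (fact m :: real) = ln (real (2 * m choose m))"
    proof -
      have "(fact (2 * m) :: real) = fact m * fact m * real (2 * m choose m)"
        using binomial_fact_lemma[of m "2 * m"] by (metis (no_types, lifting) add_diff_cancel_right' le_add1 mult_2 of_nat_fact of_nat_mult)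
      thus ?thesis by (simp add: ln_mult)
    qed
    also have "\<dots> \<le> ln (2 ^ (2 * m))"
    proof (subst ln_le_cancel_iff)
      show "real (2 * m choose m) \<le> 2 ^ (2 * m)"
        using binomial_le_pow2[of "2 * m" m] by (metis of_nat_le_iff of_nat_numeral of_nat_power)
    qed auto
    also have "\<dots> = 2 * real m * ln 2" by (simp add: ln_realpow)
    also have "\<dots> \<le> 2 * real m * (3/4)" using ln2_le_25_over_36 by (intro mult_left_mono) auto
    finally show ?thesis by simp
  qed
  show ?case
  proof (cases "N \<le> 1")
    case True
    hence "N = 0 \<or> N = 1" by auto
    thus ?thesis by auto
  next
    case False
    \<comment> \<open>Rounding up gives \<open>N \<le> 2 * m\<close>. The induction closes because
      \<open>3 * m + 3/2 * m \<le> 3 * N\<close> amounts to \<open>3 * m \<le> 2 * N\<close>, which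
      holds from \<open>N = 2\<close> on.\<close>
    define m where "m = (N + 1) div 2"
    have m: "m < N" "N \<le> 2 * m" "2 * m \<le> N + 1" using False by (auto simp: m_def)
    have "(\<Sum>d=1..N. Lam d) \<le> (\<Sum>d=1..2*m. Lam d)"
      using m mangoldt_nonneg by (intro sum_mono2) auto
    also have "\<dots> = (\<Sum>d=1..m. Lam d) + (\<Sum>d=Suc m..2*m. Lam d)"
    proof -
      have "{1..2*m} = {1..m} \<union> {Suc m..2*m}" by auto
      thus ?thesis by (simp only:) (subst sum.union_disjoint, auto)
    qed
    also have "\<dots> \<le> 3 * real m + 3/2 * real m" using less[OF m(1)] dbl[of m] by simp
    also have "\<dots> \<le> 3 * real N"
    proof -
      have "3 * m \<le> 2 * N" using False unfolding m_def by presburger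
      hence "3 * real m \<le> 2 * real N" by (metis of_nat_mono of_nat_mult of_nat_numeral)
      thus ?thesis by simp
    qed
    finally show ?thesis .
  qed
qed

lemma sum_mangoldt_div_bounds:
  assumes N: "N \<ge> 1"
  shows "ln (real N) - 1 \<le> (\<Sum>d=1..N. Lam d / real d)" "(\<Sum>d=1..N. Lam d / real d) \<le> ln (real N) + 3"
proof -
  have "real N * ln (real N) - real N \<le> (\<Sum>d=1..N. Lam d * real (N div d))"
    using ln_fact_ge[of N] by (simp add: ln_fact_eq_sum_mangoldt)
  also have "\<dots> \<le> (\<Sum>d=1..N. Lam d * (real N / real d))"
    by (intro sum_mono mult_left_mono mangoldt_nonneg) (rule of_nat_div_le_of_nat)
  also have "\<dots> = real N * (\<Sum>d=1..N. Lam d / real d)" by (simp add: sum_distrib_left mult_ac)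
  finally show "ln (real N) - 1 \<le> (\<Sum>d=1..N. Lam d / real d)"
    using N by (simp add: mult_le_cancel_left flip: right_diff_distrib[of "real N" _ 1, simplified])
  have "real N * (\<Sum>d=1..N. Lam d / real d) = (\<Sum>d=1..N. Lam d * (real N / real d))"
    by (simp add: sum_distrib_left mult_ac)
  also have "\<dots> \<le> (\<Sum>d=1..N. Lam d * (real (N div d) + 1))"
  proof (intro sum_mono mult_left_mono mangoldt_nonneg)
    fix d
    have "real (N div d) = of_int \<lfloor>real N / real d\<rfloor>" by (simp add: floor_divide_of_nat_eq)
    thus "real N / real d \<le> real (N div d) + 1" by linarith
  qed
  also have "\<dots> = (\<Sum>d=1..N. Lam d * real (N div d)) + (\<Sum>d=1..N. Lam d)"
    by (simp add: distrib_left sum.distrib)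
  also have "\<dots> \<le> real N * ln (real N) + 3 * real N"
    using ln_fact_le[of N] sum_mangoldt_le[of N] by (simp add: ln_fact_eq_sum_mangoldt)
  finally have "real N * (\<Sum>d=1..N. Lam d / real d) \<le> real N * (ln (real N) + 3)"
    by (simp add: algebra_simps)
  thus "(\<Sum>d=1..N. Lam d / real d) \<le> ln (real N) + 3" using N by simp
qed

text \<open>The Mangoldt sum differs from the sum over primes by the proper prime powers. For each
  \<open>p\<close> these form a geometric series of total \<open>ln p / (p * (p - 1))\<close>,
  dominated by the summable \<open>4 * p powr (- (3/2))\<close>.\<close>

lemma mertens_nat:
  "\<exists>C. \<forall>N\<ge>1. \<bar>(\<Sum>p | prime p \<and> p \<le> N. ln (real p) / real p) - ln (real N)\<bar> \<le> C"
proof -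
  define C where "C = (\<Sum>n. 4 * real (Suc n) powr (- (3/2)))"
  have sm: "summable (\<lambda>n. 4 * real (Suc n) powr (- (3/2)))"
    by (intro summable_mult summable_Suc_powr) simp
  have C0: "C \<ge> 0" unfolding C_def by (rule suminf_nonneg[OF sm]) auto
  show ?thesis
  proof (intro exI[of _ "C + 3"] allI impI)
    fix N :: nat assume N: "N \<ge> 1"
    define Pr where "Pr = {p. prime p \<and> p \<le> N}"
    have fin: "finite Pr" by (simp add: Pr_def)
    define A where "A = (\<Sum>p\<in>Pr. ln (real p) / real p)"
    have "A = (\<Sum>p\<in>Pr. Lam p / real p)" unfolding A_def Pr_def by (intro sum.cong refl) auto
    also have "\<dots> \<le> (\<Sum>d=1..N. Lam d / real d)"
      by (intro sum_mono2) (auto simp: Pr_def mangoldt_nonneg Suc_le_eq prime_gt_0_nat)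
    also have "\<dots> \<le> ln (real N) + 3" by (rule sum_mangoldt_div_bounds[OF N])
    finally have upper: "A \<le> ln (real N) + 3" .
    have "ln (real N) - 1 \<le> (\<Sum>d=1..N. Lam d / real d)" by (rule sum_mangoldt_div_bounds[OF N])
    also have "\<dots> = (\<Sum>d\<in>{d\<in>{1..N}. primepow d}. Lam d / real d)"
      by (intro sum.mono_neutral_right) (auto simp: mangoldt_def)
    also have "\<dots> \<le> (\<Sum>d\<in>(\<lambda>(p, k). p ^ k) ` (Pr \<times> {1..N}). Lam d / real d)"
    proof (intro sum_mono2)
      show "{d\<in>{1..N}. primepow d} \<subseteq> (\<lambda>(p, k). p ^ k) ` (Pr \<times> {1..N})"
      proof
        fix d assume d: "d \<in> {d\<in>{1..N}. primepow d}"
        then obtain p k where pk: "prime p" "k > 0" "d = p ^ k" by (auto simp: primepow_def)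
        have "p \<le> p ^ k" using pk prime_gt_0_nat[of p] by (intro self_le_power) auto
        moreover have "k < p ^ k" using pk prime_gt_1_nat[of p] by (intro power_gt_expt) auto
        ultimately have "(p, k) \<in> Pr \<times> {1..N}" using d pk by (auto simp: Pr_def)
        thus "d \<in> (\<lambda>(p, k). p ^ k) ` (Pr \<times> {1..N})" using pk by force
      qed
    qed (use fin mangoldt_nonneg in auto)
    also have "\<dots> \<le> (\<Sum>x\<in>Pr \<times> {1..N}. Lam (case x of (p, k) \<Rightarrow> p ^ k) / real (case x of (p, k) \<Rightarrow> p ^ k))"
      using fin by (intro sum_image_le[where g = "\<lambda>d. Lam d / real d", unfolded o_def]) (auto simp: mangoldt_nonneg)
    also have "\<dots> = (\<Sum>p\<in>Pr. \<Sum>k=1..N. Lam (p ^ k) / real (p ^ k))"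
      by (subst sum.cartesian_product) (simp add: case_prod_unfold)
    also have "\<dots> \<le> (\<Sum>p\<in>Pr. ln (real p) / real p + 4 * real p powr (- (3/2)))"
    proof (intro sum_mono)
      fix p assume "p \<in> Pr"
      hence p: "prime p" "p \<ge> 2" by (auto simp: Pr_def prime_ge_2_nat)
      have "(\<Sum>k=1..N. Lam (p ^ k) / real (p ^ k)) = (\<Sum>k=1..N. ln (real p) * (1 / real p) ^ k)"
        using p by (intro sum.cong refl) (auto simp: power_one_over divide_simps)
      also have "\<dots> = ln (real p) * (\<Sum>k=1..N. (1 / real p) ^ k)" by (simp add: sum_distrib_left)
      also have "\<dots> \<le> ln (real p) * (1 / (real p - 1))"
      proof (intro mult_left_mono)
        have s: "(\<lambda>k. (1 / real p) ^ k) sums (1 / (1 - 1 / real p))"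
          using p by (intro geometric_sums) auto
        have "(\<Sum>k=1..N. (1 / real p) ^ k) = (\<Sum>k\<le>N. (1 / real p) ^ k) - 1"
          by (simp add: atMost_atLeast0 sum.atLeast_Suc_atMost[of 0])
        also have "(\<Sum>k\<le>N. (1 / real p) ^ k) \<le> 1 / (1 - 1 / real p)"
          using sum_le_suminf[OF sums_summable[OF s], of "{..N}"] s by (simp add: sums_iff)
        also have "1 / (1 - 1 / real p) - 1 = 1 / (real p - 1)" using p by (simp add: field_simps)
        finally show "(\<Sum>k=1..N. (1 / real p) ^ k) \<le> 1 / (real p - 1)" by simp
      qed (use p in auto)
      also have "\<dots> = ln (real p) / real p + ln (real p) / (real p * (real p - 1))"
        using p by (simp add: field_simps)
      also have "ln (real p) / (real p * (real p - 1)) \<le> 4 * real p powr (- (3/2))"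
      proof -
        have "ln (real p) = 2 * ln (sqrt (real p))" using p by (simp add: ln_sqrt)
        also have "\<dots> \<le> 2 * sqrt (real p)" using ln_le_minus_one[of "sqrt (real p)"] p by simp
        finally have "ln (real p) \<le> 2 * sqrt (real p)" .
        moreover have "real p / 2 \<le> real p - 1" using p by simp
        ultimately have "ln (real p) / (real p * (real p - 1)) \<le> 2 * sqrt (real p) / (real p * (real p / 2))"
          using p by (intro frac_le mult_left_mono) auto
        also have "\<dots> = 4 * (real p powr (1/2) / real p powr 2)"
          using p by (simp add: powr_half_sqrt power2_eq_square)
        also have "\<dots> = 4 * real p powr (- (3/2))" by (simp only: powr_diff[symmetric]) simp
        finally show ?thesis .
      qed
      finally show "(\<Sum>k=1..N. Lam (p ^ k) / real (p ^ k)) \<le> ln (real p) / real p + 4 * real p powr (- (3/2))" by simp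
    qed
    also have "\<dots> = A + (\<Sum>p\<in>Pr. 4 * real p powr (- (3/2)))" by (simp add: A_def sum.distrib)
    also have "(\<Sum>p\<in>Pr. 4 * real p powr (- (3/2))) = (\<Sum>n\<in>(\<lambda>p. p - 1) ` Pr. 4 * real (Suc n) powr (- (3/2)))"
    proof (subst sum.reindex)
      show "inj_on (\<lambda>p. p - 1) Pr" 
        by (rule inj_onI) (auto simp: Pr_def dest!: prime_gt_0_nat)
    qed (auto intro!: sum.cong simp: Pr_def prime_gt_0_nat simp del: of_nat_Suc)
    also have "\<dots> \<le> C" unfolding C_def by (intro sum_le_suminf sm) (use fin in auto)
    finally show "\<bar>(\<Sum>p | prime p \<and> p \<le> N. ln (real p) / real p) - ln (real N)\<bar> \<le> C + 3"
      using upper C0 unfolding A_def Pr_def by linarith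
  qed
qed

text \<open>The error \<open>C\<close> does not depend on the position of the window. For a window
  of ratio \<open>exp B\<close> the mass is \<open>B\<close> up to \<open>C\<close>, so a large
  constant \<open>B\<close> makes the relative error as small as desired.\<close>

lemma mertens_window:
  "\<exists>C\<ge>1. \<forall>x y. 1 \<le> x \<longrightarrow> x \<le> y \<longrightarrow>
     \<bar>(\<Sum>p | prime p \<and> x < real p \<and> real p \<le> y. ln (real p) / real p) - ln (y / x)\<bar> \<le> C"
proof -
  obtain C where C: "\<And>N. N \<ge> 1 \<Longrightarrow> \<bar>(\<Sum>p | prime p \<and> p \<le> N. ln (real p) / real p) - ln (real N)\<bar> \<le> C"
    using mertens_nat by blast
  define A where "A = (\<lambda>x. \<Sum>p | prime p \<and> real p \<le> x. ln (real p) / real p)"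
  have fin: "finite {p. prime p \<and> real p \<le> x}" for x
    by (rule finite_subset[of _ "{..nat \<lfloor>x\<rfloor>}"]) (auto simp: le_nat_floor)
  have A: "\<bar>A x - ln x\<bar> \<le> C + 1" if x: "x \<ge> 1" for x
  proof -
    define N where "N = nat \<lfloor>x\<rfloor>"
    have "\<lfloor>x\<rfloor> \<ge> 1" using x by simp
    hence "real N = of_int \<lfloor>x\<rfloor>" "real_of_int \<lfloor>x\<rfloor> \<ge> 1" by (simp_all add: N_def)
    moreover from this have "N \<ge> 1" by (metis of_nat_1 of_nat_le_iff)
    ultimately have N: "N \<ge> 1" "real N \<le> x" "x \<le> 2 * real N" by linarith+
    have "A x = (\<Sum>p | prime p \<and> p \<le> N. ln (real p) / real p)"
      unfolding A_def N_def using x by (intro sum.cong) (auto simp: le_nat_floor le_nat_iff le_floor_iff)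
    moreover have "ln (real N) \<le> ln x" using N by simp
    moreover have "ln x \<le> ln (2 * real N)" using N x by (subst ln_le_cancel_iff) auto
    hence "ln x \<le> ln (real N) + 1" using N ln_le_minus_one[of 2] by (simp add: ln_mult)
    ultimately show ?thesis using C[OF N(1)] by linarith
  qed
  show ?thesis
  proof (intro exI[of _ "2 * (C + 1) + 1"] conjI allI impI)
    show "2 * (C + 1) + 1 \<ge> 1" using C[of 1] by simp
    fix x y :: real assume xy: "1 \<le> x" "x \<le> y"
    have "{p. prime p \<and> real p \<le> y} = {p. prime p \<and> real p \<le> x} \<union> {p. prime p \<and> x < real p \<and> real p \<le> y}"
      using xy by auto
    hence "A y = A x + (\<Sum>p | prime p \<and> x < real p \<and> real p \<le> y. ln (real p) / real p)"
      unfolding A_def using fin[of x] finite_subset[OF _ fin[of y]]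
      by (simp only:) (subst sum.union_disjoint, auto)
    thus "\<bar>(\<Sum>p | prime p \<and> x < real p \<and> real p \<le> y. ln (real p) / real p) - ln (y / x)\<bar> \<le> 2 * (C + 1) + 1"
      using A[of x] A[of y] xy by (simp add: ln_div)
  qed
qed

section \<open>The resonator and the Fejer kernel\<close>

lemma has_integral_cis:
  assumes "c \<noteq> 0" "a \<le> b"
  shows "((\<lambda>t. cis (c * t)) has_integral ((cis (c * b) - cis (c * a)) / (\<i> * of_real c))) {a..b}"
proof -
  have "((\<lambda>t. cis (c * t) * (1 / (\<i> * of_real c))) has_vector_derivative
     (c *\<^sub>R (\<i> * cis (c * t))) * (1 / (\<i> * of_real c))) (at t within {a..b})" for t
    by (intro has_vector_derivative_mult_left)
       (auto intro!: derivative_eq_intros simp: has_vector_derivative_def scaleR_conv_of_real mult_ac)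
  hence "((\<lambda>t. cis (c * t) * (1 / (\<i> * of_real c))) has_vector_derivative cis (c * t)) (at t within {a..b})" for t
    using assms by (simp add: scaleR_conv_of_real)
  from fundamental_theorem_of_calculus[OF assms(2) this] show ?thesis
    by (simp add: diff_divide_distrib)
qed

lemma norm_integral_cis_le:
  assumes "a \<le> b"
  shows "norm (integral {a..b} (\<lambda>t. cis (c * t))) \<le> b - a"
    and "c \<noteq> 0 \<Longrightarrow> norm (integral {a..b} (\<lambda>t. cis (c * t))) \<le> 2 / \<bar>c\<bar>"
proof -
  show "norm (integral {a..b} (\<lambda>t. cis (c * t))) \<le> b - a"
    using integral_bound[OF assms, of "\<lambda>t. cis (c * t)" 1] by (simp add: continuous_intros)
  assume c: "c \<noteq> 0"
  have "norm (integral {a..b} (\<lambda>t. cis (c * t))) = norm (cis (c * b) - cis (c * a)) / \<bar>c\<bar>"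
    by (simp add: integral_unique[OF has_integral_cis[OF c assms]] norm_divide norm_mult)
  also have "norm (cis (c * b) - cis (c * a)) \<le> norm (cis (c * b)) + norm (cis (c * a))"
    by (rule norm_triangle_ineq4)
  hence "norm (cis (c * b) - cis (c * a)) / \<bar>c\<bar> \<le> 2 / \<bar>c\<bar>" by (intro divide_right_mono) auto
  finally show "norm (integral {a..b} (\<lambda>t. cis (c * t))) \<le> 2 / \<bar>c\<bar>" .
qed

text \<open>The cosine transform of \<open>1 - t / T\<close> on \<open>{0..T}\<close>; the value at
  0 is the limit of the other branch.\<close>

definition fejer :: "real \<Rightarrow> real \<Rightarrow> real" where
  "fejer T \<xi> = (if \<xi> = 0 then T / 2 else (1 - cos (T * \<xi>)) / (T * \<xi>\<^sup>2))"

lemma has_integral_fejer: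
  assumes T: "T > 0"
  shows "((\<lambda>t. (1 - t / T) * cos (\<xi> * t)) has_integral fejer T \<xi>) {0..T}"
proof (cases "\<xi> = 0")
  case True
  have "((\<lambda>t. 1 - t / T) has_integral ((T - T\<^sup>2 / (2 * T)) - (0 - 0\<^sup>2 / (2 * T)))) {0..T}"
    using T by (intro fundamental_theorem_of_calculus)
      (auto intro!: derivative_eq_intros simp: has_real_derivative_iff_has_vector_derivative[symmetric])
  thus ?thesis using True T by (simp add: fejer_def power2_eq_square)
next
  case False
  define G where "G = (\<lambda>t. (1 - t / T) * (sin (\<xi> * t) / \<xi>) - cos (\<xi> * t) / (T * \<xi>\<^sup>2))"
  have "(G has_real_derivative ((1 - t / T) * cos (\<xi> * t))) (at t within {0..T})" for t
    unfolding G_def by (rule derivative_eq_intros refl | use T False in \<open>simp add: field_simps power2_eq_square\<close>)+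
  hence "((\<lambda>t. (1 - t / T) * cos (\<xi> * t)) has_integral (G T - G 0)) {0..T}"
    using T by (intro fundamental_theorem_of_calculus) (auto simp: has_real_derivative_iff_has_vector_derivative)
  also have "G T - G 0 = fejer T \<xi>"
    using T False by (simp add: G_def fejer_def diff_divide_distrib mult.commute)
  finally show ?thesis .
qed

lemma fejer_nonneg: "T > 0 \<Longrightarrow> fejer T \<xi> \<ge> 0"
  by (simp add: fejer_def)

lemma one_minus_cos_ge:
  assumes "\<bar>x::real\<bar> \<le> 1" shows "x\<^sup>2 / 4 \<le> 1 - cos x"
proof -
  define y where "y = \<bar>x\<bar> / 2"
  have y: "0 \<le> y" "y \<le> 1/2" using assms by (auto simp: y_def)
  have "\<bar>sin y - (\<Sum>m<3. sin_coeff m * y ^ m)\<bar> \<le> inverse (fact 3) * \<bar>y\<bar> ^ 3"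
    by (rule Maclaurin_sin_bound)
  hence "\<bar>sin y - y\<bar> \<le> y ^ 3 / 6"
    using y by (simp add: sin_coeff_def numeral_3_eq_3 fact_numeral)
  hence "y - sin y \<le> y ^ 3 / 6" by linarith
  also have "y ^ 3 / 6 \<le> y / 4"
  proof -
    have "y * y \<le> 1/2 * (1/2)" using y by (intro mult_mono) auto
    hence "y * (y * y) \<le> y * (1/4)" using y by (intro mult_left_mono) auto
    thus ?thesis using y by (simp add: power3_eq_cube mult.assoc)
  qed
  finally have "sin y \<ge> 3/4 * y" by simp
  hence "(3/4 * y)\<^sup>2 \<le> (sin y)\<^sup>2" using y by (intro power_mono) auto
  moreover have "cos (2 * y) = 1 - 2 * (sin y)\<^sup>2" by (rule cos_double_sin)
  moreover have "cos (2 * y) = cos x" by (auto simp: y_def abs_if)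
  moreover have "y\<^sup>2 = x\<^sup>2 / 4" by (simp add: y_def power_divide)
  moreover have "(3/4 * y)\<^sup>2 = 9/16 * y\<^sup>2" by (simp add: power_mult_distrib power_divide)
  ultimately show ?thesis using zero_le_power2[of x] by linarith
qed

lemma fejer_ge:
  assumes T: "T > 0" and "\<bar>T * \<xi>\<bar> \<le> 1"
  shows "fejer T \<xi> \<ge> T / 4"
proof (cases "\<xi> = 0")
  case False
  have "T / 4 = (T * \<xi>)\<^sup>2 / 4 / (T * \<xi>\<^sup>2)" using T False by (simp add: power2_eq_square)
  also have "\<dots> \<le> (1 - cos (T * \<xi>)) / (T * \<xi>\<^sup>2)"
    using T by (intro divide_right_mono one_minus_cos_ge assms) auto
  finally show ?thesis using False by (simp add: fejer_def)
qed (use T in \<open>simp add: fejer_def\<close>)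

section \<open>The resonator with rounded frequencies and its moments\<close>

locale resonator =
  fixes M :: "'a set" and g lam :: "'a \<Rightarrow> real" and T :: real
  assumes fin: "finite M" and g_nonneg: "\<And>u. u \<in> M \<Longrightarrow> g u \<ge> 0" and T: "T > 0"
begin

text \<open>The frequency \<open>lam u\<close> is rounded down to a multiple of
  \<open>1 / T\<close>, and all elements of a bin are merged into one term. Merging by the square
  root of the sum of squares preserves the total square mass \<open>S0\<close>.\<close>

definition bin :: "'a \<Rightarrow> int" where "bin u = \<lfloor>T * lam u\<rfloor>"
definition coef :: "int \<Rightarrow> real" where "coef j = sqrt (\<Sum>u\<in>{u\<in>M. bin u = j}. (g u)\<^sup>2)"
definition S0 :: real where "S0 = (\<Sum>u\<in>M. (g u)\<^sup>2)"
definition R :: "real \<Rightarrow> complex" where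
  "R t = (\<Sum>j\<in>bin ` M. of_real (coef j) * cis (of_int j / T * t))"
definition P :: "real \<Rightarrow> real" where "P t = (norm (R t))\<^sup>2"

lemma coef_nonneg: "coef j \<ge> 0" by (simp add: coef_def sum_nonneg)

lemma sum_coef_sq: "(\<Sum>j\<in>bin ` M. (coef j)\<^sup>2) = S0"
proof -
  have "(\<Sum>j\<in>bin ` M. (coef j)\<^sup>2) = (\<Sum>j\<in>bin ` M. \<Sum>u\<in>{u\<in>M. bin u = j}. (g u)\<^sup>2)"
    by (simp add: coef_def sum_nonneg)
  also have "\<dots> = S0" unfolding S0_def by (rule sum.image_gen[OF fin, symmetric])
  finally show ?thesis .
qed

lemma sum_coef_le: "(\<Sum>j\<in>bin ` M. coef j)\<^sup>2 \<le> card M * S0"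
proof -
  have "(\<Sum>j\<in>bin ` M. coef j)\<^sup>2 \<le> (\<Sum>j\<in>bin ` M. (coef j)\<^sup>2) * card (bin ` M)"
    by (rule sum_squared_le_sum_of_squares)
  also have "\<dots> \<le> S0 * card M"
    unfolding sum_coef_sq using card_image_le[OF fin] by (intro mult_left_mono) (auto simp: S0_def sum_nonneg)
  finally show ?thesis by (simp add: mult.commute)
qed

lemma P_nonneg: "P t \<ge> 0" by (simp add: P_def)

lemma P_le: "P t \<le> card M * S0"
proof -
  have "norm (R t) \<le> (\<Sum>j\<in>bin ` M. coef j)"
    unfolding R_def by (rule sum_norm_le) (simp add: norm_mult coef_nonneg)
  hence "P t \<le> (\<Sum>j\<in>bin ` M. coef j)\<^sup>2" unfolding P_def by (intro power_mono) auto
  thus ?thesis using sum_coef_le by simp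
qed

lemma continuous_P: "continuous_on A P"
  unfolding P_def[abs_def] R_def[abs_def] by (intro continuous_intros) (use T in auto)

lemma P_eq:
  "of_real (P t) = (\<Sum>i\<in>bin ` M. \<Sum>j\<in>bin ` M. of_real (coef i * coef j) * cis (of_int (i - j) / T * t))"
proof -
  have "of_real (P t) = R t * cnj (R t)" unfolding P_def by (rule complex_norm_square)
  also have "\<dots> = (\<Sum>i\<in>bin ` M. \<Sum>j\<in>bin ` M. (of_real (coef i) * cis (of_int i / T * t)) *
      cnj (of_real (coef j) * cis (of_int j / T * t)))"
    unfolding R_def cnj_sum by (rule sum_product)
  also have "\<dots> = (\<Sum>i\<in>bin ` M. \<Sum>j\<in>bin ` M. of_real (coef i * coef j) * cis (of_int (i - j) / T * t))"
  proof (intro sum.cong refl)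
    fix i j
    have "cis (of_int (i - j) / T * t) = cis (of_int i / T * t) * cnj (cis (of_int j / T * t))"
      by (simp add: cis_cnj cis_mult diff_divide_distrib left_diff_distrib)
    thus "(of_real (coef i) * cis (of_int i / T * t)) * cnj (of_real (coef j) * cis (of_int j / T * t)) =
      of_real (coef i * coef j) * cis (of_int (i - j) / T * t)" by simp
  qed
  finally show ?thesis .
qed

text \<open>All frequencies are multiples of \<open>1 / T\<close>, so \<open>2 * pi * T\<close> is a
  common period over which distinct frequencies are exactly orthogonal.\<close>

lemma integral_P: "(P has_integral (2 * pi * T * S0)) {0..2 * pi * T}"
proof -
  have "((\<lambda>t. cis (of_int (i - j) / T * t)) has_integral (if i = j then of_real (2 * pi * T) else 0)) {0..2 * pi * T}" for i j
  proof (cases "i = j")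
    case True
    thus ?thesis using has_integral_const_real[of "1::complex" 0 "2 * pi * T"] T by (simp add: scaleR_conv_of_real)
  next
    case False
    have "of_int (i - j) / T * (2 * pi * T) = 2 * pi * of_int (i - j)" using T by simp
    hence "cis (of_int (i - j) / T * (2 * pi * T)) = 1" by (simp only: cis_multiple_2pi Ints_of_int)
    thus ?thesis using has_integral_cis[of "of_int (i - j) / T" 0 "2 * pi * T"] False T by simp
  qed
  hence "((\<lambda>t. \<Sum>i\<in>bin ` M. \<Sum>j\<in>bin ` M. of_real (coef i * coef j) * cis (of_int (i - j) / T * t)) has_integral
     (\<Sum>i\<in>bin ` M. \<Sum>j\<in>bin ` M. of_real (coef i * coef j) * (if i = j then of_real (2 * pi * T) else 0))) {0..2 * pi * T}"
    by (intro has_integral_sum finite_imageI fin has_integral_mult_right)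
  also have "(\<Sum>i\<in>bin ` M. \<Sum>j\<in>bin ` M. complex_of_real (coef i * coef j) * (if i = j then of_real (2 * pi * T) else 0)) =
     of_real (\<Sum>i\<in>bin ` M. (coef i)\<^sup>2 * (2 * pi * T))"
    unfolding of_real_sum
  proof (intro sum.cong refl)
    fix i assume i: "i \<in> bin ` M"
    have "(\<Sum>j\<in>bin ` M. complex_of_real (coef i * coef j) * (if i = j then of_real (2 * pi * T) else 0)) =
       (\<Sum>j\<in>bin ` M. if j = i then complex_of_real ((coef i)\<^sup>2 * (2 * pi * T)) else 0)"
      by (intro sum.cong refl) (auto simp: power2_eq_square)
    also have "\<dots> = of_real ((coef i)\<^sup>2 * (2 * pi * T))"
      by (subst sum.delta) (use fin i in auto)
    finally show "(\<Sum>j\<in>bin ` M. complex_of_real (coef i * coef j) * (if i = j then of_real (2 * pi * T) else 0)) = \<dots>" .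
  qed
  also have "(\<Sum>i\<in>bin ` M. (coef i)\<^sup>2 * (2 * pi * T)) = 2 * pi * T * S0"
    by (simp add: sum_distrib_right[symmetric] sum_coef_sq)
  finally have "((\<lambda>t. complex_of_real (P t)) has_integral of_real (2 * pi * T * S0)) {0..2 * pi * T}"
    unfolding P_eq .
  from has_integral_Re[OF this] show ?thesis by (simp add: o_def)
qed

text \<open>Each pair of frequencies costs \<open>Q\<close>, and Cauchy-Schwarz bounds the sum of
  the coefficient products. This is where the number of terms enters the error.\<close>

lemma norm_integral_mult_P_le:
  fixes F :: "real \<Rightarrow> complex"
  assumes F: "continuous_on {a..b} F"
    and Q: "\<And>\<mu>. norm (integral {a..b} (\<lambda>t. F t * cis (\<mu> * t))) \<le> Q"
  shows "norm (integral {a..b} (\<lambda>t. F t * of_real (P t))) \<le> Q * (card M * S0)"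
proof -
  have Q0: "Q \<ge> 0" using Q[of 0] norm_ge_zero order_trans by blast
  define I where "I = (\<lambda>i j. integral {a..b} (\<lambda>t. F t * cis (of_int (i - j) / T * t)))"
  have "((\<lambda>t. \<Sum>i\<in>bin ` M. \<Sum>j\<in>bin ` M. of_real (coef i * coef j) * (F t * cis (of_int (i - j) / T * t)))
     has_integral (\<Sum>i\<in>bin ` M. \<Sum>j\<in>bin ` M. of_real (coef i * coef j) * I i j)) {a..b}"
    unfolding I_def
    by (intro has_integral_sum finite_imageI fin has_integral_mult_right integrable_integral
          integrable_continuous_interval continuous_intros F) (use T in auto)
  moreover have "F t * of_real (P t) =
     (\<Sum>i\<in>bin ` M. \<Sum>j\<in>bin ` M. of_real (coef i * coef j) * (F t * cis (of_int (i - j) / T * t)))" for t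
    unfolding P_eq sum_distrib_left by (simp only: mult_ac)
  ultimately have eq: "integral {a..b} (\<lambda>t. F t * of_real (P t)) =
     (\<Sum>i\<in>bin ` M. \<Sum>j\<in>bin ` M. of_real (coef i * coef j) * I i j)"
    by (simp only: integral_unique)
  have "norm (integral {a..b} (\<lambda>t. F t * of_real (P t))) \<le> (\<Sum>i\<in>bin ` M. \<Sum>j\<in>bin ` M. coef i * coef j * Q)"
    unfolding eq
  proof (intro order_trans[OF norm_sum] sum_mono)
    fix i j
    show "norm (complex_of_real (coef i * coef j) * I i j) \<le> coef i * coef j * Q"
      unfolding norm_mult norm_of_real I_def using coef_nonneg by (intro mult_mono Q) (auto simp: abs_mult)
  qed
  also have "(\<Sum>i\<in>bin ` M. \<Sum>j\<in>bin ` M. coef i * coef j * Q) = (\<Sum>j\<in>bin ` M. coef j)\<^sup>2 * Q"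
    unfolding power2_eq_square sum_product by (simp only: sum_distrib_right)
  also have "(\<Sum>j\<in>bin ` M. coef j)\<^sup>2 * Q \<le> (card M * S0) * Q" by (intro mult_right_mono sum_coef_le Q0)
  finally show ?thesis by (simp only: mult.commute)
qed

text \<open>Cauchy-Schwarz on the elements that \<open>h\<close> carries from bin \<open>i\<close>
  to bin \<open>j\<close>: merging by square sums loses nothing against the sum over matched pairs.
  Injectivity of \<open>h\<close> ensures that no image is counted twice.\<close>

lemma coef_prod_ge:
  assumes A: "A \<subseteq> M" "inj_on h A" "h ` A \<subseteq> M"
  shows "(\<Sum>u\<in>{u\<in>A. bin u = i \<and> bin (h u) = j}. g u * g (h u)) \<le> coef i * coef j"
proof -
  define B where "B = {u\<in>A. bin u = i \<and> bin (h u) = j}"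
  have B: "B \<subseteq> A" "finite B" using A fin by (auto simp: B_def intro: finite_subset)
  have "(\<Sum>u\<in>B. g u * g (h u)) = (\<Sum>u\<in>B. \<bar>g u\<bar> * \<bar>g (h u)\<bar>)"
    using A B g_nonneg by (intro sum.cong refl) (auto simp: subset_iff image_subset_iff)
  also have "\<dots> \<le> L2_set g B * L2_set (g \<circ> h) B"
    using L2_set_mult_ineq[of g "g \<circ> h" B] by simp
  also have "\<dots> \<le> coef i * coef j"
  proof (intro mult_mono)
    show "L2_set g B \<le> coef i" unfolding L2_set_def coef_def
      using A fin by (intro real_sqrt_le_mono sum_mono2) (auto simp: B_def)
    have "(\<Sum>u\<in>B. ((g \<circ> h) u)\<^sup>2) = (\<Sum>v\<in>h ` B. (g v)\<^sup>2)"
      using A B by (subst sum.reindex) (auto intro: inj_on_subset)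
    also have "\<dots> \<le> (\<Sum>u\<in>{u\<in>M. bin u = j}. (g u)\<^sup>2)"
      using A fin by (intro sum_mono2) (auto simp: B_def)
    finally show "L2_set (g \<circ> h) B \<le> coef j" unfolding L2_set_def coef_def by (rule real_sqrt_le_mono)
  qed (auto simp: coef_nonneg)
  finally show ?thesis by (simp add: B_def)
qed

text \<open>Expanding \<open>P\<close> writes the real part as a sum over pairs of bins of products
  of coefficients with values of the Fejer kernel, all nonnegative. Only the pairs
  \<open>(u, h u)\<close>, whose frequencies differ by \<open>\<xi>\<close>, are kept.\<close>

lemma fejer_P_ge:
  assumes A: "A \<subseteq> M" "inj_on h A" "h ` A \<subseteq> M" and lam: "\<And>u. u \<in> A \<Longrightarrow> lam (h u) = lam u + \<xi>"
  shows "Re (integral {0..T} (\<lambda>t. cis (- \<xi> * t) * of_real (P t) * of_real (1 - t / T))) \<ge>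
    T / 4 * (\<Sum>u\<in>A. g u * g (h u))"
proof -
  define J where "J = bin ` M"
  have J: "finite J" using fin by (simp add: J_def)
  define c where "c = (\<lambda>(i, j). of_int (j - i) / T - \<xi>)"
  have "((\<lambda>t. \<Sum>p\<in>J \<times> J. coef (snd p) * coef (fst p) * ((1 - t / T) * cos (c p * t))) has_integral
      (\<Sum>p\<in>J \<times> J. coef (snd p) * coef (fst p) * fejer T (c p))) {0..T}"
    using J by (intro has_integral_sum has_integral_mult_right has_integral_fejer T) auto
  moreover have "(\<Sum>p\<in>J \<times> J. coef (snd p) * coef (fst p) * ((1 - t / T) * cos (c p * t))) =
     Re (cis (- \<xi> * t) * of_real (P t) * of_real (1 - t / T))" for t
  proof -
    have "cis (- \<xi> * t) * of_real (P t) * of_real (1 - t / T) =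
      (\<Sum>j\<in>J. \<Sum>i\<in>J. of_real (coef j * coef i * (1 - t / T)) * cis (c (i, j) * t))"
      unfolding P_eq J_def sum_distrib_left sum_distrib_right
    proof (intro sum.cong refl)
      fix j i
      have "cis (c (i, j) * t) = cis (- \<xi> * t) * cis (of_int (j - i) / T * t)"
        by (simp add: c_def cis_mult left_diff_distrib)
      thus "cis (- \<xi> * t) * (of_real (coef j * coef i) * cis (of_int (j - i) / T * t)) * of_real (1 - t / T) =
         of_real (coef j * coef i * (1 - t / T)) * cis (c (i, j) * t)"
        by (simp only: of_real_mult mult_ac)
    qed
    hence "Re (cis (- \<xi> * t) * of_real (P t) * of_real (1 - t / T)) =
      Re (\<Sum>j\<in>J. \<Sum>i\<in>J. of_real (coef j * coef i * (1 - t / T)) * cis (c (i, j) * t))" by (rule arg_cong)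
    also have "\<dots> = (\<Sum>j\<in>J. \<Sum>i\<in>J. coef j * coef i * ((1 - t / T) * cos (c (i, j) * t)))"
      unfolding Re_sum by (intro sum.cong refl) simp
    also have "\<dots> = (\<Sum>p\<in>J \<times> J. coef (snd p) * coef (fst p) * ((1 - t / T) * cos (c p * t)))"
    proof -
      have "(\<Sum>j\<in>J. \<Sum>i\<in>J. coef j * coef i * ((1 - t / T) * cos (c (i, j) * t))) =
        (\<Sum>i\<in>J. \<Sum>j\<in>J. coef j * coef i * ((1 - t / T) * cos (c (i, j) * t)))" by (rule sum.swap)
      also have "\<dots> = (\<Sum>(i, j)\<in>J \<times> J. coef j * coef i * ((1 - t / T) * cos (c (i, j) * t)))"
        by (rule sum.cartesian_product)
      finally show ?thesis by (simp only: case_prod_unfold prod.collapse)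
    qed
    finally show ?thesis by simp
  qed
  ultimately have I: "((\<lambda>t. Re (cis (- \<xi> * t) * of_real (P t) * of_real (1 - t / T))) has_integral
      (\<Sum>p\<in>J \<times> J. coef (snd p) * coef (fst p) * fejer T (c p))) {0..T}" by (simp only:)
  have int: "(\<lambda>t. cis (- \<xi> * t) * of_real (P t) * of_real (1 - t / T)) integrable_on {0..T}"
    by (intro integrable_continuous_interval continuous_intros continuous_P) (use T in auto)
  have "Re (integral {0..T} (\<lambda>t. cis (- \<xi> * t) * of_real (P t) * of_real (1 - t / T))) =
      (\<Sum>p\<in>J \<times> J. coef (snd p) * coef (fst p) * fejer T (c p))"
    using has_integral_unique[OF I] has_integral_Re[OF integrable_integral[OF int]] by (simp add: o_def)
  moreover have "T / 4 * (\<Sum>u\<in>A. g u * g (h u)) \<le> \<dots>"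
  proof -
    define q where "q = (\<lambda>u. (bin u, bin (h u)))"
    have fA: "finite A" using A fin finite_subset by blast
    have qA: "q ` A \<subseteq> J \<times> J" using A by (auto simp: q_def J_def)
    have "T / 4 * (\<Sum>u\<in>A. g u * g (h u)) = (\<Sum>p\<in>q ` A. T / 4 * (\<Sum>u\<in>{u\<in>A. q u = p}. g u * g (h u)))"
      by (subst sum.image_gen[OF fA, of _ q]) (simp add: sum_distrib_left)
    also have "\<dots> \<le> (\<Sum>p\<in>q ` A. coef (snd p) * coef (fst p) * fejer T (c p))"
    proof (rule sum_mono)
      fix p assume "p \<in> q ` A"
      then obtain u where u: "u \<in> A" "p = (bin u, bin (h u))" by (auto simp: q_def)
      \<comment> \<open>The two roundings change the difference of frequencies by at most
        \<open>1 / T\<close>, so the kernel is evaluated where it is at least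
        \<open>T / 4\<close>.\<close>
      have "T * c p = of_int \<lfloor>T * lam u + T * \<xi>\<rfloor> - of_int \<lfloor>T * lam u\<rfloor> - T * \<xi>"
        using T lam[OF u(1)] by (simp add: u c_def bin_def field_simps)
      hence "\<bar>T * c p\<bar> \<le> 1" by linarith
      hence "T / 4 \<le> fejer T (c p)" by (rule fejer_ge[OF T])
      moreover have "(\<Sum>u\<in>{u\<in>A. q u = p}. g u * g (h u)) \<le> coef (fst p) * coef (snd p)"
        using coef_prod_ge[OF A, of "fst p" "snd p"] by (simp add: q_def prod_eq_iff)
      ultimately have "T / 4 * (\<Sum>u\<in>{u\<in>A. q u = p}. g u * g (h u)) \<le> fejer T (c p) * (coef (fst p) * coef (snd p))"
      proof (intro mult_mono)
        show "0 \<le> (\<Sum>u\<in>{u\<in>A. q u = p}. g u * g (h u))"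
          by (intro sum_nonneg mult_nonneg_nonneg g_nonneg) (use A in auto)
      qed (use fejer_nonneg[OF T] in auto)
      thus "T / 4 * (\<Sum>u\<in>{u\<in>A. q u = p}. g u * g (h u)) \<le> coef (snd p) * coef (fst p) * fejer T (c p)"
        by (simp add: mult_ac)
    qed
    also have "\<dots> \<le> (\<Sum>p\<in>J \<times> J. coef (snd p) * coef (fst p) * fejer T (c p))"
      using J qA coef_nonneg fejer_nonneg[OF T] by (intro sum_mono2) auto
    finally show ?thesis .
  qed
  ultimately show ?thesis by simp
qed

end

section \<open>Counting and truncating the resonator\<close>

lemma sum_Pow_prod:
  fixes z :: "'a \<Rightarrow> real"
  assumes "finite P"
  shows "(\<Sum>U\<in>Pow P. \<Prod>p\<in>U. z p) = (\<Prod>p\<in>P. 1 + z p)"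
  using prod_add[OF assms, of z "\<lambda>_. 1"] by (simp add: add.commute)

text \<open>Each \<open>p\<close> lies outside \<open>U\<close>, in \<open>U - K\<close> or in
  \<open>K\<close>, which contributes the factor 1, \<open>x p\<close> or
  \<open>y p\<close>.\<close>

lemma sum_Pow_Pow_prod:
  fixes x y :: "'a \<Rightarrow> real"
  assumes "finite P"
  shows "(\<Sum>U\<in>Pow P. \<Sum>K\<in>Pow U. (\<Prod>p\<in>K. y p) * (\<Prod>p\<in>U - K. x p)) = (\<Prod>p\<in>P. 1 + x p + y p)"
proof -
  have "(\<Sum>K\<in>Pow U. (\<Prod>p\<in>K. y p) * (\<Prod>p\<in>U - K. x p)) = (\<Prod>p\<in>U. y p + x p)" if "U \<in> Pow P" for U
    using that assms by (subst prod_add) (auto intro: finite_subset)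
  hence "(\<Sum>U\<in>Pow P. \<Sum>K\<in>Pow U. (\<Prod>p\<in>K. y p) * (\<Prod>p\<in>U - K. x p)) = (\<Sum>U\<in>Pow P. \<Prod>p\<in>U. y p + x p)"
    by (intro sum.cong refl)
  also have "\<dots> = (\<Prod>p\<in>P. 1 + (y p + x p))" by (rule sum_Pow_prod[OF assms])
  finally show ?thesis by (simp add: add_ac)
qed

text \<open>The cap is imposed on each class separately: this keeps the family closed under subsets
  and adapts the count to the very different sizes of the classes.\<close>

definition few_per_class :: "'a set \<Rightarrow> ('a \<Rightarrow> nat) \<Rightarrow> nat set \<Rightarrow> (nat \<Rightarrow> real) \<Rightarrow> 'a set set" where
  "few_per_class P cl I \<alpha> = {U \<in> Pow P. \<forall>k\<in>I. real (card {p\<in>U. cl p = k}) \<le> \<alpha> k}"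

text \<open>Rankin's trick: each element of class \<open>k\<close> is given the weight
  \<open>\<xi> k\<close>, at most 1. The caps bound the weight of every admissible set from below,
  while all subsets of \<open>P\<close> together weigh at most the exponential of the sum of the
  \<open>\<xi> (cl p)\<close>.\<close>

lemma card_few_per_class_le:
  fixes \<xi> :: "nat \<Rightarrow> real"
  assumes P: "finite P" and I: "finite I" "cl ` P \<subseteq> I" and \<xi>: "\<And>k. 0 < \<xi> k" "\<And>k. \<xi> k \<le> 1"
  shows "real (card (few_per_class P cl I \<alpha>)) \<le> exp ((\<Sum>k\<in>I. \<alpha> k * ln (1 / \<xi> k)) + (\<Sum>p\<in>P. \<xi> (cl p)))"
proof -
  define M where "M = few_per_class P cl I \<alpha>"
  have MP: "M \<subseteq> Pow P" by (auto simp: M_def few_per_class_def)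
  define c where "c = (\<lambda>U k. real (card {p\<in>U. cl p = k}))"
  have one: "1 \<le> exp (\<Sum>k\<in>I. \<alpha> k * ln (1 / \<xi> k)) * (\<Prod>p\<in>U. \<xi> (cl p))" if U: "U \<in> M" for U
  proof -
    have fU: "finite U" and clU: "cl ` U \<subseteq> I" using U MP P I(2) by (auto intro: finite_subset)
    have "(\<Prod>p\<in>U. \<xi> (cl p)) = exp (\<Sum>p\<in>U. ln (\<xi> (cl p)))"
      by (subst exp_sum[OF fU]) (simp add: \<xi>)
    also have "(\<Sum>p\<in>U. ln (\<xi> (cl p))) = (\<Sum>k\<in>I. \<Sum>p\<in>{p\<in>U. cl p = k}. ln (\<xi> (cl p)))"
      by (rule sum.group[OF fU I(1) clU, symmetric])
    also have "\<dots> = (\<Sum>k\<in>I. c U k * ln (\<xi> k))" by (intro sum.cong refl) (simp add: c_def)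
    finally have e: "exp (\<Sum>k\<in>I. \<alpha> k * ln (1 / \<xi> k)) * (\<Prod>p\<in>U. \<xi> (cl p)) =
       exp ((\<Sum>k\<in>I. \<alpha> k * ln (1 / \<xi> k)) + (\<Sum>k\<in>I. c U k * ln (\<xi> k)))" by (simp add: exp_add)
    have "(\<Sum>k\<in>I. \<alpha> k * ln (1 / \<xi> k)) + (\<Sum>k\<in>I. c U k * ln (\<xi> k)) = (\<Sum>k\<in>I. (\<alpha> k - c U k) * (- ln (\<xi> k)))"
      by (simp add: sum.distrib[symmetric] ln_div \<xi> \<xi>(1)[THEN less_imp_neq, THEN not_sym] algebra_simps)
    also have "\<dots> \<ge> 0"
    proof (rule sum_nonneg)
      fix k assume "k \<in> I"
      hence "c U k \<le> \<alpha> k" using U by (auto simp: M_def few_per_class_def c_def)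
      moreover have "ln (\<xi> k) \<le> 0" using \<xi>[of k] by simp
      ultimately show "0 \<le> (\<alpha> k - c U k) * (- ln (\<xi> k))" by (intro mult_nonneg_nonneg) auto
    qed
    finally show ?thesis unfolding e by simp
  qed
  have "real (card M) = (\<Sum>U\<in>M. 1)" by simp
  also have "\<dots> \<le> (\<Sum>U\<in>M. exp (\<Sum>k\<in>I. \<alpha> k * ln (1 / \<xi> k)) * (\<Prod>p\<in>U. \<xi> (cl p)))" by (intro sum_mono one)
  also have "\<dots> \<le> (\<Sum>U\<in>Pow P. exp (\<Sum>k\<in>I. \<alpha> k * ln (1 / \<xi> k)) * (\<Prod>p\<in>U. \<xi> (cl p)))"
  proof (rule sum_mono2)
    show "0 \<le> exp (\<Sum>k\<in>I. \<alpha> k * ln (1 / \<xi> k)) * (\<Prod>p\<in>U. \<xi> (cl p))" for U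
      by (intro mult_nonneg_nonneg prod_nonneg) (auto intro: less_imp_le \<xi>)
  qed (use P MP in auto)
  also have "\<dots> = exp (\<Sum>k\<in>I. \<alpha> k * ln (1 / \<xi> k)) * (\<Prod>p\<in>P. 1 + \<xi> (cl p))"
    by (simp add: sum_distrib_left[symmetric] sum_Pow_prod[OF P])
  also have "(\<Prod>p\<in>P. 1 + \<xi> (cl p)) \<le> (\<Prod>p\<in>P. exp (\<xi> (cl p)))"
    by (intro prod_mono) (auto simp: add_nonneg_nonneg less_imp_le \<xi>)
  also have "\<dots> = exp (\<Sum>p\<in>P. \<xi> (cl p))" by (simp add: exp_sum P)
  finally show ?thesis by (simp add: M_def exp_add)
qed

section \<open>Weighted sums over pairs of sets and the loss from truncating them\<close>

locale rankin =
  fixes P :: "nat set" and cl :: "nat \<Rightarrow> nat" and I :: "nat set" and \<alpha> :: "nat \<Rightarrow> real"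
    and x y :: "nat \<Rightarrow> real"
  assumes P: "finite P" and I: "finite I" "cl ` P \<subseteq> I"
    and x: "\<And>p. x p \<ge> 0" and y: "\<And>p. y p \<ge> 0" and pos: "\<And>p. p \<in> P \<Longrightarrow> p > 0"
begin

text \<open>With \<open>x p\<close> the square of the resonator coefficient at \<open>p\<close> and
  \<open>y p\<close> that coefficient divided by \<open>sqrt p\<close>, this is the contribution to
  the resonance sum of the integer with prime set \<open>K\<close>, which links the resonator terms
  \<open>U - K\<close> and \<open>U\<close>.\<close>

definition wt :: "nat set \<Rightarrow> nat set \<Rightarrow> real" where
  "wt U K = (\<Prod>p\<in>K. y p) * (\<Prod>p\<in>U - K. x p)"

definition tot :: real where "tot = (\<Prod>p\<in>P. 1 + x p + y p)"

lemma wt_nonneg: "wt U K \<ge> 0" unfolding wt_def using x y by (intro mult_nonneg_nonneg prod_nonneg) auto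

lemma tot_pos: "tot > 0" unfolding tot_def using x y by (intro prod_pos) (simp add: add_pos_nonneg)

text \<open>The weight of every element of class \<open>k\<close> is inflated by \<open>b\<close>.
  An overfull set gains at least \<open>b powr \<alpha> k\<close>, whereas the total over all sets
  grows by at most the exponential of \<open>b - 1\<close> times the mass of the class.\<close>

lemma overfull_class_le:
  assumes b: "b \<ge> 1"
  shows "(\<Sum>U\<in>{U\<in>Pow P. real (card {p\<in>U. cl p = k}) > \<alpha> k}. \<Sum>K\<in>Pow U. wt U K) \<le>
    tot * exp (- \<alpha> k * ln b + (b - 1) * (\<Sum>p\<in>{p\<in>P. cl p = k}. x p + y p))"
proof -
  define B where "B = {U\<in>Pow P. real (card {p\<in>U. cl p = k}) > \<alpha> k}"
  define z where "z = (\<lambda>p. y p + x p)"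
  define d where "d = (\<lambda>p. if cl p = k then b else 1)"
  have z: "z p \<ge> 0" for p using x y by (simp add: z_def)
  have d: "d p \<ge> 1" for p using b by (simp add: d_def)
  have "(\<Sum>U\<in>B. \<Sum>K\<in>Pow U. wt U K) = (\<Sum>U\<in>B. \<Prod>p\<in>U. z p)"
    unfolding wt_def z_def using P
    by (intro sum.cong refl, subst prod_add) (auto simp: B_def intro: finite_subset)
  also have "\<dots> \<le> (\<Sum>U\<in>B. exp (- \<alpha> k * ln b) * (\<Prod>p\<in>U. d p * z p))"
  proof (rule sum_mono)
    fix U assume U: "U \<in> B"
    hence fU: "finite U" using P by (auto simp: B_def intro: finite_subset)
    have "(\<Prod>p\<in>U. d p) = (\<Prod>p\<in>{p\<in>U. cl p = k}. b)"
      unfolding d_def by (rule prod.inter_filter[OF fU, symmetric])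
    also have "\<dots> = exp (real (card {p\<in>U. cl p = k}) * ln b)"
      using b by (simp add: exp_of_nat_mult)
    also have "\<dots> \<ge> exp (\<alpha> k * ln b)" using U b by (auto simp: B_def intro!: mult_right_mono)
    finally have "exp (- \<alpha> k * ln b) * (\<Prod>p\<in>U. d p) \<ge> exp (- \<alpha> k * ln b) * exp (\<alpha> k * ln b)"
      by (intro mult_left_mono) auto
    hence "1 * (\<Prod>p\<in>U. z p) \<le> exp (- \<alpha> k * ln b) * (\<Prod>p\<in>U. d p) * (\<Prod>p\<in>U. z p)"
      using z by (intro mult_right_mono prod_nonneg) (auto simp flip: exp_add)
    thus "(\<Prod>p\<in>U. z p) \<le> exp (- \<alpha> k * ln b) * (\<Prod>p\<in>U. d p * z p)"
      by (simp add: prod.distrib mult.assoc)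
  qed
  also have "\<dots> \<le> (\<Sum>U\<in>Pow P. exp (- \<alpha> k * ln b) * (\<Prod>p\<in>U. d p * z p))"
  proof (rule sum_mono2)
    have "0 \<le> d p * z p" for p using d[of p] z[of p] by simp
    thus "0 \<le> exp (- \<alpha> k * ln b) * (\<Prod>p\<in>U. d p * z p)" for U by (simp add: prod_nonneg)
  qed (use P in \<open>auto simp: B_def\<close>)
  also have "\<dots> = exp (- \<alpha> k * ln b) * (\<Prod>p\<in>P. 1 + d p * z p)"
    by (simp add: sum_distrib_left[symmetric] sum_Pow_prod[OF P])
  also have "(\<Prod>p\<in>P. 1 + d p * z p) \<le> tot * exp (\<Sum>p\<in>P. (d p - 1) * z p)"
    unfolding tot_def exp_sum[OF P] prod.distrib[symmetric]
  proof (intro prod_mono conjI)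
    fix p
    show "0 \<le> 1 + d p * z p" using d[of p] z[of p] by (simp add: add_nonneg_nonneg)
    have "(1 + z p) * (1 + (d p - 1) * z p) = 1 + d p * z p + (d p - 1) * (z p * z p)"
      by (simp add: algebra_simps)
    moreover have "0 \<le> (d p - 1) * (z p * z p)" using d[of p] by simp
    ultimately have "1 + d p * z p \<le> (1 + z p) * (1 + (d p - 1) * z p)" by linarith
    also have "\<dots> \<le> (1 + z p) * exp ((d p - 1) * z p)" using z[of p] by (intro mult_left_mono) auto
    finally show "1 + d p * z p \<le> (1 + x p + y p) * exp ((d p - 1) * z p)" by (simp add: z_def add_ac)
  qed
  also have "(\<Sum>p\<in>P. (d p - 1) * z p) = (b - 1) * (\<Sum>p\<in>{p\<in>P. cl p = k}. x p + y p)"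
  proof -
    have "(\<Sum>p\<in>P. (d p - 1) * z p) = (\<Sum>p\<in>P. if cl p = k then (b - 1) * z p else 0)"
      by (intro sum.cong) (auto simp: d_def)
    also have "\<dots> = (\<Sum>p\<in>{p\<in>P. cl p = k}. (b - 1) * z p)" by (rule sum.inter_filter[OF P, symmetric])
    finally show ?thesis by (simp add: sum_distrib_left z_def add.commute)
  qed
  also have "exp (- \<alpha> k * ln b) * (tot * exp S) = tot * exp (- \<alpha> k * ln b + S)" for S
    by (simp only: exp_add mult_ac)
  finally show ?thesis unfolding B_def by (simp add: mult_left_mono)
qed

text \<open>The factor \<open>(\<Prod>K / X) powr \<eta>\<close> is at least 1 on the sets in
  question. It replaces the condition on the product by something multiplicative, so that the sum
  factors over the primes again.\<close>

lemma large_part_le: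
  assumes \<eta>: "\<eta> \<ge> 0" and X: "X > 0"
  shows "(\<Sum>U\<in>Pow P. \<Sum>K\<in>{K\<in>Pow U. real (\<Prod>K) > X}. wt U K) \<le>
    tot * exp (- \<eta> * ln X + (\<Sum>p\<in>P. real p powr \<eta> * y p))"
proof -
  define c where "c = (\<lambda>p::nat. real p powr \<eta>)"
  have c: "c p \<ge> 0" for p by (simp add: c_def)
  have "(\<Sum>U\<in>Pow P. \<Sum>K\<in>{K\<in>Pow U. real (\<Prod>K) > X}. wt U K) \<le>
     (\<Sum>U\<in>Pow P. \<Sum>K\<in>Pow U. exp (- \<eta> * ln X) * ((\<Prod>p\<in>K. c p * y p) * (\<Prod>p\<in>U - K. x p)))"
  proof (intro sum_mono)
    fix U assume U: "U \<in> Pow P"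
    hence fU: "finite U" using P by (auto intro: finite_subset)
    have "(\<Sum>K\<in>{K\<in>Pow U. real (\<Prod>K) > X}. wt U K) \<le>
      (\<Sum>K\<in>{K\<in>Pow U. real (\<Prod>K) > X}. exp (- \<eta> * ln X) * ((\<Prod>p\<in>K. c p * y p) * (\<Prod>p\<in>U - K. x p)))"
    proof (rule sum_mono)
      fix K assume K: "K \<in> {K\<in>Pow U. real (\<Prod>K) > X}"
      have "(\<Prod>p\<in>K. c p) = real (\<Prod>K) powr \<eta>"
        unfolding c_def by (subst prod_powr_distrib[symmetric]) auto
      also have "\<dots> \<ge> X powr \<eta>" using K X \<eta> by (intro powr_mono2) auto
      finally have "exp (- \<eta> * ln X) * (\<Prod>p\<in>K. c p) \<ge> exp (- \<eta> * ln X) * exp (\<eta> * ln X)"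
        using X by (intro mult_left_mono) (auto simp: powr_def)
      hence "1 * wt U K \<le> exp (- \<eta> * ln X) * (\<Prod>p\<in>K. c p) * wt U K"
        using wt_nonneg by (intro mult_right_mono) (auto simp flip: exp_add)
      thus "wt U K \<le> exp (- \<eta> * ln X) * ((\<Prod>p\<in>K. c p * y p) * (\<Prod>p\<in>U - K. x p))"
        by (simp add: wt_def prod.distrib mult_ac)
    qed
    also have "\<dots> \<le> (\<Sum>K\<in>Pow U. exp (- \<eta> * ln X) * ((\<Prod>p\<in>K. c p * y p) * (\<Prod>p\<in>U - K. x p)))"
      using fU x y c by (intro sum_mono2) (auto intro!: mult_nonneg_nonneg prod_nonneg)
    finally show "(\<Sum>K\<in>{K\<in>Pow U. real (\<Prod>K) > X}. wt U K) \<le> \<dots>" .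
  qed
  also have "\<dots> = exp (- \<eta> * ln X) * (\<Prod>p\<in>P. 1 + x p + c p * y p)"
    unfolding sum_distrib_left[symmetric] sum_Pow_Pow_prod[OF P] ..
  also have "(\<Prod>p\<in>P. 1 + x p + c p * y p) \<le> tot * exp (\<Sum>p\<in>P. c p * y p)"
    unfolding tot_def exp_sum[OF P] prod.distrib[symmetric]
  proof (intro prod_mono conjI)
    fix p
    have cy: "0 \<le> c p * y p" using c y by simp
    show "0 \<le> 1 + x p + c p * y p" using cy x[of p] by simp
    have "1 + x p + c p * y p \<le> (1 + x p + y p) * (1 + c p * y p)"
      using cy x[of p] y[of p] by (simp add: distrib_left distrib_right add_nonneg_nonneg)
    also have "\<dots> \<le> (1 + x p + y p) * exp (c p * y p)" using x[of p] y[of p] by (intro mult_left_mono) auto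
    finally show "1 + x p + c p * y p \<le> (1 + x p + y p) * exp (c p * y p)" .
  qed
  also have "exp (- \<eta> * ln X) * (tot * exp (\<Sum>p\<in>P. c p * y p)) = tot * exp (- \<eta> * ln X + (\<Sum>p\<in>P. c p * y p))"
    by (simp only: exp_add mult_ac)
  finally show ?thesis unfolding c_def by (simp add: mult_left_mono)
qed

text \<open>Overfull classes and large products cost at most a quarter of \<open>tot\<close> each,
  so half of it survives.\<close>

lemma restricted_sum_ge:
  assumes b: "b \<ge> 1" and \<eta>: "\<eta> \<ge> 0" and X: "X > 0"
    and small: "(\<Sum>k\<in>I. exp (- \<alpha> k * ln b + (b - 1) * (\<Sum>p\<in>{p\<in>P. cl p = k}. x p + y p))) \<le> 1 / 4"
      "exp (- \<eta> * ln X + (\<Sum>p\<in>P. real p powr \<eta> * y p)) \<le> 1 / 4"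
  shows "(\<Sum>U\<in>few_per_class P cl I \<alpha>. \<Sum>K\<in>{K\<in>Pow U. real (\<Prod>K) \<le> X}. wt U K) \<ge> tot / 2"
proof -
  define M where "M = few_per_class P cl I \<alpha>"
  define B where "B = (\<lambda>k. {U\<in>Pow P. real (card {p\<in>U. cl p = k}) > \<alpha> k})"
  define S where "S = (\<lambda>U. \<Sum>K\<in>Pow U. wt U K)"
  have S: "S U \<ge> 0" for U unfolding S_def by (intro sum_nonneg wt_nonneg)
  have fM: "M \<subseteq> Pow P" "finite M" using P by (auto simp: M_def few_per_class_def)
  have "Pow P = M \<union> (Pow P - M)" using fM by auto
  hence "tot = (\<Sum>U\<in>M. S U) + (\<Sum>U\<in>Pow P - M. S U)"
    unfolding tot_def sum_Pow_Pow_prod[OF P, symmetric] S_def wt_def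
    by (subst sum.union_disjoint[symmetric]) (use fM P in auto)
  also have "(\<Sum>U\<in>Pow P - M. S U) \<le> (\<Sum>U\<in>(\<Union>k\<in>I. B k). S U)"
    using P I S by (intro sum_mono2) (auto simp: M_def few_per_class_def B_def not_le)
  also have "\<dots> \<le> (\<Sum>k\<in>I. \<Sum>U\<in>B k. S U)"
    using I(1)
  proof (induction I rule: finite_induct)
    case (insert k J)
    have "(\<Sum>U\<in>(\<Union>k\<in>insert k J. B k). S U) \<le> (\<Sum>U\<in>B k. S U) + (\<Sum>U\<in>(\<Union>k\<in>J. B k). S U)"
      using insert.hyps P S sum.union_inter[of "B k" "\<Union>k\<in>J. B k" S] sum_nonneg[of "B k \<inter> (\<Union>k\<in>J. B k)" S]
      by (simp add: B_def)
    thus ?case using insert by simp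
  qed simp
  also have "\<dots> \<le> (\<Sum>k\<in>I. tot * exp (- \<alpha> k * ln b + (b - 1) * (\<Sum>p\<in>{p\<in>P. cl p = k}. x p + y p)))"
    unfolding B_def S_def by (intro sum_mono overfull_class_le b)
  also have "\<dots> \<le> tot * (1 / 4)" unfolding sum_distrib_left[symmetric] using small(1) tot_pos by (intro mult_left_mono) auto
  finally have 1: "tot \<le> (\<Sum>U\<in>M. S U) + tot / 4" by simp
  have "(\<Sum>U\<in>M. S U) = (\<Sum>U\<in>M. (\<Sum>K\<in>{K\<in>Pow U. real (\<Prod>K) \<le> X}. wt U K) + (\<Sum>K\<in>{K\<in>Pow U. real (\<Prod>K) > X}. wt U K))"
  proof (intro sum.cong refl)
    fix U assume "U \<in> M"
    hence fU: "finite U" using fM P by (auto intro: finite_subset)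
    define A B where "A = {K\<in>Pow U. real (\<Prod>K) \<le> X}" and "B = {K\<in>Pow U. real (\<Prod>K) > X}"
    have "Pow U = A \<union> B" "A \<inter> B = {}" "finite A" "finite B" using fU by (auto simp: A_def B_def)
    thus "S U = (\<Sum>K\<in>{K\<in>Pow U. real (\<Prod>K) \<le> X}. wt U K) + (\<Sum>K\<in>{K\<in>Pow U. real (\<Prod>K) > X}. wt U K)"
      unfolding A_def[symmetric] B_def[symmetric] S_def by (simp add: sum.union_disjoint)
  qed
  also have "\<dots> = (\<Sum>U\<in>M. \<Sum>K\<in>{K\<in>Pow U. real (\<Prod>K) \<le> X}. wt U K) + (\<Sum>U\<in>M. \<Sum>K\<in>{K\<in>Pow U. real (\<Prod>K) > X}. wt U K)"
    by (rule sum.distrib)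
  also have "(\<Sum>U\<in>M. \<Sum>K\<in>{K\<in>Pow U. real (\<Prod>K) > X}. wt U K) \<le> (\<Sum>U\<in>Pow P. \<Sum>K\<in>{K\<in>Pow U. real (\<Prod>K) > X}. wt U K)"
    using P fM by (intro sum_mono2 sum_nonneg wt_nonneg) auto
  also have "\<dots> \<le> tot * exp (- \<eta> * ln X + (\<Sum>p\<in>P. real p powr \<eta> * y p))" by (rule large_part_le[OF \<eta> X])
  also have "\<dots> \<le> tot * (1 / 4)" using small(2) tot_pos by (intro mult_left_mono) auto
  finally show ?thesis using 1 by (simp add: M_def)
qed

text \<open>The exponential is the gain over the square sum. With \<open>u = y / (1 + x + y)\<close>
  the ratio \<open>(1 + x + y) / (1 + x)\<close> is \<open>1 / (1 - u)\<close>, which is at least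
  \<open>exp u\<close>.\<close>

lemma tot_ge: "tot \<ge> (\<Sum>U\<in>few_per_class P cl I \<alpha>. \<Prod>p\<in>U. x p) * exp (\<Sum>p\<in>P. y p / (1 + x p + y p))"
proof -
  have "(\<Sum>U\<in>few_per_class P cl I \<alpha>. \<Prod>p\<in>U. x p) \<le> (\<Sum>U\<in>Pow P. \<Prod>p\<in>U. x p)"
    using P x by (intro sum_mono2) (auto simp: few_per_class_def intro!: prod_nonneg)
  also have "\<dots> = (\<Prod>p\<in>P. 1 + x p)" by (rule sum_Pow_prod[OF P])
  finally have "(\<Sum>U\<in>few_per_class P cl I \<alpha>. \<Prod>p\<in>U. x p) * exp (\<Sum>p\<in>P. y p / (1 + x p + y p)) \<le>
     (\<Prod>p\<in>P. 1 + x p) * exp (\<Sum>p\<in>P. y p / (1 + x p + y p))"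
    by (rule mult_right_mono) simp
  also have "\<dots> = (\<Prod>p\<in>P. 1 + x p) * (\<Prod>p\<in>P. exp (y p / (1 + x p + y p)))"
    by (simp only: exp_sum[OF P])
  also have "\<dots> = (\<Prod>p\<in>P. (1 + x p) * exp (y p / (1 + x p + y p)))" by (simp add: prod.distrib)
  also have "\<dots> \<le> (\<Prod>p\<in>P. 1 + x p + y p)"
  proof (intro prod_mono conjI)
    fix p
    define u where "u = y p / (1 + x p + y p)"
    have s: "1 + x p + y p > 0" using x[of p] y[of p] by simp
    have "1 - u = (1 + x p) / (1 + x p + y p)" using s by (simp add: u_def field_simps)
    hence "(1 + x p) = (1 + x p + y p) * (1 - u)" using s by simp
    also have "\<dots> \<le> (1 + x p + y p) * exp (- u)"
      using s exp_ge_add_one_self[of "- u"] by (intro mult_left_mono) auto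
    finally have "(1 + x p) * exp u \<le> (1 + x p + y p) * exp (- u) * exp u" by (intro mult_right_mono) auto
    thus "(1 + x p) * exp (y p / (1 + x p + y p)) \<le> 1 + x p + y p"
      unfolding u_def[symmetric] by (simp add: mult.assoc flip: exp_add)
    show "0 \<le> (1 + x p) * exp (y p / (1 + x p + y p))" using x[of p] by simp
  qed
  finally show ?thesis by (simp add: tot_def)
qed

end

section \<open>The functional equation of zeta\<close>

lemma Gamma_integral_change_of_variables:
  fixes g h :: "real \<Rightarrow> real"
  assumes s: "s > 0" and g: "\<And>x. x > 0 \<Longrightarrow> (g has_field_derivative h x) (at x)"
    and inj: "inj_on g {0<..}" and im: "g ` {0<..} = {0<..}"
  shows "((\<lambda>x. \<bar>h x\<bar> * (g x powr (s - 1) * exp (- g x))) has_integral Gamma s) {0<..}"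
proof -
  define f where "f = (\<lambda>t::real. t powr (s - 1) * exp (- t))"
  have "((\<lambda>t. t powr (s - 1) / exp t) has_integral Gamma s) {0..}" by (rule Gamma_integral_real[OF s])
  hence "(f has_integral Gamma s) {0..}" by (simp only: f_def exp_minus divide_inverse)
  moreover have "(f has_integral Gamma s) {0..} \<longleftrightarrow> (f has_integral Gamma s) {0<..}"
    by (rule has_integral_spike_set_eq; rule negligible_subset[of "{0}"]) auto
  ultimately have f: "(f has_integral Gamma s) {0<..}" by simp
  hence "f absolutely_integrable_on {0<..}"
    by (intro nonnegative_absolutely_integrable_1) (auto simp: f_def)
  hence "f absolutely_integrable_on g ` {0<..} \<and> integral (g ` {0<..}) f = Gamma s"
    using f unfolding im by (auto simp: integral_unique)
  hence "(\<lambda>x. \<bar>h x\<bar> * f (g x)) absolutely_integrable_on {0<..} \<and>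
      integral {0<..} (\<lambda>x. \<bar>h x\<bar> * f (g x)) = Gamma s"
    using g by (subst has_absolute_integral_change_of_variables_1'[OF _ _ inj])
      (auto intro: has_field_derivative_at_within)
  thus ?thesis unfolding f_def
    by (metis (no_types, lifting) absolutely_integrable_on_def has_integral_integral)
qed

text \<open>This and the following transforms are nonnegative Lebesgue integrals, so that every
  later exchange of integrals and sums is an instance of Tonelli's theorem.\<close>

lemma nn_integral_powr_exp:
  assumes s: "s > 0" and u: "u > (0::real)"
  shows "(\<integral>\<^sup>+x. ennreal (indicator {0<..} x * (x powr (s - 1) * exp (- u * x))) \<partial>lborel) = ennreal (Gamma s * u powr (- s))"
proof -
  have "((\<lambda>x. \<bar>u\<bar> * ((u * x) powr (s - 1) * exp (- (u * x)))) has_integral Gamma s) {0<..}"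
  proof (rule Gamma_integral_change_of_variables[OF s])
    show "(*) u ` {0<..} = {0<..}"
    proof (intro equalityI subsetI)
      fix y :: real assume "y \<in> {0<..}"
      thus "y \<in> (*) u ` {0<..}" using u by (intro image_eqI[of _ _ "y / u"]) auto
    qed (use u in auto)
  qed (use u in \<open>auto intro!: derivative_eq_intros inj_onI\<close>)
  hence "((\<lambda>x. u powr (- s) * (\<bar>u\<bar> * ((u * x) powr (s - 1) * exp (- (u * x))))) has_integral u powr (- s) * Gamma s) {0<..}"
    by (rule has_integral_mult_right)
  also have "?this \<longleftrightarrow> ((\<lambda>x. x powr (s - 1) * exp (- u * x)) has_integral (Gamma s * u powr (- s))) {0<..}"
  proof -
    have "u powr (- s) * (\<bar>u\<bar> * ((u * x) powr (s - 1) * exp (- (u * x)))) = x powr (s - 1) * exp (- u * x)"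
      if "x > 0" for x
    proof -
      have "u powr (- s) * (\<bar>u\<bar> * (u powr (s - 1))) = 1"
        using u by (simp add: powr_diff powr_minus)
      thus ?thesis using u that by (simp add: powr_mult mult_ac)
    qed
    thus ?thesis by (subst mult.commute[of "Gamma s"], intro has_integral_cong) auto
  qed
  finally show ?thesis
    using nn_integral_has_integral_lebesgue[of "{0<..}" "\<lambda>x. x powr (s - 1) * exp (- u * x)"] by auto
qed

lemma nn_integral_powr_gauss:
  assumes s: "s > 0" and w: "w > (0::real)"
  shows "(\<integral>\<^sup>+x. ennreal (indicator {0<..} x * (2 * x powr (2 * s - 1) * exp (- w * x\<^sup>2))) \<partial>lborel) = ennreal (Gamma s * w powr (- s))"
proof -
  have "((\<lambda>x. \<bar>2 * w * x\<bar> * ((w * x\<^sup>2) powr (s - 1) * exp (- (w * x\<^sup>2)))) has_integral Gamma s) {0<..}"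
  proof (rule Gamma_integral_change_of_variables[OF s])
    show "(\<lambda>x. w * x\<^sup>2) ` {0<..} = {0<..}"
    proof (intro equalityI subsetI)
      fix y :: real assume "y \<in> {0<..}"
      thus "y \<in> (\<lambda>x. w * x\<^sup>2) ` {0<..}" using w by (intro image_eqI[of _ _ "sqrt (y / w)"]) auto
    qed (use w in auto)
  qed (use w in \<open>auto intro!: derivative_eq_intros inj_onI\<close>)
  hence "((\<lambda>x. w powr (- s) * (\<bar>2 * w * x\<bar> * ((w * x\<^sup>2) powr (s - 1) * exp (- (w * x\<^sup>2))))) has_integral w powr (- s) * Gamma s) {0<..}"
    by (rule has_integral_mult_right)
  also have "?this \<longleftrightarrow> ((\<lambda>x. 2 * x powr (2 * s - 1) * exp (- w * x\<^sup>2)) has_integral (Gamma s * w powr (- s))) {0<..}"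
  proof -
    have "w powr (- s) * (\<bar>2 * w * x\<bar> * ((w * x\<^sup>2) powr (s - 1) * exp (- (w * x\<^sup>2)))) = 2 * x powr (2 * s - 1) * exp (- w * x\<^sup>2)"
      if "x > 0" for x
    proof -
      have "w powr (- s) * (w * (w powr (s - 1))) = 1"
        using w by (simp add: powr_diff powr_minus)
      moreover have "x * (x\<^sup>2) powr (s - 1) = x powr (2 * s - 1)"
      proof -
        have "x * (x\<^sup>2) powr (s - 1) = x powr 1 * (x powr 2) powr (s - 1)" using that by simp
        also have "\<dots> = x powr (1 + 2 * (s - 1))" by (simp only: powr_powr powr_add)
        finally show ?thesis by simp
      qed
      moreover have "w powr (- s) * (\<bar>2 * w * x\<bar> * ((w * x\<^sup>2) powr (s - 1) * exp (- (w * x\<^sup>2)))) =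
        2 * (w powr (- s) * (w * (w powr (s - 1)))) * (x * (x\<^sup>2) powr (s - 1)) * exp (- w * x\<^sup>2)"
        using w that by (simp add: powr_mult mult_ac abs_mult)
      ultimately show ?thesis by simp
    qed
    thus ?thesis by (subst mult.commute[of "Gamma s"], intro has_integral_cong) auto
  qed
  finally show ?thesis
    using nn_integral_has_integral_lebesgue[of "{0<..}" "\<lambda>x. 2 * x powr (2 * s - 1) * exp (- w * x\<^sup>2)"] by auto
qed

text \<open>Writing \<open>1 / (x^2 + c^2)\<close> as the integral of
  \<open>exp (- w * (x^2 + c^2))\<close> over positive \<open>w\<close> and exchanging the integrals
  leaves a Gaussian and then an exponential Gamma integral.\<close>

lemma mellin_rational:
  fixes a c :: real
  assumes a: "0 < a" "a < 1" and c: "c > 0"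
  shows "(\<integral>\<^sup>+x. ennreal (indicator {0<..} x * (x powr (- a - 1) * (2 * x / (x\<^sup>2 + c\<^sup>2)))) \<partial>lborel) =
    ennreal (Gamma ((1 - a) / 2) * Gamma ((1 + a) / 2) * c powr (- 1 - a))"
proof -
  let ?F = "\<lambda>w x. ennreal (indicator {0<..} w * (indicator {0<..} x * (2 * x powr (- a) * exp (- w * (x\<^sup>2 + c\<^sup>2)))))"
  have g1: "Gamma ((1 - a) / 2) > 0" using a by (intro Gamma_real_pos) auto
  have "ennreal (indicator {0<..} x * (x powr (- a - 1) * (2 * x / (x\<^sup>2 + c\<^sup>2)))) = (\<integral>\<^sup>+w. ?F w x \<partial>lborel)" for x
  proof (cases "x > 0")
    case True
    have pos: "x\<^sup>2 + c\<^sup>2 > 0" using True by (simp add: add_pos_nonneg)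
    have "(\<integral>\<^sup>+w. ?F w x \<partial>lborel) = (\<integral>\<^sup>+w. ennreal (2 * x powr (- a)) * ennreal (indicator {0<..} w * (w powr (1 - 1) * exp (- (x\<^sup>2 + c\<^sup>2) * w))) \<partial>lborel)"
      by (intro nn_integral_cong) (use True in \<open>auto simp: ennreal_mult'[symmetric] indicator_def algebra_simps\<close>)
    also have "\<dots> = ennreal (2 * x powr (- a)) * ennreal (Gamma 1 * (x\<^sup>2 + c\<^sup>2) powr (- 1))"
      by (subst nn_integral_cmult, simp, subst nn_integral_powr_exp) (use pos in auto)
    also have "\<dots> = ennreal (indicator {0<..} x * (x powr (- a - 1) * (2 * x / (x\<^sup>2 + c\<^sup>2))))"
      using True pos by (subst ennreal_mult'[symmetric]) (auto simp: powr_minus powr_diff divide_simps powr_one)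
    finally show ?thesis ..
  qed auto
  hence "(\<integral>\<^sup>+x. ennreal (indicator {0<..} x * (x powr (- a - 1) * (2 * x / (x\<^sup>2 + c\<^sup>2)))) \<partial>lborel) =
    (\<integral>\<^sup>+x. \<integral>\<^sup>+w. ?F w x \<partial>lborel \<partial>lborel)" by simp
  also have "\<dots> = (\<integral>\<^sup>+w. \<integral>\<^sup>+x. ?F w x \<partial>lborel \<partial>lborel)"
    by (subst lborel_pair.Fubini') (auto simp: case_prod_unfold)
  also have "\<dots> = (\<integral>\<^sup>+w. ennreal (Gamma ((1 - a) / 2)) * ennreal (indicator {0<..} w * (w powr ((1 + a) / 2 - 1) * exp (- c\<^sup>2 * w))) \<partial>lborel)"
  proof (intro nn_integral_cong)
    fix w :: real
    show "(\<integral>\<^sup>+x. ?F w x \<partial>lborel) = ennreal (Gamma ((1 - a) / 2)) * ennreal (indicator {0<..} w * (w powr ((1 + a) / 2 - 1) * exp (- c\<^sup>2 * w)))"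
    proof (cases "w > 0")
      case True
      have "(\<integral>\<^sup>+x. ?F w x \<partial>lborel) =
        (\<integral>\<^sup>+x. ennreal (exp (- c\<^sup>2 * w)) * ennreal (indicator {0<..} x * (2 * x powr (2 * ((1 - a) / 2) - 1) * exp (- w * x\<^sup>2))) \<partial>lborel)"
        by (intro nn_integral_cong)
           (use True in \<open>auto simp: ennreal_mult'[symmetric] indicator_def ring_distribs exp_add exp_diff exp_minus field_simps\<close>)
      also have "\<dots> = ennreal (exp (- c\<^sup>2 * w)) * ennreal (Gamma ((1 - a) / 2) * w powr (- ((1 - a) / 2)))"
        by (subst nn_integral_cmult, simp, subst nn_integral_powr_gauss) (use a True in auto)
      also have "- ((1 - a) / 2) = (1 + a) / 2 - 1" by (simp add: field_simps)
      finally show ?thesis using True g1 by (simp add: ennreal_mult'[symmetric] mult_ac)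
    qed auto
  qed
  also have "\<dots> = ennreal (Gamma ((1 - a) / 2)) * ennreal (Gamma ((1 + a) / 2) * (c\<^sup>2) powr (- ((1 + a) / 2)))"
    by (subst nn_integral_cmult, simp, subst nn_integral_powr_exp) (use a c in auto)
  also have "(c\<^sup>2) powr (- ((1 + a) / 2)) = c powr (- 1 - a)"
  proof -
    have "(c\<^sup>2) powr (- ((1 + a) / 2)) = (c powr 2) powr (- ((1 + a) / 2))" using c by simp
    also have "\<dots> = c powr (2 * (- ((1 + a) / 2)))" by (rule powr_powr)
    also have "2 * (- ((1 + a) / 2)) = - 1 - a" by (simp add: field_simps)
    finally show ?thesis .
  qed
  finally show ?thesis using g1 by (simp add: ennreal_mult'[symmetric] mult.assoc)
qed

section \<open>Errors of the trapezoidal rule for exponentials and powers\<close>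

lemma trapezoid_has_integral:
  fixes h h' h'' H :: "real \<Rightarrow> real"
  assumes cont: "continuous_on {a..a+1} (\<lambda>u. (u - a) * (a + 1 - u) * h' u)" "continuous_on {a..a+1} h" "continuous_on {a..a+1} H"
    and d: "\<And>u. u \<in> {a<..<a+1} \<Longrightarrow> (H has_real_derivative h u) (at u)"
      "\<And>u. u \<in> {a<..<a+1} \<Longrightarrow> (h has_real_derivative h' u) (at u)"
      "\<And>u. u \<in> {a<..<a+1} \<Longrightarrow> (h' has_real_derivative h'' u) (at u)"
  shows "((\<lambda>u. (u - a) * (a + 1 - u) / 2 * h'' u) has_integral ((h a + h (a + 1)) / 2 - (H (a + 1) - H a))) {a..a+1}"
proof -
  \<comment> \<open>An antiderivative found by integrating by parts twice against the Peano kernel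
    \<open>(u - a) * (a + 1 - u) / 2\<close>. The kernel vanishes at both ends, so only
    \<open>h\<close> and \<open>H\<close> survive there.\<close>
  define \<Phi> where "\<Phi> = (\<lambda>u. ((u - a) * (a + 1 - u) * h' u) / 2 - (2 * a + 1 - 2 * u) * h u / 2 - H u)"
  have "((\<lambda>u. (u - a) * (a + 1 - u) / 2 * h'' u) has_integral (\<Phi> (a + 1) - \<Phi> a)) {a..a+1}"
  proof (rule fundamental_theorem_of_calculus_interior)
    show "continuous_on {a..a+1} \<Phi>" unfolding \<Phi>_def by (intro continuous_intros cont) auto
    fix u assume u: "u \<in> {a<..<a+1}"
    have "(\<Phi> has_real_derivative (u - a) * (a + 1 - u) / 2 * h'' u) (at u)"
      unfolding \<Phi>_def
      by (rule derivative_eq_intros d[OF u] refl | simp)+ (simp add: field_simps)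
    thus "(\<Phi> has_vector_derivative (u - a) * (a + 1 - u) / 2 * h'' u) (at u)"
      by (simp add: has_real_derivative_iff_has_vector_derivative)
  qed simp
  also have "\<Phi> (a + 1) - \<Phi> a = (h a + h (a + 1)) / 2 - (H (a + 1) - H a)"
    by (simp add: \<Phi>_def field_simps)
  finally show ?thesis .
qed

text \<open>\<open>trap_exp\<close> and \<open>trap_powr\<close> are the trapezoidal value minus the
  integral over the interval from \<open>n\<close> to \<open>n + 1\<close>, for
  \<open>exp (- x * u)\<close> and for \<open>u powr a\<close>. Convexity and concavity give them
  opposite signs.\<close>

definition trap_exp :: "nat \<Rightarrow> real \<Rightarrow> real" where
  "trap_exp n x = (exp (- x * real n) + exp (- x * (real n + 1))) / 2 - (exp (- x * real n) - exp (- x * (real n + 1))) / x"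

definition trap_powr :: "real \<Rightarrow> nat \<Rightarrow> real" where
  "trap_powr a n = (real n powr a + (real n + 1) powr a) / 2 - ((real n + 1) powr (a + 1) - real n powr (a + 1)) / (a + 1)"

lemma trap_exp_has_integral:
  assumes x: "x > 0"
  shows "((\<lambda>u. (u - real n) * (real n + 1 - u) / 2 * (x\<^sup>2 * exp (- x * u))) has_integral trap_exp n x) {real n..real n + 1}"
proof -
  have "((\<lambda>u. (u - real n) * (real n + 1 - u) / 2 * (x\<^sup>2 * exp (- x * u))) has_integral
     ((exp (- x * real n) + exp (- x * (real n + 1))) / 2 - (- exp (- x * (real n + 1)) / x - - exp (- x * real n) / x))) {real n..real n + 1}"
    by (rule trapezoid_has_integral[where h' = "\<lambda>u. - x * exp (- x * u)"])
       (use x in \<open>auto intro!: continuous_intros derivative_eq_intros simp: power2_eq_square\<close>)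
  thus ?thesis by (simp add: trap_exp_def diff_divide_distrib)
qed

lemma trap_powr_has_integral:
  assumes a: "0 < a" "a < 1"
  shows "((\<lambda>u. (u - real n) * (real n + 1 - u) / 2 * (a * (a - 1) * u powr (a - 2))) has_integral trap_powr a n) {real n..real n + 1}"
proof -
  have "((\<lambda>u. (u - real n) * (real n + 1 - u) / 2 * (a * (a - 1) * u powr (a - 2))) has_integral
     ((real n powr a + (real n + 1) powr a) / 2 - ((real n + 1) powr (a + 1) / (a + 1) - real n powr (a + 1) / (a + 1)))) {real n..real n + 1}"
  proof (rule trapezoid_has_integral[where h' = "\<lambda>u. a * u powr (a - 1)"])
    show "continuous_on {real n..real n + 1} (\<lambda>u. (u - real n) * (real n + 1 - u) * (a * u powr (a - 1)))"
    proof (cases "n = 0")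
      case True
      \<comment> \<open>At \<open>u = 0\<close> the derivative of \<open>u powr a\<close> blows up,
        but the factor \<open>u\<close> of the kernel turns \<open>u powr (a - 1)\<close> into the
        continuous \<open>u powr a\<close>.\<close>
      have "continuous_on {0..1} (\<lambda>u::real. (1 - u) * (a * u powr a))"
        by (intro continuous_intros continuous_on_powr') (use a in auto)
      moreover have "(1 - u) * (a * u powr a) = u * (1 - u) * (a * u powr (a - 1))" if "u \<in> {0..1}" for u :: real
        using that by (cases "u = 0") (auto simp: powr_diff)
      ultimately have "continuous_on {0..1} (\<lambda>u::real. u * (1 - u) * (a * u powr (a - 1)))"
        by (rule continuous_on_eq)
      thus ?thesis using True by simp
    next
      case False
      thus ?thesis by (intro continuous_intros) auto
    qed
    show "continuous_on {real n..real n + 1} (\<lambda>u. u powr a)" "continuous_on {real n..real n + 1} (\<lambda>u. u powr (a + 1) / (a + 1))"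
      by (intro continuous_intros continuous_on_powr'; use a in auto)+
    fix u assume u: "u \<in> {real n<..<real n + 1}"
    hence u0: "u > 0" by (metis greaterThanLessThan_iff le_less_trans of_nat_0_le_iff)
    show "((\<lambda>u. u powr (a + 1) / (a + 1)) has_real_derivative u powr a) (at u)"
      "((\<lambda>u. u powr a) has_real_derivative a * u powr (a - 1)) (at u)"
      "((\<lambda>u. a * u powr (a - 1)) has_real_derivative a * (a - 1) * u powr (a - 2)) (at u)"
      using u0 a by (auto intro!: derivative_eq_intros)
  qed
  thus ?thesis by (simp add: trap_powr_def diff_divide_distrib)
qed

lemma trap_exp_nonneg: "x > 0 \<Longrightarrow> trap_exp n x \<ge> 0"
  by (rule has_integral_nonneg[OF trap_exp_has_integral]) auto

lemma trap_powr_integrand_nonpos: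
  assumes "0 < a" "a < 1" "u \<in> {real n..real n + 1}"
  shows "(u - real n) * (real n + 1 - u) / 2 * (a * (a - 1) * u powr (a - 2)) \<le> 0"
proof -
  have "a * (a - 1) * u powr (a - 2) \<le> 0" using assms by (intro mult_nonpos_nonneg mult_nonneg_nonpos) auto
  moreover have "(u - real n) * (real n + 1 - u) / 2 \<ge> 0" using assms by auto
  ultimately show ?thesis by (rule mult_nonneg_nonpos[rotated])
qed

lemma trap_powr_nonpos:
  assumes a: "0 < a" "a < 1" shows "trap_powr a n \<le> 0"
proof -
  have "((\<lambda>u. - ((u - real n) * (real n + 1 - u) / 2 * (a * (a - 1) * u powr (a - 2)))) has_integral - trap_powr a n) {real n..real n + 1}"
    by (intro has_integral_neg trap_powr_has_integral a)
  hence "- trap_powr a n \<ge> 0"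
    by (rule has_integral_nonneg) (use trap_powr_integrand_nonpos[OF a] in simp)
  thus ?thesis by simp
qed

text \<open>Both errors are integrals against the same kernel, of \<open>x^2 * exp (- x * u)\<close>
  and of \<open>a * (a - 1) * u powr (a - 2)\<close>. Integrating the first against
  \<open>x powr (- a - 1)\<close> produces \<open>Gamma (2 - a) * u powr (a - 2)\<close>, a constant
  multiple of the second.\<close>

lemma mellin_trap_exp:
  assumes a: "0 < a" "a < 1"
  shows "(\<integral>\<^sup>+x. ennreal (indicator {0<..} x * (x powr (- a - 1) * trap_exp n x)) \<partial>lborel) =
    ennreal (Gamma (2 - a) / (a * (1 - a)) * - trap_powr a n)"
proof -
  define q where "q = (\<lambda>u. (u - real n) * (real n + 1 - u) / 2)"
  have qn: "q u \<ge> 0" if "u \<in> {real n..real n + 1}" for u using that by (auto simp: q_def)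
  have qm [measurable]: "q \<in> borel_measurable borel" unfolding q_def by simp
  have G: "Gamma (2 - a) > 0" using a by (intro Gamma_real_pos) auto
  let ?I = "{real n..real n + 1}"
  let ?F = "\<lambda>x u. ennreal (indicator {0<..} x * (indicator ?I u * (q u * (x powr (1 - a) * exp (- u * x)))))"
  have "ennreal (indicator {0<..} x * (x powr (- a - 1) * trap_exp n x)) = (\<integral>\<^sup>+u. ?F x u \<partial>lborel)" for x
  proof (cases "x > 0")
    case True
    have x2: "x powr (- a - 1) * x\<^sup>2 = x powr (1 - a)"
    proof -
      have "x powr (- a - 1) * x\<^sup>2 = x powr (- a - 1) * x powr 2" using True by simp
      thus ?thesis by (simp flip: powr_add)
    qed
    have "(\<integral>\<^sup>+u. ennreal (indicator ?I u * (q u * (x\<^sup>2 * exp (- x * u)))) \<partial>lborel) = ennreal (trap_exp n x)"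
      using nn_integral_has_integral_lebesgue[OF _ trap_exp_has_integral[OF True, of n]] by (simp add: q_def)
    hence "ennreal (x powr (- a - 1)) * ennreal (trap_exp n x) =
       (\<integral>\<^sup>+u. ennreal (x powr (- a - 1)) * ennreal (indicator ?I u * (q u * (x\<^sup>2 * exp (- x * u)))) \<partial>lborel)"
      by (subst nn_integral_cmult) auto
    also have "\<dots> = (\<integral>\<^sup>+u. ?F x u \<partial>lborel)"
    proof (intro nn_integral_cong)
      fix u
      have "x powr (- a - 1) * (indicator ?I u * (q u * (x\<^sup>2 * exp (- x * u)))) =
        indicator ?I u * (q u * ((x powr (- a - 1) * x\<^sup>2) * exp (- u * x)))" by (simp add: mult_ac)
      thus "ennreal (x powr (- a - 1)) * ennreal (indicator ?I u * (q u * (x\<^sup>2 * exp (- x * u)))) = ?F x u"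
        using True x2 by (simp only: ennreal_mult'[symmetric] powr_ge_zero) (simp add: indicator_def)
    qed
    finally show ?thesis using True by (simp add: ennreal_mult' trap_exp_nonneg)
  qed auto
  hence "(\<integral>\<^sup>+x. ennreal (indicator {0<..} x * (x powr (- a - 1) * trap_exp n x)) \<partial>lborel) =
    (\<integral>\<^sup>+x. \<integral>\<^sup>+u. ?F x u \<partial>lborel \<partial>lborel)" by simp
  also have "\<dots> = (\<integral>\<^sup>+u. \<integral>\<^sup>+x. ?F x u \<partial>lborel \<partial>lborel)"
    by (subst lborel_pair.Fubini') (auto simp: case_prod_unfold)
  also have "\<dots> = (\<integral>\<^sup>+u. ennreal (Gamma (2 - a) / (a * (1 - a))) * ennreal (indicator ?I u * - (q u * (a * (a - 1) * u powr (a - 2)))) \<partial>lborel)"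
  proof (rule nn_integral_cong_AE, rule AE_mp[OF AE_lborel_singleton[of 0]], rule AE_I2, rule impI)
    fix u :: real assume u0: "u \<noteq> 0"
    show "(\<integral>\<^sup>+x. ?F x u \<partial>lborel) = ennreal (Gamma (2 - a) / (a * (1 - a))) * ennreal (indicator ?I u * - (q u * (a * (a - 1) * u powr (a - 2))))"
    proof (cases "u \<in> ?I")
      case True
      hence u: "u > 0" using u0 of_nat_0_le_iff[of n] by (auto simp del: of_nat_0_le_iff)
      have "(\<integral>\<^sup>+x. ?F x u \<partial>lborel) = (\<integral>\<^sup>+x. ennreal (q u) * ennreal (indicator {0<..} x * (x powr ((2 - a) - 1) * exp (- u * x))) \<partial>lborel)"
        by (intro nn_integral_cong) (use True qn[OF True] in \<open>auto simp: ennreal_mult'[symmetric] mult_ac\<close>)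
      also have "\<dots> = ennreal (q u) * ennreal (Gamma (2 - a) * u powr (- (2 - a)))"
        by (subst nn_integral_cmult, simp, subst nn_integral_powr_exp) (use a u in auto)
      also have "\<dots> = ennreal (q u * (Gamma (2 - a) * u powr (a - 2)))"
        using qn[OF True] by (simp add: ennreal_mult'[symmetric])
      also have "q u * (Gamma (2 - a) * u powr (a - 2)) = Gamma (2 - a) / (a * (1 - a)) * - (q u * (a * (a - 1) * u powr (a - 2)))"
      proof -
        define k where "k = a * (1 - a)"
        have k: "k \<noteq> 0" "a * (a - 1) = - k" using a by (auto simp: k_def algebra_simps)
        show ?thesis unfolding k(2) k_def[symmetric] using k(1) by (simp add: field_simps)
      qed
      also have "ennreal (Gamma (2 - a) / (a * (1 - a)) * - (q u * (a * (a - 1) * u powr (a - 2)))) =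
        ennreal (Gamma (2 - a) / (a * (1 - a))) * ennreal (indicator ?I u * - (q u * (a * (a - 1) * u powr (a - 2))))"
        using True a G by (subst ennreal_mult') auto
      finally show ?thesis .
    qed auto
  qed
  also have "\<dots> = ennreal (Gamma (2 - a) / (a * (1 - a))) * (\<integral>\<^sup>+u. ennreal (indicator ?I u * - (q u * (a * (a - 1) * u powr (a - 2)))) \<partial>lborel)"
    by (subst nn_integral_cmult) auto
  also have "(\<integral>\<^sup>+u. ennreal (indicator ?I u * - (q u * (a * (a - 1) * u powr (a - 2)))) \<partial>lborel) = ennreal (- trap_powr a n)"
  proof (rule nn_integral_has_integral_lebesgue)
    show "((\<lambda>u. - (q u * (a * (a - 1) * u powr (a - 2)))) has_integral - trap_powr a n) ?I"
      unfolding q_def by (intro has_integral_neg trap_powr_has_integral a)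
    fix u assume "u \<in> ?I"
    thus "0 \<le> - (q u * (a * (a - 1) * u powr (a - 2)))"
      using trap_powr_integrand_nonpos[OF a] by (simp add: q_def)
  qed
  finally show ?thesis using G a by (subst ennreal_mult') auto
qed

section \<open>Two series with terms of one sign for
  \<open>1 / (exp x - 1) - 1 / x + 1 / 2\<close>\<close>

lemma Digamma_reflection:
  fixes z :: complex
  assumes z: "z \<notin> \<int>"
  shows "Digamma (- z) - Digamma z = 1 / z + of_real pi * cos (of_real pi * z) / sin (of_real pi * z)"
proof -
  have nz: "z \<notin> \<int>\<^sub>\<le>\<^sub>0" "- z \<notin> \<int>\<^sub>\<le>\<^sub>0" "z \<noteq> 0"
    using z nonpos_Ints_Int[of z] nonpos_Ints_Int[of "- z"] by auto
  \<comment> \<open>The reflection formula for \<open>Digamma\<close> comes from differentiating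
    this function twice over: once by the product rule and once in its closed form
    \<open>- z * sin (pi * z) / pi\<close>.\<close>
  define f where "f = (\<lambda>z::complex. rGamma z * rGamma (- z))"
  have f: "f = (\<lambda>z. - z * sin (of_real pi * z) / of_real pi)"
    by (simp add: f_def rGamma_reflection_complex' fun_eq_iff)
  have "f z \<noteq> 0" using nz by (simp add: f_def rGamma_eq_zero_iff)
  hence s: "sin (of_real pi * z) \<noteq> 0" unfolding f by auto
  have d1: "((\<lambda>z. rGamma (- z)) has_field_derivative rGamma (- z) * Digamma (- z)) (at z)"
    by (auto intro!: derivative_eq_intros simp: nz)
  have d2: "(rGamma has_field_derivative - rGamma z * Digamma z) (at z)"
    by (auto intro!: derivative_eq_intros simp: nz)
  have "(f has_field_derivative (- rGamma z * Digamma z * rGamma (- z) + rGamma (- z) * Digamma (- z) * rGamma z)) (at z)"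
    unfolding f_def by (rule DERIV_mult[OF d2 d1])
  moreover have "(f has_field_derivative (- sin (of_real pi * z) - z * of_real pi * cos (of_real pi * z)) / of_real pi) (at z)"
    unfolding f by (auto intro!: derivative_eq_intros simp: field_simps)
  ultimately have "- rGamma z * Digamma z * rGamma (- z) + rGamma (- z) * Digamma (- z) * rGamma z =
     (- sin (of_real pi * z) - z * of_real pi * cos (of_real pi * z)) / of_real pi" by (rule DERIV_unique)
  hence "f z * (Digamma (- z) - Digamma z) = (- sin (of_real pi * z) - z * of_real pi * cos (of_real pi * z)) / of_real pi"
    by (simp add: f_def algebra_simps)
  hence "- z * sin (of_real pi * z) * (Digamma (- z) - Digamma z) = - sin (of_real pi * z) - z * of_real pi * cos (of_real pi * z)"
    unfolding f times_divide_eq_left divide_cancel_right by simp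
  hence "z * sin (of_real pi * z) * (Digamma (- z) - Digamma z) = sin (of_real pi * z) + z * of_real pi * cos (of_real pi * z)"
    by (simp add: algebra_simps)
  moreover define d where "d = Digamma (- z) - Digamma z"
  ultimately have "z * sin (of_real pi * z) * d = sin (of_real pi * z) + z * of_real pi * cos (of_real pi * z)"
    by (simp only: d_def)
  hence "d = (sin (of_real pi * z) + z * of_real pi * cos (of_real pi * z)) / (z * sin (of_real pi * z))"
    using s nz(3) by (simp add: eq_divide_eq mult_ac)
  also have "\<dots> = 1 / z + of_real pi * cos (of_real pi * z) / sin (of_real pi * z)"
    using s nz(3) by (simp add: add_divide_distrib)
  finally show ?thesis by (simp only: d_def)
qed

text \<open>At the imaginary point \<open>z = \<i> * x / (2 * pi)\<close> the imaginary part of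
  \<open>Digamma (- z) - Digamma z\<close> is the series of rational terms by the limit formula, and
  a hyperbolic cotangent by the reflection formula.\<close>

lemma bose_partial_fractions:
  fixes x :: real
  assumes x: "x > 0"
  shows "(\<lambda>n. 2 * x / (x\<^sup>2 + (2 * pi * real (Suc n))\<^sup>2)) sums (1 / (exp x - 1) - 1 / x + 1 / 2)"
proof -
  define y where "y = x / (2 * pi)"
  define z where "z = \<i> * complex_of_real y"
  have y: "y > 0" using x by (simp add: y_def)
  have zI: "z \<notin> \<int>"
  proof
    assume "z \<in> \<int>"
    then obtain n where "z = of_int n" by (elim Ints_cases)
    hence "Im z = 0" by simp
    thus False using y by (simp add: z_def)
  qed
  have z0: "z \<noteq> 0" using zI by auto
  have "(\<lambda>m. (of_real (ln (real m)) - (\<Sum>n<m. inverse (- z + of_nat n))) - (of_real (ln (real m)) - (\<Sum>n<m. inverse (z + of_nat n)))) \<longlonglongrightarrow> Digamma (- z) - Digamma z"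
    by (intro tendsto_diff Digamma_LIMSEQ) (use z0 in auto)
  hence "(\<lambda>n. inverse (z + of_nat n) - inverse (- z + of_nat n)) sums (Digamma (- z) - Digamma z)"
    unfolding sums_def by (simp add: sum_subtractf algebra_simps)
  hence "(\<lambda>n. Im (inverse (z + of_nat n) - inverse (- z + of_nat n))) sums Im (Digamma (- z) - Digamma z)"
    by (rule sums_Im)
  \<comment> \<open>The term for \<open>n = 0\<close> is \<open>- 2 / y\<close>; it is moved to the
    right and accounts for the \<open>1 / x\<close> in the end.\<close>
  from sums_split_initial_segment[OF this, of 1]
  have 1: "(\<lambda>n. Im (inverse (z + of_nat (Suc n)) - inverse (- z + of_nat (Suc n)))) sums (Im (Digamma (- z) - Digamma z) + 2 / y)"
    using y by (simp add: z_def power2_eq_square of_nat_Suc[of 0] del: of_nat_Suc)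
  have t: "Im (inverse (z + of_nat (Suc n)) - inverse (- z + of_nat (Suc n))) = - (2 * y / (y\<^sup>2 + (real (Suc n))\<^sup>2))" for n
    by (simp add: z_def add_ac del: of_nat_Suc)
  have "Im (of_real pi * cos (of_real pi * z) / sin (of_real pi * z)) = - pi * (1 + 2 / (exp x - 1))"
  proof -
    have e: "exp (x / 2) * exp (x / 2) = exp x" "exp (- (x / 2)) = 1 / exp (x / 2)" by (simp_all add: mult_exp_exp exp_minus inverse_eq_divide)
    have w: "\<i> * (of_real pi * z) = of_real (- (x / 2))" "- complex_of_real (- (x / 2)) = of_real (x / 2)" by (simp_all add: z_def y_def)
    define A B where "A = exp (- (x / 2)) + exp (x / 2)" and "B = exp (x / 2) - exp (- (x / 2))"
    have c: "cos (of_real pi * z) = of_real A / 2"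
      unfolding cos_exp_eq w(1) unfolding w(2) A_def by (simp only: exp_of_real of_real_add)
    have s: "sin (of_real pi * z) = - of_real B / (2 * \<i>)"
      unfolding sin_exp_eq w(1) unfolding w(2) B_def by (simp only: exp_of_real of_real_diff minus_diff_eq)
    have B: "B > 0" using x by (simp add: B_def)
    have "of_real pi * cos (of_real pi * z) / sin (of_real pi * z) = - \<i> * of_real (pi * (A / B))"
      unfolding c s using B by (simp add: field_simps)
    moreover have "A / B = 1 + 2 / (exp x - 1)"
    proof -
      have "exp x > 1" using x by simp
      hence "A * exp (x / 2) = exp x + 1" "B * exp (x / 2) = exp x - 1" by (simp_all add: A_def B_def ring_distribs e)
      hence "A / B = (exp x + 1) / (exp x - 1)" by (metis exp_not_eq_zero mult_divide_mult_cancel_right)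
      also have "\<dots> = 1 + 2 / (exp x - 1)" using \<open>exp x > 1\<close> by (simp add: field_simps)
      finally show ?thesis .
    qed
    ultimately show ?thesis by simp
  qed
  moreover have "Im (1 / z) = - 1 / y" using y by (simp add: z_def Im_divide power2_eq_square)
  ultimately have "Im (Digamma (- z) - Digamma z) + 2 / y = 1 / y - pi * (1 + 2 / (exp x - 1))"
    unfolding Digamma_reflection[OF zI] by (simp add: field_simps)
  with 1 have "(\<lambda>n. - (2 * y / (y\<^sup>2 + (real (Suc n))\<^sup>2))) sums (1 / y - pi * (1 + 2 / (exp x - 1)))"
    unfolding t by simp
  hence "(\<lambda>n. - (1 / (2 * pi)) * - (2 * y / (y\<^sup>2 + (real (Suc n))\<^sup>2))) sums (- (1 / (2 * pi)) * (1 / y - pi * (1 + 2 / (exp x - 1))))"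
    by (rule sums_mult)
  also have "(\<lambda>n. - (1 / (2 * pi)) * - (2 * y / (y\<^sup>2 + (real (Suc n))\<^sup>2))) = (\<lambda>n. 2 * x / (x\<^sup>2 + (2 * pi * real (Suc n))\<^sup>2))"
  proof
    fix n
    have "x = 2 * pi * y" by (simp add: y_def)
    moreover have "y\<^sup>2 + (real (Suc n))\<^sup>2 > 0" using y by (simp add: add_pos_nonneg)
    ultimately show "- (1 / (2 * pi)) * - (2 * y / (y\<^sup>2 + (real (Suc n))\<^sup>2)) = 2 * x / (x\<^sup>2 + (2 * pi * real (Suc n))\<^sup>2)"
    proof -
      assume a: "x = 2 * pi * y" "y\<^sup>2 + (real (Suc n))\<^sup>2 > 0"
      have "x\<^sup>2 + (2 * pi * real (Suc n))\<^sup>2 = (2 * pi)\<^sup>2 * (y\<^sup>2 + (real (Suc n))\<^sup>2)"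
        unfolding a(1) by (simp add: power_mult_distrib distrib_left del: of_nat_Suc)
      thus ?thesis unfolding a(1) using a(2) by (simp add: power2_eq_square divide_simps del: of_nat_Suc)
    qed
  qed
  also have "- (1 / (2 * pi)) * (1 / y - pi * (1 + 2 / (exp x - 1))) = 1 / (exp x - 1) - 1 / x + 1 / 2"
  proof -
    define q where "q = 1 / (exp x - 1)"
    have "2 / (exp x - 1) = 2 * q" "1 / y = 2 * pi * (1 / x)" using x by (simp_all add: q_def y_def)
    thus ?thesis unfolding q_def[symmetric] by (simp only:) (simp add: field_simps)
  qed
  finally show ?thesis .
qed

lemma trap_exp_sums:
  fixes x :: real
  assumes x: "x > 0"
  shows "(\<lambda>n. trap_exp n x) sums (1 / (exp x - 1) - 1 / x + 1 / 2)"
proof -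
  define r where "r = exp (- x)"
  have r: "0 < r" "r < 1" using x by (auto simp: r_def)
  have g: "(\<lambda>n. r ^ n) sums (1 / (1 - r))" using r by (intro geometric_sums) auto
  have e1: "exp (- x * real n) = r ^ n" for n
    using exp_of_nat_mult[of n "- x"] by (simp add: r_def mult.commute)
  have "exp (- x * (real n + 1)) = exp (- x) * exp (- x * real n)" for n
    by (simp add: mult_exp_exp algebra_simps)
  hence e: "exp (- x * real n) = r ^ n" "exp (- x * (real n + 1)) = r * r ^ n" for n
    unfolding e1 by (simp_all add: r_def)
  have "(\<lambda>n. (1 + r) / 2 * r ^ n - (1 - r) / x * r ^ n) sums ((1 + r) / 2 * (1 / (1 - r)) - (1 - r) / x * (1 / (1 - r)))"
    by (intro sums_diff sums_mult g)
  moreover have "trap_exp n x = (1 + r) / 2 * r ^ n - (1 - r) / x * r ^ n" for n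
    unfolding trap_exp_def e by (simp add: field_simps)
  moreover have "(1 + r) / 2 * (1 / (1 - r)) - (1 - r) / x * (1 / (1 - r)) = 1 / (exp x - 1) - 1 / x + 1 / 2"
  proof -
    have "exp x = 1 / r" by (simp add: r_def exp_minus divide_inverse)
    moreover have "1 / (1 / r - 1) = r / (1 - r)" using r by (simp add: field_simps)
    ultimately show ?thesis using r x by (simp add: field_simps)
  qed
  ultimately show ?thesis by simp
qed

section \<open>The functional equation on a real interval and its continuation\<close>

lemma real_functional_equation:
  fixes a :: real
  assumes a: "0 < a" "a < 1"
  obtains z z' where "zeta (of_real (- a)) = of_real z" "zeta (of_real (1 + a)) = of_real z'"
    "Gamma (2 - a) / (a * (1 - a)) * - z = Gamma ((1 - a) / 2) * Gamma ((1 + a) / 2) * (2 * pi) powr (- 1 - a) * z'"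
proof -
  have "(\<lambda>n. em_err n (of_real (- a))) sums ((1 - of_real (- a)) * (zeta (of_real (- a)) - 1 / 2) + 1)"
    by (rule em_err_sums) (use a in \<open>auto simp: complex_eq_iff\<close>)
  moreover have "em_err n (of_real (- a)) = of_real ((1 + a) * trap_powr a (Suc n))" for n
  proof -
    have p: "complex_of_nat k powr of_real b = of_real (real k powr b)" for k b
      using powr_of_real[of "real k" b] by simp
    have 1: "- complex_of_real (- a) = of_real a" "1 - complex_of_real (- a) = of_real (a + 1)" by simp_all
    have "(1 + a) * trap_powr a (Suc n) = (a + 1) * (real (Suc n) powr a + real (Suc (Suc n)) powr a) / 2 -
       (real (Suc (Suc n)) powr (a + 1) - real (Suc n) powr (a + 1))"
      unfolding trap_powr_def using a by (simp add: add_ac right_diff_distrib diff_divide_distrib)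
    thus ?thesis unfolding em_err_eq 1 p by (simp only: of_real_mult of_real_add of_real_diff of_real_divide of_real_numeral)
  qed
  ultimately have "(\<lambda>n. complex_of_real ((1 + a) * trap_powr a (Suc n))) sums ((1 + of_real a) * (zeta (of_real (- a)) - 1 / 2) + 1)"
    by simp
  hence "(\<lambda>n. 1 / (1 + of_real a) * complex_of_real ((1 + a) * trap_powr a (Suc n))) sums (1 / (1 + of_real a) * ((1 + of_real a) * (zeta (of_real (- a)) - 1 / 2) + 1))"
    by (rule sums_mult)
  moreover have a1: "1 + complex_of_real a \<noteq> 0" using a by (auto simp: complex_eq_iff)
  ultimately have "(\<lambda>n. complex_of_real (trap_powr a (Suc n))) sums (zeta (of_real (- a)) - 1 / 2 + 1 / (1 + of_real a))"
    using a by (simp add: distrib_left add_divide_distrib)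
  \<comment> \<open>The interval from 0 to 1 is put back: its error
    \<open>1 / 2 - 1 / (a + 1)\<close> cancels the constants, so the trapezoidal errors of
    \<open>u powr a\<close> sum exactly to zeta at \<open>- a\<close>.\<close>
  hence "(\<lambda>n. complex_of_real (trap_powr a n)) sums (zeta (of_real (- a)) - 1 / 2 + 1 / (1 + of_real a) + of_real (trap_powr a 0))"
    by (rule sums_Suc)
  also have "zeta (of_real (- a)) - 1 / 2 + 1 / (1 + of_real a) + of_real (trap_powr a 0) = zeta (of_real (- a))"
    using a a1 by (simp add: trap_powr_def add_ac)
  finally have s1: "(\<lambda>n. complex_of_real (trap_powr a n)) sums zeta (of_real (- a))" .
  define z where "z = Re (zeta (of_real (- a)))"
  have z1: "trap_powr a sums z" using sums_Re[OF s1] by (simp add: z_def)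
  have z2: "zeta (of_real (- a)) = of_real z" using sums_unique2[OF s1] z1 by (metis sums_of_real_iff)
  have "(\<lambda>n. of_nat (Suc n) powr (- of_real (1 + a))) sums zeta (of_real (1 + a))"
    by (rule zeta_sums) (use a in simp)
  moreover have "of_nat (Suc n) powr (- complex_of_real (1 + a)) = of_real (real (Suc n) powr (- 1 - a))" for n
    using powr_of_real[of "real (Suc n)" "- 1 - a"] by (simp del: of_nat_Suc)
  ultimately have s2: "(\<lambda>n. complex_of_real (real (Suc n) powr (- 1 - a))) sums zeta (of_real (1 + a))" by simp
  define z' where "z' = Re (zeta (of_real (1 + a)))"
  have z'1: "(\<lambda>n. real (Suc n) powr (- 1 - a)) sums z'" using sums_Re[OF s2] by (simp add: z'_def)
  have z'2: "zeta (of_real (1 + a)) = of_real z'" using sums_unique2[OF s2] z'1 by (metis sums_of_real_iff)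
  \<comment> \<open>The integral of \<open>x powr (- a - 1) * ?g x\<close> is evaluated twice. The
    trapezoidal errors of the exponential lead to zeta at \<open>- a\<close>, the partial fractions
    to zeta at \<open>1 + a\<close>.\<close>
  let ?g = "\<lambda>x::real. 1 / (exp x - 1) - 1 / x + 1 / 2"
  have G: "Gamma (2 - a) > 0" "Gamma ((1 - a) / 2) > 0" "Gamma ((1 + a) / 2) > 0"
    using a by (auto intro!: Gamma_real_pos)
  have c0: "Gamma (2 - a) / (a * (1 - a)) \<ge> 0" using G(1) a by simp
  define c where "c = Gamma ((1 - a) / 2) * Gamma ((1 + a) / 2)"
  have "(\<integral>\<^sup>+x. ennreal (indicator {0<..} x * (x powr (- a - 1) * ?g x)) \<partial>lborel) =
     (\<integral>\<^sup>+x. (\<Sum>n. ennreal (indicator {0<..} x * (x powr (- a - 1) * trap_exp n x))) \<partial>lborel)"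
  proof (intro nn_integral_cong)
    fix x :: real
    show "ennreal (indicator {0<..} x * (x powr (- a - 1) * ?g x)) = (\<Sum>n. ennreal (indicator {0<..} x * (x powr (- a - 1) * trap_exp n x)))"
    proof (cases "x > 0")
      case True
      have "(\<lambda>n. indicator {0<..} x * (x powr (- a - 1) * trap_exp n x)) sums (indicator {0<..} x * (x powr (- a - 1) * ?g x))"
        by (intro sums_mult trap_exp_sums True)
      thus ?thesis by (intro suminf_ennreal_eq[symmetric]) (auto simp: True trap_exp_nonneg)
    qed auto
  qed
  also have "\<dots> = (\<Sum>n. \<integral>\<^sup>+x. ennreal (indicator {0<..} x * (x powr (- a - 1) * trap_exp n x)) \<partial>lborel)"
    unfolding trap_exp_def by (intro nn_integral_suminf) measurable
  also have "\<dots> = (\<Sum>n. ennreal (Gamma (2 - a) / (a * (1 - a)) * - trap_powr a n))"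
    by (simp only: mellin_trap_exp[OF a])
  also have "\<dots> = ennreal (Gamma (2 - a) / (a * (1 - a)) * - z)"
    using trap_powr_nonpos[OF a] by (intro suminf_ennreal_eq sums_mult sums_minus z1 mult_nonneg_nonneg c0) auto
  finally have A: "(\<integral>\<^sup>+x. ennreal (indicator {0<..} x * (x powr (- a - 1) * ?g x)) \<partial>lborel) = ennreal (Gamma (2 - a) / (a * (1 - a)) * - z)" .
  have "(\<integral>\<^sup>+x. ennreal (indicator {0<..} x * (x powr (- a - 1) * ?g x)) \<partial>lborel) =
     (\<integral>\<^sup>+x. (\<Sum>n. ennreal (indicator {0<..} x * (x powr (- a - 1) * (2 * x / (x\<^sup>2 + (2 * pi * real (Suc n))\<^sup>2))))) \<partial>lborel)"
  proof (intro nn_integral_cong)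
    fix x :: real
    show "ennreal (indicator {0<..} x * (x powr (- a - 1) * ?g x)) = (\<Sum>n. ennreal (indicator {0<..} x * (x powr (- a - 1) * (2 * x / (x\<^sup>2 + (2 * pi * real (Suc n))\<^sup>2)))))"
    proof (cases "x > 0")
      case True
      have "(\<lambda>n. indicator {0<..} x * (x powr (- a - 1) * (2 * x / (x\<^sup>2 + (2 * pi * real (Suc n))\<^sup>2)))) sums (indicator {0<..} x * (x powr (- a - 1) * ?g x))"
        by (intro sums_mult bose_partial_fractions True)
      thus ?thesis by (intro suminf_ennreal_eq[symmetric]) (use True in \<open>auto intro!: mult_nonneg_nonneg divide_nonneg_nonneg add_nonneg_nonneg\<close>)
    qed auto
  qed
  also have "\<dots> = (\<Sum>n. \<integral>\<^sup>+x. ennreal (indicator {0<..} x * (x powr (- a - 1) * (2 * x / (x\<^sup>2 + (2 * pi * real (Suc n))\<^sup>2)))) \<partial>lborel)"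
    by (intro nn_integral_suminf) measurable
  also have "\<dots> = (\<Sum>n. ennreal (c * (2 * pi * real (Suc n)) powr (- 1 - a)))"
    by (subst mellin_rational[OF a]) (simp_all add: c_def)
  also have "\<dots> = ennreal (c * (2 * pi) powr (- 1 - a) * z')"
  proof (rule suminf_ennreal_eq)
    have "(\<lambda>n. c * (2 * pi) powr (- 1 - a) * real (Suc n) powr (- 1 - a)) sums (c * (2 * pi) powr (- 1 - a) * z')"
      by (intro sums_mult z'1)
    thus "(\<lambda>n. c * (2 * pi * real (Suc n)) powr (- 1 - a)) sums (c * (2 * pi) powr (- 1 - a) * z')"
      by (simp add: powr_mult mult.assoc del: of_nat_Suc)
  qed (use G in \<open>auto simp: c_def\<close>)
  finally have "ennreal (Gamma (2 - a) / (a * (1 - a)) * - z) = ennreal (c * (2 * pi) powr (- 1 - a) * z')"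
    unfolding A .
  moreover have "- z \<ge> 0" by (rule sums_le[OF _ sums_zero sums_minus[OF z1]]) (use trap_powr_nonpos[OF a] in simp)
  moreover have "z' \<ge> 0" by (rule sums_le[OF _ sums_zero z'1]) simp
  ultimately have "Gamma (2 - a) / (a * (1 - a)) * - z = c * (2 * pi) powr (- 1 - a) * z'"
    using G mult_nonneg_nonneg[OF c0, of "- z"] by (subst (asm) ennreal_inj) (auto simp: c_def)
  thus ?thesis using z2 z'2 that by (simp add: c_def)
qed

text \<open>\<open>rGamma\<close> is entire, so in this form the difference of the two sides is
  holomorphic off 0 and 1 and the identity theorem applies. It vanishes on the real segment from -1
  to 0, where Legendre duplication splits \<open>Gamma (- a)\<close> into the values at
  \<open>- a / 2\<close> and \<open>(1 - a) / 2\<close>.\<close>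

lemma functional_equation_rGamma:
  assumes "s \<noteq> 0" "s \<noteq> 1"
  shows "zeta s * rGamma ((1 - s) / 2) = of_real pi powr (s - 1 / 2) * zeta (1 - s) * rGamma (s / 2)"
proof -
  define f where "f = (\<lambda>s. zeta s * rGamma ((1 - s) / 2) - of_real pi powr (s - 1 / 2) * zeta (1 - s) * rGamma (s / 2))"
  define S where "S = - {0, 1 :: complex}"
  have opS: "open S" "connected S"
    unfolding S_def by (auto simp: open_Compl finite_imp_closed intro: connected_open_delete_finite[of UNIV, simplified Compl_eq_Diff_UNIV[symmetric]])
  have "(zeta \<circ> (\<lambda>s. 1 - s)) holomorphic_on S"
    by (rule holomorphic_on_compose_gen[of _ _ _ "- {1}"])
       (auto simp: S_def intro!: holomorphic_intros holomorphic_zeta)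
  hence "(\<lambda>s. zeta (1 - s)) holomorphic_on S" by (simp add: o_def)
  moreover have "zeta holomorphic_on S" by (rule holomorphic_on_subset[OF holomorphic_zeta]) (auto simp: S_def)
  ultimately have hol: "f holomorphic_on S"
    unfolding f_def by (intro holomorphic_intros holomorphic_on_compose_gen[OF _ holomorphic_rGamma[of UNIV], unfolded o_def]) auto
  define U where "U = complex_of_real ` {-1<..<0}"
  have "f s = 0"
  proof (rule analytic_continuation[OF hol opS])
    show "U \<subseteq> S" by (auto simp: U_def S_def)
    show "complex_of_real (-1/2) \<in> S" by (auto simp: S_def complex_eq_iff)
    have "complex_of_real (-1/2) islimpt complex_of_real ` {-1<..<0}"
    proof (rule islimpt_isCont_image)
      show "(-1/2::real) islimpt {-1<..<0}" by (rule interior_limit_point) simp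
      show "isCont complex_of_real (-1/2)" by (intro continuous_intros)
      show "\<forall>\<^sub>F y in at (-1/2). complex_of_real y \<noteq> complex_of_real (-1/2)"
        by (simp only: of_real_eq_iff) (simp add: eventually_at_filter)
    qed
    thus "complex_of_real (-1/2) islimpt U" by (simp only: U_def)
    show "s \<in> S" using assms by (auto simp: S_def)
    fix w assume "w \<in> U"
    then obtain a where a: "0 < a" "a < 1" "w = of_real (- a)" unfolding U_def
      by (auto intro: that[of "- x" for x])
    obtain z z' where z: "zeta (of_real (- a)) = of_real z" "zeta (of_real (1 + a)) = of_real z'"
      and eq: "Gamma (2 - a) / (a * (1 - a)) * - z = Gamma ((1 - a) / 2) * Gamma ((1 + a) / 2) * (2 * pi) powr (- 1 - a) * z'"
      by (rule real_functional_equation[OF a(1,2)])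
    have nonint: "complex_of_real x \<notin> \<int>\<^sub>\<le>\<^sub>0" if "-1 < x" "x \<noteq> 0" for x
    proof
      assume "complex_of_real x \<in> \<int>\<^sub>\<le>\<^sub>0"
      then obtain n where n: "complex_of_real x = of_int n" "n \<le> 0" by (elim nonpos_Ints_cases)
      hence "x = of_int n" by (metis of_real_eq_iff of_real_of_int_eq)
      thus False using that n by simp
    qed
    define A where "A = Gamma (complex_of_real (- a / 2))"
    define B where "B = Gamma (complex_of_real ((1 - a) / 2))"
    define C where "C = Gamma (complex_of_real ((1 + a) / 2))"
    define E where "E = Gamma (complex_of_real (- a))"
    have nz: "A \<noteq> 0" "B \<noteq> 0" "C \<noteq> 0"
      unfolding A_def B_def C_def
      by (subst Gamma_eq_zero_iff, rule nonint, use a in simp, use a in simp)+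
    have "complex_of_real (- a / 2) + 1 / 2 = of_real ((1 - a) / 2)" "2 * complex_of_real (- a / 2) = of_real (- a)"
      "(1 - 2 * complex_of_real (- a / 2)) * of_real (ln 2) = of_real ((1 + a) * ln 2)"
      by (simp_all add: diff_divide_distrib)
    note e = this
    have "A * B = exp ((1 - 2 * complex_of_real (- a / 2)) * of_real (ln 2)) * of_real (sqrt pi) * Gamma (2 * complex_of_real (- a / 2))"
      unfolding A_def B_def e(1)[symmetric]
    proof (rule Gamma_legendre_duplication)
      show "complex_of_real (- a / 2) \<notin> \<int>\<^sub>\<le>\<^sub>0" by (rule nonint) (use a in simp_all)
      show "complex_of_real (- a / 2) + 1 / 2 \<notin> \<int>\<^sub>\<le>\<^sub>0" unfolding e(1) by (rule nonint) (use a in simp_all)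
    qed
    also have "exp ((1 - 2 * complex_of_real (- a / 2)) * of_real (ln 2)) = of_real (2 powr (1 + a))"
      unfolding e(3) exp_of_real by (simp add: powr_def)
    finally have dup: "A * B = of_real (2 powr (1 + a) * sqrt pi) * E"
      unfolding e(2) E_def of_real_mult .
    have "Gamma (complex_of_real (- a) + 1) = of_real (- a) * E"
      unfolding E_def by (rule Gamma_plus1, rule nonint) (use a in simp_all)
    moreover have "Gamma (complex_of_real (1 - a) + 1) = of_real (1 - a) * Gamma (of_real (1 - a))"
      by (rule Gamma_plus1, rule nonint) (use a in simp_all)
    ultimately have "Gamma (complex_of_real (2 - a)) = of_real (1 - a) * (of_real (- a) * E)" by simp
    hence g2: "complex_of_real (Gamma (2 - a)) = - (of_real (a * (1 - a)) * E)"
      by (simp only: Gamma_complex_of_real of_real_mult of_real_minus) simp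
    have "complex_of_real (a * (1 - a)) \<noteq> 0" using a by simp
    moreover have "complex_of_real (Gamma (2 - a) / (a * (1 - a)) * - z) = of_real (Gamma ((1 - a) / 2) * Gamma ((1 + a) / 2) * (2 * pi) powr (- 1 - a) * z')"
      by (simp only: eq)
    ultimately have "E * of_real z = B * C * of_real ((2 * pi) powr (- 1 - a)) * of_real z'"
      unfolding B_def C_def Gamma_complex_of_real by (simp only: of_real_mult of_real_divide of_real_minus g2) simp
    hence "of_real (2 powr (1 + a) * sqrt pi) * E * of_real z =
      of_real (2 powr (1 + a) * sqrt pi) * (B * C * of_real ((2 * pi) powr (- 1 - a)) * of_real z')" by simp
    hence "B * (A * of_real z) = B * (C * of_real (2 powr (1 + a) * sqrt pi * (2 * pi) powr (- 1 - a)) * of_real z')"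
      unfolding dup[symmetric] by (simp only: of_real_mult mult_ac)
    hence Az: "A * of_real z = C * of_real (2 powr (1 + a) * sqrt pi * (2 * pi) powr (- 1 - a)) * of_real z'"
      using nz(2) mult_left_cancel by blast
    have "2 powr (1 + a) * sqrt pi * (2 * pi) powr (- 1 - a) = pi powr (- a - 1 / 2)"
    proof -
      have "2 powr (1 + a) * sqrt pi * (2 * pi) powr (- 1 - a) = (2 powr (1 + a) * 2 powr (- 1 - a)) * (pi powr (1 / 2) * pi powr (- 1 - a))"
        by (simp add: powr_mult powr_half_sqrt)
      also have "\<dots> = pi powr (- a - 1 / 2)"
      proof -
        have "1 + a + (- 1 - a) = 0" "1 / 2 + (- 1 - a) = - a - 1 / 2" by simp_all
        thus ?thesis by (simp only: powr_add[symmetric]) simp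
      qed
      finally show ?thesis .
    qed
    with Az have Az: "A * of_real z = C * of_real (pi powr (- a - 1 / 2)) * of_real z'" by simp
    have w: "(1 - w) / 2 = of_real ((1 + a) / 2)" "w / 2 = of_real (- a / 2)" "1 - w = of_real (1 + a)"
      "w - 1 / 2 = of_real (- a - 1 / 2)" by (simp_all add: a)
    have pw: "of_real pi powr (of_real (- a - 1 / 2)) = complex_of_real (pi powr (- a - 1 / 2))"
      by (rule powr_of_real) auto
    have "f w = of_real z * rGamma (of_real ((1 + a) / 2)) - of_real (pi powr (- a - 1 / 2)) * of_real z' * rGamma (of_real (- a / 2))"
    proof -
      have "zeta w = of_real z" "zeta (1 - w) = of_real z'" unfolding w(3) z unfolding a(3) z by (rule refl)+
      thus ?thesis unfolding f_def w(1,2,4) pw by (simp only:)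
    qed
    also have "\<dots> = of_real z * inverse C - of_real (pi powr (- a - 1 / 2)) * of_real z' * inverse A"
      by (simp only: A_def C_def Gamma_def inverse_inverse_eq)
    also have "\<dots> = (A * of_real z - C * of_real (pi powr (- a - 1 / 2)) * of_real z') * (inverse C * inverse A)"
      using nz by (simp add: field_simps)
    finally show "f w = 0" unfolding Az by simp
  qed
  thus ?thesis by (simp add: f_def)
qed

section \<open>Hardy's function is real\<close>

lemma zeta_cnj: "zeta (cnj s) = cnj (zeta s)"
proof -
  have "zeta_continuation (cnj \<circ> zeta \<circ> cnj)"
    unfolding zeta_continuation_def
  proof (intro conjI allI impI)
    show "(cnj \<circ> zeta \<circ> cnj) holomorphic_on - {1}"
      unfolding holomorphic_on_def
    proof
      fix s :: complex assume s: "s \<in> - {1}"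
      hence "cnj s \<in> - {1}" by (auto simp: complex_eq_iff)
      moreover have "open (- {1::complex})" by auto
      ultimately obtain D where "(zeta has_field_derivative D) (at (cnj s))"
        using holomorphic_on_imp_differentiable_at[OF holomorphic_zeta] unfolding field_differentiable_def by blast
      hence "((cnj \<circ> zeta \<circ> cnj) has_field_derivative cnj D) (at s)"
        by (simp add: has_field_derivative_cnj_cnj)
      thus "(cnj \<circ> zeta \<circ> cnj) field_differentiable at s within - {1}"
        unfolding field_differentiable_def using has_field_derivative_at_within by blast
    qed
    show "(cnj \<circ> zeta \<circ> cnj) 1 = 0" using zeta_continuation_zeta by (simp add: zeta_continuation_def)
    fix s :: complex assume s: "Re s > 1"
    have "(\<lambda>n. cnj (of_nat (Suc n) powr (- cnj s))) sums cnj (zeta (cnj s))"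
      unfolding sums_cnj by (rule zeta_sums) (use s in simp)
    thus "(\<lambda>n. of_nat (Suc n) powr - s) sums (cnj \<circ> zeta \<circ> cnj) s"
      by (simp add: cnj_powr del: of_nat_Suc)
  qed
  from zeta_continuation_unique[OF this zeta_continuation_zeta] show ?thesis
    by (metis complex_cnj_cnj o_apply)
qed

text \<open>On the critical line \<open>1 - s\<close> is \<open>cnj s\<close>, so the functional
  equation says that \<open>zeta s * cis (RS_theta t)\<close> is its own conjugate. Taking
  \<open>Re\<close> in the definition of \<open>hardy_Z\<close> therefore loses nothing.\<close>

lemma hardy_Z_eq: "of_real (hardy_Z t) = zeta (critical t) * cis (RS_theta t)"
proof -
  define s where "s = critical t"
  have s: "s \<noteq> 0" "s \<noteq> 1" "1 - s = cnj s" by (auto simp: s_def complex_eq_iff)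
  have r: "rGamma ((1 - s) / 2) \<noteq> 0"
  proof -
    have "(1 - s) / 2 \<notin> \<int>\<^sub>\<le>\<^sub>0" using nonpos_Ints_subset_nonpos_Reals by (auto simp: s_def complex_nonpos_Reals_iff)
    thus ?thesis by (simp add: rGamma_eq_zero_iff)
  qed
  have "zeta s = chi s * zeta (1 - s)"
    using functional_equation_rGamma[OF s(1,2)] r by (simp add: chi_def Gamma_def field_simps)
  hence "zeta s = exp (- 2 * \<i> * of_real (RS_theta t)) * cnj (zeta s)"
    unfolding s(3) zeta_cnj by (simp add: s_def chi_critical)
  hence "zeta s * cis (RS_theta t) = (exp (- 2 * \<i> * of_real (RS_theta t)) * cis (RS_theta t)) * cnj (zeta s)" by simp
  also have "exp (- 2 * \<i> * of_real (RS_theta t)) * cis (RS_theta t) = cnj (cis (RS_theta t))"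
    by (simp add: cis_conv_exp exp_cnj mult_exp_exp algebra_simps)
  finally have "cnj (zeta s * cis (RS_theta t)) = zeta s * cis (RS_theta t)" by (simp add: mult.commute)
  hence "zeta s * cis (RS_theta t) \<in> \<real>" by (simp add: Reals_cnj_iff)
  moreover have "hardy_Z t = Re (zeta s * cis (RS_theta t))"
    by (simp only: hardy_Z_def chi_inv_sqrt_eq s_def cis_conv_exp)
  ultimately show ?thesis by (simp only: s_def of_real_Re)
qed

lemma abs_hardy_Z: "\<bar>hardy_Z t\<bar> = norm (zeta (critical t))"
proof -
  have "\<bar>hardy_Z t\<bar> = norm (complex_of_real (hardy_Z t))" by simp
  thus ?thesis unfolding hardy_Z_eq by (simp add: norm_mult)
qed

section \<open>Integrals of Hardy's function\<close>

lemma dsum_eq: "dsum X t = (\<Sum>k=1..X. of_real (1 / sqrt (real k)) * cis (- ln (real k) * t))"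
proof -
  have "of_nat k powr (- critical t) = of_real (1 / sqrt (real k)) * cis (- ln (real k) * t)" if "k \<in> {1..X}" for k
  proof -
    have k: "k \<ge> 1" using that by simp
    have "of_nat k powr (- critical t) = exp (- critical t * of_real (ln (real k)))"
    proof -
      have "Ln (of_nat k) = of_real (ln (real k))" using k by (intro Ln_of_nat) simp
      thus ?thesis using k by (simp add: powr_def)
    qed
    also have "- critical t * of_real (ln (real k)) = of_real (- ln (real k) / 2) + \<i> * of_real (- ln (real k) * t)"
      by (simp add: algebra_simps)
    also have "exp \<dots> = of_real (exp (- ln (real k) / 2)) * cis (- ln (real k) * t)"
      by (simp only: exp_add exp_of_real cis_conv_exp)
    also have "exp (- ln (real k) / 2) = 1 / sqrt (real k)"
      using k by (simp add: exp_minus ln_sqrt[symmetric] inverse_eq_divide)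
    finally show ?thesis .
  qed
  thus ?thesis unfolding dsum_def by (rule sum.cong[OF refl])
qed

lemma continuous_on_dsum [continuous_intros]: "continuous_on A (dsum X)"
  unfolding dsum_eq[abs_def] by (intro continuous_intros)

lemma continuous_on_zeta_critical: "continuous_on A (\<lambda>t. zeta (critical t))"
  by (intro continuous_on_compose2[OF holomorphic_on_imp_continuous_on[OF holomorphic_zeta]]
        continuous_intros) (auto simp: complex_eq_iff)

lemma norm_integral_dsum_mult_le:
  fixes G :: "real \<Rightarrow> complex"
  assumes G: "continuous_on {a..b} G"
    and b: "\<And>k. k \<in> {1..X} \<Longrightarrow> norm (integral {a..b} (\<lambda>t. cis (- ln (real k) * t) * G t)) \<le> B k"
  shows "norm (integral {a..b} (\<lambda>t. dsum X t * G t)) \<le> (\<Sum>k=1..X. B k / sqrt (real k))"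
proof -
  have "((\<lambda>t. \<Sum>k=1..X. of_real (1 / sqrt (real k)) * (cis (- ln (real k) * t) * G t)) has_integral
    (\<Sum>k=1..X. of_real (1 / sqrt (real k)) * integral {a..b} (\<lambda>t. cis (- ln (real k) * t) * G t))) {a..b}"
    by (intro has_integral_sum has_integral_mult_right integrable_integral integrable_continuous_interval continuous_intros G) auto
  moreover have "dsum X t * G t = (\<Sum>k=1..X. of_real (1 / sqrt (real k)) * (cis (- ln (real k) * t) * G t))" for t
    unfolding dsum_eq sum_distrib_right by (simp only: mult.assoc)
  ultimately have "integral {a..b} (\<lambda>t. dsum X t * G t) =
    (\<Sum>k=1..X. of_real (1 / sqrt (real k)) * integral {a..b} (\<lambda>t. cis (- ln (real k) * t) * G t))"
    by (simp only: integral_unique)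
  also have "norm \<dots> \<le> (\<Sum>k=1..X. B k / sqrt (real k))"
    by (intro sum_norm_le) (use b in \<open>auto simp: norm_mult norm_divide intro!: divide_right_mono\<close>)
  finally show ?thesis .
qed

lemma sum_inverse_sqrt_le: "(\<Sum>k=1..n. 1 / sqrt (real k)) \<le> 2 * sqrt (real n)"
proof (induction n)
  case (Suc n)
  have "1 / sqrt (real (Suc n)) \<le> 2 * (sqrt (real (Suc n)) - sqrt (real n))"
  proof -
    have "(sqrt (real (Suc n)) - sqrt (real n)) * (sqrt (real (Suc n)) + sqrt (real n)) = 1"
      by (simp add: algebra_simps)
    moreover have "sqrt (real (Suc n)) + sqrt (real n) \<le> 2 * sqrt (real (Suc n))" by simp
    moreover have "sqrt (real (Suc n)) - sqrt (real n) \<ge> 0" by simp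
    ultimately have "1 \<le> (sqrt (real (Suc n)) - sqrt (real n)) * (2 * sqrt (real (Suc n)))"
      by (metis mult_left_mono)
    moreover define s d where "s = sqrt (real (Suc n))" and "d = sqrt (real (Suc n)) - sqrt (real n)"
    ultimately have "1 \<le> d * (2 * s)" "s > 0" by (simp_all only: s_def d_def) simp
    hence "1 / s \<le> 2 * d" by (simp add: pos_divide_le_eq mult_ac)
    thus ?thesis by (simp only: s_def d_def)
  qed
  thus ?case using Suc.IH by simp
qed simp

text \<open>The factor 320 is \<open>8 * sqrt 1600\<close>, from the lower bound for
  \<open>theta''\<close>. In the second case the derivative of the phase is at most -1 throughout,
  because \<open>theta'\<close> is at most \<open>ln T / 2 + 1\<close>.\<close>

lemma theta_integral_bounds:
  assumes ab: "1 \<le> a" "a \<le> b" "b \<le> T"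
  shows "norm (integral {a..b} (\<lambda>t. cis (RS_theta t - c * t))) \<le> 320 * sqrt T"
    and "c \<ge> ln T / 2 + 2 \<Longrightarrow> norm (integral {a..b} (\<lambda>t. cis (RS_theta t - c * t))) \<le> 3"
proof -
  have d1: "((\<lambda>t. RS_theta t - c * t) has_real_derivative theta' t - c) (at t)" for t
    by (auto intro!: derivative_eq_intros RS_theta_deriv)
  have d2: "((\<lambda>t. theta' t - c) has_real_derivative theta'' t) (at t)" for t
    using DERIV_diff[OF theta'_deriv DERIV_const[of c]] by simp
  have ge: "theta'' t \<ge> 1 / (1600 * T)" if "t \<in> {a..b}" for t
  proof -
    have "1 / (1600 * T) \<le> 1 / (1600 * t)" using that ab by (intro divide_left_mono) auto
    also have "\<dots> \<le> theta'' t" using that ab by (intro theta''_ge) auto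
    finally show ?thesis .
  qed
  have T: "T \<ge> 1" using ab by simp
  have "norm (integral {a..b} (\<lambda>t. cis (RS_theta t - c * t))) \<le> 8 / sqrt (1 / (1600 * T))"
    by (rule second_derivative_test[OF ab(2) d1 d2 ge]) (use T in auto)
  also have "sqrt 1600 = 40" by (rule real_sqrt_unique) auto
  hence "8 / sqrt (1 / (1600 * T)) = 320 * sqrt T" by (simp add: real_sqrt_divide real_sqrt_mult)
  finally show "norm (integral {a..b} (\<lambda>t. cis (RS_theta t - c * t))) \<le> 320 * sqrt T" .
  assume c: "c \<ge> ln T / 2 + 2"
  have le: "theta' t - c \<le> - 1" if "t \<in> {a..b}" for t
  proof -
    have "theta' t \<le> ln t / 2 + 1" using that ab by (intro theta'_le) auto
    moreover have "ln t \<le> ln T" using that ab by (subst ln_le_cancel_iff) auto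
    ultimately show ?thesis using c by simp
  qed
  have "theta'' t \<ge> 0" if "t \<in> {a..b}" for t
    using order_trans[OF _ ge[OF that], of 0] T by simp
  from first_derivative_test[OF ab(2) d1 d2 this, of 1] le
  show "norm (integral {a..b} (\<lambda>t. cis (RS_theta t - c * t))) \<le> 3" by simp
qed

text \<open>A stationary phase forces \<open>k \<le> 9 * sqrt T\<close>, as
  \<open>exp 2 \<le> 9\<close>; these terms cost \<open>320 * sqrt T / sqrt k\<close> each and
  \<open>1920 * T powr (3/4)\<close> in all. The sign of \<open>\<nu>\<close> matters: a negative
  shift would allow stationary points for \<open>k\<close> up to about
  \<open>exp (- \<nu>) * sqrt T\<close>.\<close>

lemma dsum_theta_integral_le:
  assumes ab: "1 \<le> a" "a \<le> b" "b \<le> T" and \<nu>: "\<nu> \<ge> 0"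
  shows "norm (integral {a..b} (\<lambda>t. dsum X t * (cis (RS_theta t) * cis (- \<nu> * t)))) \<le>
    1920 * T powr (3/4) + 6 * sqrt (real X)"
proof -
  define B where "B = (\<lambda>k. if ln (real k) + \<nu> < ln T / 2 + 2 then 320 * sqrt T else 3 :: real)"
  have T: "T \<ge> 1" using ab by simp
  have "norm (integral {a..b} (\<lambda>t. dsum X t * (cis (RS_theta t) * cis (- \<nu> * t)))) \<le> (\<Sum>k=1..X. B k / sqrt (real k))"
  proof (rule norm_integral_dsum_mult_le)
    show "continuous_on {a..b} (\<lambda>t. cis (RS_theta t) * cis (- \<nu> * t))"
      by (intro continuous_intros continuous_on_subset[OF continuous_RS_theta]) auto
    fix k assume "k \<in> {1..X}"
    have "cis (- ln (real k) * t) * (cis (RS_theta t) * cis (- \<nu> * t)) = cis (RS_theta t - (ln (real k) + \<nu>) * t)" for t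
      by (simp add: cis_mult algebra_simps)
    thus "norm (integral {a..b} (\<lambda>t. cis (- ln (real k) * t) * (cis (RS_theta t) * cis (- \<nu> * t)))) \<le> B k"
      using theta_integral_bounds[OF ab, of "ln (real k) + \<nu>"] by (simp add: B_def)
  qed
  also have "\<dots> \<le> (\<Sum>k=1..X. (if ln (real k) + \<nu> < ln T / 2 + 2 then 320 * sqrt T * (1 / sqrt (real k)) else 0) + 3 * (1 / sqrt (real k)))"
    by (intro sum_mono) (auto simp: B_def)
  also have "\<dots> = (\<Sum>k\<in>{k\<in>{1..X}. ln (real k) + \<nu> < ln T / 2 + 2}. 320 * sqrt T * (1 / sqrt (real k))) + 3 * (\<Sum>k=1..X. 1 / sqrt (real k))"
    unfolding sum.distrib sum_distrib_left by (subst sum.inter_filter) auto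
  also have "(\<Sum>k\<in>{k\<in>{1..X}. ln (real k) + \<nu> < ln T / 2 + 2}. 320 * sqrt T * (1 / sqrt (real k))) \<le>
     (\<Sum>k\<in>{1..nat \<lfloor>9 * sqrt T\<rfloor>}. 320 * sqrt T * (1 / sqrt (real k)))"
  proof (rule sum_mono2)
    show "{k\<in>{1..X}. ln (real k) + \<nu> < ln T / 2 + 2} \<subseteq> {1..nat \<lfloor>9 * sqrt T\<rfloor>}"
    proof safe
      fix k assume k: "k \<in> {1..X}" "ln (real k) + \<nu> < ln T / 2 + 2"
      have "real k = exp (ln (real k))" using k by simp
      also have "\<dots> \<le> exp (ln (sqrt T) + 2)" using k \<nu> T by (subst exp_le_cancel_iff) (simp add: ln_sqrt)
      also have "\<dots> = sqrt T * (exp 1 * exp 1)" using T by (simp add: exp_add mult_exp_exp)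
      also have "\<dots> \<le> sqrt T * (3 * 3)" using T exp_le by (intro mult_left_mono mult_mono) auto
      finally have "real k \<le> 9 * sqrt T" by simp
      thus "k \<in> {1..nat \<lfloor>9 * sqrt T\<rfloor>}" using k by (simp add: le_nat_floor)
    qed
  qed (use T in auto)
  also have "\<dots> = 320 * sqrt T * (\<Sum>k\<in>{1..nat \<lfloor>9 * sqrt T\<rfloor>}. 1 / sqrt (real k))" by (simp add: sum_distrib_left)
  also have "\<dots> \<le> 320 * sqrt T * (2 * sqrt (real (nat \<lfloor>9 * sqrt T\<rfloor>)))"
    using T by (intro mult_left_mono sum_inverse_sqrt_le) auto
  also have "\<dots> \<le> 320 * sqrt T * (2 * sqrt (9 * sqrt T))" using T by (intro mult_left_mono real_sqrt_le_mono) auto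
  also have "\<dots> = 1920 * T powr (3/4)"
  proof -
    have "sqrt 9 = 3" by (rule real_sqrt_unique) auto
    moreover have "sqrt T * sqrt (sqrt T) = T powr (1/2) * T powr (1/4)" using T by (simp add: powr_half_sqrt[symmetric] powr_powr)
    moreover have "\<dots> = T powr (3/4)" by (simp flip: powr_add)
    ultimately show ?thesis by (simp add: real_sqrt_mult)
  qed
  finally show ?thesis using sum_inverse_sqrt_le[of X] by simp
qed

lemma harm_bound: "n \<ge> 1 \<Longrightarrow> (\<Sum>j=1..n. 1 / real j) \<le> 1 + ln (real n)"
proof (induction n rule: dec_induct)
  case (step n)
  have "ln (real n) - ln (real (Suc n)) = ln (real n / real (Suc n))" using step by (simp add: ln_div)
  also have "\<dots> \<le> real n / real (Suc n) - 1" using step by (intro ln_le_minus_one) auto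
  also have "\<dots> = - (1 / real (Suc n))" by (simp add: field_simps)
  finally show ?case using step.IH by simp
qed auto

text \<open>The frequency \<open>\<mu>\<close> resonates with \<open>k\<close> near
  \<open>exp \<mu>\<close>. The at most two nearest \<open>k\<close> are bounded by the length
  \<open>Y\<close>; for the others the integral is at most
  \<open>2 / \<bar>\<mu> - ln k\<bar>\<close>, and the distances of \<open>k\<close> from
  \<open>exp \<mu>\<close> give harmonic sums.\<close>

lemma dsum_integral_le:
  assumes Y: "0 \<le> x" "x \<le> Y" and X: "X \<ge> 1"
  shows "norm (integral {0..x} (\<lambda>t. dsum X t * cis (\<mu> * t))) \<le> 2 * Y + 20 * sqrt (real X) * (1 + ln (real X))"
proof -
  define \<kappa> where "\<kappa> = exp \<mu>"
  define k0 where "k0 = nat \<lfloor>\<kappa>\<rfloor>"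
  have \<kappa>: "\<kappa> > 0" "ln \<kappa> = \<mu>" "real k0 \<le> \<kappa>" "\<kappa> < real k0 + 1" by (simp_all add: \<kappa>_def k0_def)
  \<comment> \<open>\<open>exp \<mu>\<close> may be far beyond \<open>X\<close>; the cap keeps the
    harmonic sum below within length \<open>X\<close>.\<close>
  define m where "m = min k0 (Suc X)"
  define I where "I = (\<lambda>k. norm (integral {0..x} (\<lambda>t. cis (- ln (real k) * t) * cis (\<mu> * t))))"
  have cm: "cis (- ln (real k) * t) * cis (\<mu> * t) = cis ((\<mu> - ln (real k)) * t)" for k t
    by (simp add: cis_mult algebra_simps)
  have I1: "I k \<le> Y" for k using norm_integral_cis_le(1)[OF Y(1), of "\<mu> - ln (real k)"] Y unfolding I_def cm by linarith
  have I2: "I k \<le> 2 / \<bar>\<mu> - ln (real k)\<bar>" if "\<mu> \<noteq> ln (real k)" for k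
    using norm_integral_cis_le(2)[OF Y(1), of "\<mu> - ln (real k)"] that unfolding I_def cm by simp
  have up: "I k / sqrt (real k) \<le> 2 * sqrt (real X) * (1 / real (k - Suc k0))" if k: "k \<in> {k0+2..X}" for k
  proof -
    have j: "real (k - Suc k0) = real k - real k0 - 1" "real (k - Suc k0) \<ge> 1" using k by (auto simp: of_nat_diff)
    have kp: "real k > \<kappa>" "real k > 0" using k \<kappa> j by linarith+
    have "ln (\<kappa> / real k) \<le> \<kappa> / real k - 1" using kp \<kappa> by (intro ln_le_minus_one) auto
    hence "ln (real k) - \<mu> \<ge> 1 - \<kappa> / real k" using kp \<kappa> by (simp add: ln_div)
    also have "1 - \<kappa> / real k = (real k - \<kappa>) / real k" using kp by (simp add: diff_divide_distrib)
    finally have l: "ln (real k) - \<mu> \<ge> real (k - Suc k0) / real k"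
      using j \<kappa> kp divide_right_mono[of "real (k - Suc k0)" "real k - \<kappa>" "real k"] by linarith
    have lp: "real (k - Suc k0) / real k > 0" using j kp by (intro divide_pos_pos) auto
    define r where "r = real (k - Suc k0) / real k"
    have r: "r > 0" "\<bar>\<mu> - ln (real k)\<bar> \<ge> r" using l lp unfolding r_def[symmetric] by linarith+
    have "I k \<le> 2 / \<bar>\<mu> - ln (real k)\<bar>" using r by (intro I2) auto
    also have "\<dots> \<le> 2 / r" using r by (intro divide_left_mono) auto
    also have "\<dots> = 2 / (real (k - Suc k0) / real k)" by (simp only: r_def)
    finally have "I k / sqrt (real k) \<le> 2 / (real (k - Suc k0) / real k) / sqrt (real k)" by (rule divide_right_mono) simp
    also have "\<dots> = 2 * (real k / sqrt (real k)) * (1 / real (k - Suc k0))" by simp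
    also have "real k / sqrt (real k) = sqrt (real k)" by (simp add: real_div_sqrt)
    also have "2 * sqrt (real k) * (1 / real (k - Suc k0)) \<le> 2 * sqrt (real X) * (1 / real (k - Suc k0))"
      using k by (intro mult_right_mono mult_left_mono) auto
    finally show ?thesis .
  qed
  have down: "I k / sqrt (real k) \<le> 4 * (1 / sqrt (real k)) + 4 * sqrt (real X) * (1 / real (m - k))" if k: "k \<in> {1..<m}" for k
  proof -
    have j: "real (m - k) \<le> \<kappa> - real k" "real (m - k) \<ge> 1" "real k > 0" "k \<le> X"
      using k \<kappa> by (auto simp: of_nat_diff m_def)
    hence kk: "\<kappa> > real k" by linarith
    have "ln (real k / \<kappa>) \<le> real k / \<kappa> - 1" using \<kappa> j by (intro ln_le_minus_one) auto
    hence l: "\<mu> - ln (real k) \<ge> 1 - real k / \<kappa>" using \<kappa> j by (simp add: ln_div)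
    have l0: "1 - real k / \<kappa> > 0" using kk \<kappa> by (simp add: field_simps)
    have "I k \<le> 2 / \<bar>\<mu> - ln (real k)\<bar>" using l l0 by (intro I2) auto
    also have "\<dots> \<le> 2 / (1 - real k / \<kappa>)" using l l0 by (intro divide_left_mono) auto
    also have "\<dots> = 2 * \<kappa> / (\<kappa> - real k)" using \<kappa>(1) by (simp add: field_simps)
    \<comment> \<open>If \<open>\<kappa>\<close> is at least twice \<open>k\<close>, the quotient is
      at most 4; otherwise the numerator is at most \<open>4 * k\<close> and the distance
      decides.\<close>
    also have "\<dots> \<le> 4 + 4 * real k / real (m - k)"
    proof (cases "\<kappa> \<ge> 2 * real k")
      case True
      hence "2 * \<kappa> / (\<kappa> - real k) \<le> 4" using kk by (simp add: divide_le_eq)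
      thus ?thesis by (intro add_increasing2) auto
    next
      case False
      hence "2 * \<kappa> / (\<kappa> - real k) \<le> 4 * real k / real (m - k)" using j by (intro frac_le) auto
      thus ?thesis by (intro add_increasing) auto
    qed
    finally have "I k / sqrt (real k) \<le> (4 + 4 * real k / real (m - k)) / sqrt (real k)" by (rule divide_right_mono) simp
    also have "\<dots> = 4 * (1 / sqrt (real k)) + 4 * (real k / sqrt (real k)) * (1 / real (m - k))"
      by (simp add: add_divide_distrib)
    also have "real k / sqrt (real k) = sqrt (real k)" by (simp add: real_div_sqrt)
    also have "4 * sqrt (real k) * (1 / real (m - k)) \<le> 4 * sqrt (real X) * (1 / real (m - k))"
      using j by (intro mult_right_mono mult_left_mono) auto
    finally show ?thesis by simp
  qed
  have hX: "(\<Sum>j=1..n. 1 / real j) \<le> 1 + ln (real X)" if "n \<le> X" for n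
  proof -
    have "(\<Sum>j=1..n. 1 / real j) \<le> (\<Sum>j=1..X. 1 / real j)" using that by (intro sum_mono2) auto
    thus ?thesis using harm_bound[OF X] by linarith
  qed
  have "norm (integral {0..x} (\<lambda>t. dsum X t * cis (\<mu> * t))) \<le> (\<Sum>k=1..X. I k / sqrt (real k))"
    by (rule norm_integral_dsum_mult_le) (auto intro!: continuous_intros simp: I_def)
  also have "\<dots> \<le> (\<Sum>k\<in>{1..<m} \<union> {max 1 k0..k0+1} \<union> {k0+2..X}. I k / sqrt (real k))"
    by (intro sum_mono2) (auto simp: m_def I_def)
  also have "\<dots> \<le> (\<Sum>k\<in>{1..<m}. I k / sqrt (real k)) + (\<Sum>k\<in>{max 1 k0..k0+1}. I k / sqrt (real k)) + (\<Sum>k\<in>{k0+2..X}. I k / sqrt (real k))"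
    by (subst sum.union_disjoint, (auto simp: m_def)[3], subst sum.union_disjoint) (auto simp: m_def)
  also have "(\<Sum>k\<in>{k0+2..X}. I k / sqrt (real k)) \<le> 2 * sqrt (real X) * (1 + ln (real X))"
  proof -
    have "(\<Sum>k\<in>{k0+2..X}. I k / sqrt (real k)) \<le> (\<Sum>k\<in>{k0+2..X}. 2 * sqrt (real X) * (1 / real (k - Suc k0)))"
      by (intro sum_mono up)
    also have "\<dots> = 2 * sqrt (real X) * (\<Sum>k\<in>{k0+2..X}. 1 / real (k - Suc k0))" by (simp add: sum_distrib_left)
    also have "(\<Sum>k\<in>{k0+2..X}. 1 / real (k - Suc k0)) = (\<Sum>j=1..X - Suc k0. 1 / real j)"
      by (rule sum.reindex_bij_witness[of _ "\<lambda>j. j + Suc k0" "\<lambda>k. k - Suc k0"]) auto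
    also have "2 * sqrt (real X) * \<dots> \<le> 2 * sqrt (real X) * (1 + ln (real X))" by (intro mult_left_mono hX) auto
    finally show ?thesis .
  qed
  also have "(\<Sum>k\<in>{max 1 k0..k0+1}. I k / sqrt (real k)) \<le> 2 * Y"
  proof -
    have "(\<Sum>k\<in>{max 1 k0..k0+1}. I k / sqrt (real k)) \<le> (\<Sum>k\<in>{max 1 k0..k0+1}. Y)"
    proof (intro sum_mono)
      fix k assume "k \<in> {max 1 k0..k0+1}"
      hence "sqrt (real k) \<ge> 1" by simp
      hence "I k / sqrt (real k) \<le> I k / 1" by (intro divide_left_mono) (auto simp: I_def)
      thus "I k / sqrt (real k) \<le> Y" using I1[of k] by simp
    qed
    also have "\<dots> = real (card {max 1 k0..k0+1}) * Y" by simp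
    also have "\<dots> \<le> 2 * Y" using Y by (intro mult_right_mono) auto
    finally show ?thesis .
  qed
  also have "(\<Sum>k\<in>{1..<m}. I k / sqrt (real k)) \<le> 8 * sqrt (real X) + 4 * sqrt (real X) * (1 + ln (real X))"
  proof -
    have "(\<Sum>k\<in>{1..<m}. I k / sqrt (real k)) \<le> (\<Sum>k\<in>{1..<m}. 4 * (1 / sqrt (real k)) + 4 * sqrt (real X) * (1 / real (m - k)))"
      by (intro sum_mono down)
    also have "\<dots> = 4 * (\<Sum>k\<in>{1..<m}. 1 / sqrt (real k)) + 4 * sqrt (real X) * (\<Sum>k\<in>{1..<m}. 1 / real (m - k))"
      by (simp add: sum_distrib_left sum.distrib)
    also have "(\<Sum>k\<in>{1..<m}. 1 / real (m - k)) = (\<Sum>j=1..m - 1. 1 / real j)"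
      by (rule sum.reindex_bij_witness[of _ "\<lambda>j. m - j" "\<lambda>k. m - k"]) auto
    also have "4 * (\<Sum>k\<in>{1..<m}. 1 / sqrt (real k)) + 4 * sqrt (real X) * (\<Sum>j=1..m - 1. 1 / real j) \<le>
       4 * (\<Sum>k=1..X. 1 / sqrt (real k)) + 4 * sqrt (real X) * (1 + ln (real X))"
      by (intro add_mono mult_left_mono sum_mono2 hX) (auto simp: m_def)
    also have "4 * (\<Sum>k=1..X. 1 / sqrt (real k)) \<le> 8 * sqrt (real X)" using sum_inverse_sqrt_le[of X] by simp
    finally show ?thesis by simp
  qed
  finally have "norm (integral {0..x} (\<lambda>t. dsum X t * cis (\<mu> * t))) \<le>
    8 * sqrt (real X) + 4 * sqrt (real X) * (1 + ln (real X)) + 2 * Y + 2 * sqrt (real X) * (1 + ln (real X))" by simp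
  moreover define S l where "S = sqrt (real X)" and "l = ln (real X)"
  moreover have "0 \<le> S" "0 \<le> S * l" using X by (simp_all add: S_def l_def)
  hence "8 * S + 4 * S * (1 + l) + 2 * Y + 2 * S * (1 + l) \<le> 2 * Y + 20 * S * (1 + l)"
    by (simp add: algebra_simps)
  ultimately show ?thesis by simp
qed

lemma integral_inverse_norm_le:
  fixes T t :: real
  assumes T: "T \<ge> 0"
  shows "((\<lambda>t. 4 / (1 + t)) has_integral (4 * ln (1 + T))) {0..T}"
    and "t \<ge> 0 \<Longrightarrow> 1 / norm (1 / 2 - \<i> * of_real t) \<le> 4 / (1 + t)"
proof -
  have "((\<lambda>t. 4 * ln (1 + t)) has_vector_derivative 4 / (1 + t)) (at t within {0..T})" if "t \<in> {0..T}" for t :: real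
    using that by (auto intro!: derivative_eq_intros simp: has_real_derivative_iff_has_vector_derivative[symmetric])
  from fundamental_theorem_of_calculus[OF T this]
  show "((\<lambda>t. 4 / (1 + t)) has_integral (4 * ln (1 + T))) {0..T}" by simp
  assume t: "t \<ge> 0"
  have "\<bar>Re (1 / 2 - \<i> * of_real t)\<bar> \<le> norm (1 / 2 - \<i> * of_real t)" "\<bar>Im (1 / 2 - \<i> * of_real t)\<bar> \<le> norm (1 / 2 - \<i> * of_real t)"
    by (rule abs_Re_le_cmod abs_Im_le_cmod)+
  hence "(1 + t) / 4 \<le> norm (1 / 2 - \<i> * of_real t)" using t by simp
  hence "1 / norm (1 / 2 - \<i> * of_real t) \<le> 1 / ((1 + t) / 4)" using t by (intro frac_le) auto
  thus "1 / norm (1 / 2 - \<i> * of_real t) \<le> 4 / (1 + t)" by simp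
qed

lemma dsum_length_bounds:
  assumes T: "T \<ge> 3" and X: "X = nat \<lceil>T powr (3/2)\<rceil>"
  shows "X \<ge> 1" "T powr (3/2) \<le> real X" "sqrt (real X) \<le> 2 * T powr (3/4)" "1 + ln (real X) \<le> 4 * ln T" "ln T \<ge> 1"
proof -
  have p: "T powr (3/2) \<ge> 1" using T by (intro ge_one_powr_ge_zero) auto
  show X1: "T powr (3/2) \<le> real X" unfolding X by linarith
  with p show "X \<ge> 1" by linarith
  have X2: "real X \<le> 2 * T powr (3/2)" unfolding X using p by linarith
  hence "sqrt (real X) \<le> sqrt (2 * T powr (3/2))" by (rule real_sqrt_le_mono)
  also have "\<dots> \<le> sqrt (4 * T powr (3/2))" by (intro real_sqrt_le_mono mult_right_mono) auto
  also have "\<dots> = 2 * T powr (3/4)" by (simp add: real_sqrt_mult powr_half_sqrt[symmetric] powr_powr)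
  finally show "sqrt (real X) \<le> 2 * T powr (3/4)" .
  have "exp 1 \<le> T" using exp_le T by linarith
  thus l: "ln T \<ge> 1" using T by (subst ln_ge_iff) auto
  have "ln (real X) \<le> ln (2 * T powr (3/2))" using X1 X2 p by (subst ln_le_cancel_iff) auto
  also have "\<dots> = ln 2 + 3/2 * ln T" using T by (simp add: ln_mult ln_powr)
  also have "ln 2 \<le> (1::real)" using ln_le_minus_one[of "2::real"] by simp
  finally show "1 + ln (real X) \<le> 4 * ln T" using l by linarith
qed

text \<open>The length \<open>T powr (3/2)\<close> balances the two errors: \<open>sqrt X\<close>
  from the polar term and \<open>T^3 * X powr (- (3/2))\<close> from the tail both become
  \<open>T powr (3/4)\<close>, the first times a logarithm.\<close>

lemma integral_zeta_minus_dsum_le: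
  assumes T: "T \<ge> 3" and X: "X = nat \<lceil>T powr (3/2)\<rceil>"
  shows "integral {0..T} (\<lambda>t. norm (zeta (critical t) - dsum X t)) \<le> 40 * T powr (3/4) * ln T"
proof -
  note b = dsum_length_bounds[OF T X]
  define Y where "Y = T powr (3/4)"
  define e where "e = real X powr (- (1/2)) / 2 + 16 * T\<^sup>2 * real X powr (- (3/2))"
  have Y1: "Y \<ge> 1" unfolding Y_def using T by (intro ge_one_powr_ge_zero) auto
  have X0: "real X powr (1/2) = sqrt (real X)" by (simp add: powr_half_sqrt)
  have le: "norm (zeta (critical t) - dsum X t) \<le> e + sqrt (real X) * (4 / (1 + t))" if "t \<in> {0..T}" for t
  proof -
    have "sqrt (real X) / norm (1 / 2 - \<i> * of_real t) \<le> sqrt (real X) * (4 / (1 + t))"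
      using integral_inverse_norm_le(2)[of T t] that T mult_left_mono[of "1 / norm (1 / 2 - \<i> * of_real t)" "4 / (1 + t)" "sqrt (real X)"] by simp
    thus ?thesis using zeta_approx[of t T X] that T b(1) unfolding e_def X0 by simp
  qed
  have int: "((\<lambda>t. e + sqrt (real X) * (4 / (1 + t))) has_integral (e * T + sqrt (real X) * (4 * ln (1 + T)))) {0..T}"
    using T has_integral_const_real[of e 0 T]
    by (intro has_integral_add has_integral_mult_right integral_inverse_norm_le) (auto simp: mult.commute)
  have "integral {0..T} (\<lambda>t. norm (zeta (critical t) - dsum X t)) \<le> e * T + sqrt (real X) * (4 * ln (1 + T))"
    unfolding integral_unique[OF int, symmetric]
  proof (rule integral_le)
    show "(\<lambda>t. norm (zeta (critical t) - dsum X t)) integrable_on {0..T}"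
      by (intro integrable_continuous_interval continuous_intros continuous_on_zeta_critical)
    show "(\<lambda>t. e + sqrt (real X) * (4 / (1 + t))) integrable_on {0..T}" using int by (rule has_integral_integrable)
  qed (use le in auto)
  also have "e * T \<le> 17 * Y"
  proof -
    have "real X powr (- (1/2)) \<le> (T powr (3/2)) powr (- (1/2))" using b(2) T by (intro powr_mono2') auto
    also have "\<dots> = T powr (- (3/4))" by (simp add: powr_powr)
    finally have "real X powr (- (1/2)) / 2 \<le> T powr (- (3/4))"
      using powr_ge_zero[of "real X" "- (1/2)"] by linarith
    hence "real X powr (- (1/2)) / 2 * T \<le> T powr (- (3/4)) * T powr 1" using T by (intro mult_mono) auto
    also have "\<dots> = T powr (1/4)" by (simp only: powr_add[symmetric]) simp
    also have "\<dots> \<le> Y" unfolding Y_def using T by (intro powr_mono) auto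
    finally have 1: "real X powr (- (1/2)) / 2 * T \<le> Y" .
    have "real X powr (- (3/2)) \<le> (T powr (3/2)) powr (- (3/2))" using b(2) T by (intro powr_mono2') auto
    also have "\<dots> = T powr (- (9/4))" by (simp add: powr_powr)
    finally have "T\<^sup>2 * real X powr (- (3/2)) * T \<le> T\<^sup>2 * T powr (- (9/4)) * T" using T by (intro mult_right_mono mult_left_mono) auto
    also have "\<dots> = T powr 2 * T powr (- (9/4)) * T powr 1" using T by simp
    also have "\<dots> = Y" unfolding Y_def by (simp only: powr_add[symmetric]) simp
    finally show ?thesis using 1 unfolding e_def by (simp add: distrib_right)
  qed
  also have "sqrt (real X) * (4 * ln (1 + T)) \<le> (2 * Y) * (4 * (2 * ln T))"
  proof -
    have "3 * T \<le> T * T" using T by (intro mult_right_mono) auto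
    hence "1 + T \<le> T * T" using T by linarith
    hence "ln (1 + T) \<le> ln (T * T)" using T by (subst ln_le_cancel_iff) auto
    also have "\<dots> = 2 * ln T" using T by (simp add: ln_mult)
    finally show ?thesis using b(3) T unfolding Y_def by (intro mult_mono) auto
  qed
  finally have "integral {0..T} (\<lambda>t. norm (zeta (critical t) - dsum X t)) \<le> 17 * Y + 16 * Y * ln T" by simp
  also have "17 * Y \<le> 17 * Y * ln T" using Y1 b(5) by simp
  finally have "integral {0..T} (\<lambda>t. norm (zeta (critical t) - dsum X t)) \<le> 33 * (Y * ln T)" by simp
  also have "\<dots> \<le> 40 * (Y * ln T)" using Y1 b(5) by (intro mult_right_mono) auto
  finally show ?thesis by (simp add: Y_def)
qed

text \<open>The positivity of the Fejer kernel requires integration from 0, while the maximum is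
  sought only from \<open>T powr (3/4)\<close> on. This bounds the stretch in between.\<close>

lemma dsum_short_integral_le:
  assumes T: "T \<ge> 3" and X: "X = nat \<lceil>T powr (3/2)\<rceil>" and x: "x \<in> {0..T powr (3/4)}"
  shows "norm (integral {0..x} (\<lambda>t. dsum X t * cis (\<mu> * t))) \<le> 200 * T powr (3/4) * ln T"
proof -
  note b = dsum_length_bounds[OF T X]
  define Y where "Y = T powr (3/4)"
  have Y1: "Y \<ge> 1" unfolding Y_def using T by (intro ge_one_powr_ge_zero) auto
  have "norm (integral {0..x} (\<lambda>t. dsum X t * cis (\<mu> * t))) \<le> 2 * Y + 20 * sqrt (real X) * (1 + ln (real X))"
    using x b(1) by (intro dsum_integral_le) (auto simp: Y_def)
  also have "20 * sqrt (real X) * (1 + ln (real X)) \<le> 20 * (2 * Y) * (4 * ln T)"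
    using b unfolding Y_def by (intro mult_mono) auto
  also have "2 * Y + 20 * (2 * Y) * (4 * ln T) \<le> 200 * Y * ln T"
    using Y1 b(5) mult_left_mono[of 1 "ln T" Y] by simp
  finally show ?thesis by (simp add: Y_def)
qed

text \<open>Since \<open>hardy_Z\<close> is real, conjugation reverses the sign of
  \<open>\<mu>\<close>. It suffices to treat the sign for which the stationary points stay below a
  multiple of \<open>sqrt T\<close>.\<close>

lemma hardy_Z_integral_le:
  assumes T: "T \<ge> 3" and x: "x \<in> {T powr (3/4)..T}"
  shows "norm (integral {T powr (3/4)..x} (\<lambda>t. of_real (hardy_Z t) * cis (\<mu> * t))) \<le> 2000 * T powr (3/4) * ln T"
proof -
  define Y where "Y = T powr (3/4)"
  have Y1: "Y \<ge> 1" unfolding Y_def using T by (intro ge_one_powr_ge_zero) auto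
  define X where "X = nat \<lceil>T powr (3/2)\<rceil>"
  note b = dsum_length_bounds[OF T X_def]
  have xY: "1 \<le> Y" "Y \<le> x" "x \<le> T" using x Y1 by (auto simp: Y_def)
  have neg: "norm (integral {Y..x} (\<lambda>t. of_real (hardy_Z t) * cis (- \<nu> * t))) \<le> 2000 * (Y * ln T)" if \<nu>: "\<nu> \<ge> 0" for \<nu>
  proof -
    define G where "G = (\<lambda>t. cis (RS_theta t) * cis (- \<nu> * t))"
    have cG: "continuous_on A G" for A
      unfolding G_def by (intro continuous_intros continuous_on_subset[OF continuous_RS_theta]) auto
    have nG: "norm (G t) = 1" for t by (simp add: G_def norm_mult)
    have ctg: "continuous_on A (\<lambda>t. dsum X t * G t)" "continuous_on A (\<lambda>t. (zeta (critical t) - dsum X t) * G t)" for A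
      by (intro continuous_intros cG continuous_on_zeta_critical)+
    have "of_real (hardy_Z t) * cis (- \<nu> * t) = dsum X t * G t + (zeta (critical t) - dsum X t) * G t" for t
      by (simp add: hardy_Z_eq G_def algebra_simps)
    hence "integral {Y..x} (\<lambda>t. of_real (hardy_Z t) * cis (- \<nu> * t)) =
      integral {Y..x} (\<lambda>t. dsum X t * G t) + integral {Y..x} (\<lambda>t. (zeta (critical t) - dsum X t) * G t)"
      by (simp only:) (intro integral_add integrable_continuous_interval ctg)
    also have "norm \<dots> \<le> norm (integral {Y..x} (\<lambda>t. dsum X t * G t)) + norm (integral {Y..x} (\<lambda>t. (zeta (critical t) - dsum X t) * G t))"
      by (rule norm_triangle_ineq)
    also have "norm (integral {Y..x} (\<lambda>t. dsum X t * G t)) \<le> 1920 * Y + 6 * (2 * Y)"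
      using dsum_theta_integral_le[OF xY \<nu>, of X] b(3) unfolding G_def Y_def by linarith
    also have "norm (integral {Y..x} (\<lambda>t. (zeta (critical t) - dsum X t) * G t)) \<le> integral {Y..x} (\<lambda>t. norm (zeta (critical t) - dsum X t))"
      by (rule integral_norm_bound_integral)
         (auto intro!: integrable_continuous_interval continuous_intros cG continuous_on_zeta_critical simp: norm_mult nG)
    also have "\<dots> \<le> integral {0..T} (\<lambda>t. norm (zeta (critical t) - dsum X t))"
      using xY by (intro integral_subset_le integrable_continuous_interval continuous_intros continuous_on_zeta_critical) auto
    also have "\<dots> \<le> 40 * Y * ln T" using integral_zeta_minus_dsum_le[OF T X_def] by (simp add: Y_def)
    finally have "norm (integral {Y..x} (\<lambda>t. of_real (hardy_Z t) * cis (- \<nu> * t))) \<le> 1932 * Y + 40 * (Y * ln T)" by simp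
    moreover have "Y \<le> Y * ln T" using Y1 b(5) by simp
    moreover have "Y * ln T \<ge> 0" using Y1 b(5) by simp
    ultimately show ?thesis by linarith
  qed
  show ?thesis
  proof (cases "\<mu> \<le> 0")
    case True
    thus ?thesis using neg[of "- \<mu>"] by (simp add: Y_def)
  next
    case False
    have "integral {Y..x} (\<lambda>t. of_real (hardy_Z t) * cis (\<mu> * t)) = integral {Y..x} (\<lambda>t. cnj (of_real (hardy_Z t) * cis (- \<mu> * t)))"
      by (simp add: cis_cnj)
    also have "\<dots> = cnj (integral {Y..x} (\<lambda>t. of_real (hardy_Z t) * cis (- \<mu> * t)))"
      by (rule integral_cnj[symmetric])
    finally show ?thesis using neg[of "\<mu>"] False by (simp add: Y_def)
  qed
qed

section \<open>Primes in windows\<close>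

text \<open>\<open>l\<close>, \<open>A\<close>, \<open>D\<close> are the iterated logarithms of
  \<open>T\<close>, \<open>B\<close> is the logarithmic width of a window and \<open>\<tau>\<close>
  the slack. \<open>\<beta>a\<close> keeps the square mass of a window below its cap.
  \<open>e1\<close> confines the logarithms of the primes, \<open>e2\<close> makes single weights
  small, \<open>e3\<close> makes the linear mass small against the cap, \<open>e4\<close> and
  \<open>e5\<close> control the two truncations, and \<open>e6\<close> bounds the number of
  terms.\<close>

locale prime_windows =
  fixes T B C \<tau> \<beta> a \<gamma> \<kappa> l A D :: real and K :: nat
  assumes BC: "C \<ge> 1" "B > C" and \<tau>: "0 < \<tau>" "\<tau> \<le> 1 / 2" and \<beta>: "\<beta> > 0" and a: "a > 0" and \<gamma>: "0 < \<gamma>" "\<gamma> < 1"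
    and l: "l = ln T" "l \<ge> 1" and A: "A = ln l" "A \<ge> 1" and D: "D = ln A" "D \<ge> 1" and T: "T \<ge> 1"
    and K: "K = nat \<lfloor>A powr \<gamma>\<rfloor>"
    and mertens: "\<And>x y. 1 \<le> x \<Longrightarrow> x \<le> y \<Longrightarrow>
       \<bar>(\<Sum>p | prime p \<and> x < real p \<and> real p \<le> y. ln (real p) / real p) - ln (y / x)\<bar> \<le> C"
    and \<beta>a: "\<beta>\<^sup>2 * (B + C) \<le> a * (1 - \<tau>)\<^sup>2"
    and e1: "A + D + B * (A powr \<gamma> + 1) \<le> (1 + \<tau>) * A"
    and e2: "\<beta>\<^sup>2 / D \<le> \<tau> / 2" "\<beta> / sqrt (l * A) \<le> \<tau> / 2"
    and e3: "\<beta> * (B + C) * A \<le> a * \<tau> * sqrt (l * A / D)"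
    and e4: "A * exp (- (a * \<tau>\<^sup>2 / 16) * l / (D * A\<^sup>2)) \<le> 1 / 4"
    and e5: "exp (- (1 / A) * (3 / 2 * l) + exp 2 * \<beta> * (B + C) * sqrt (l / (A * D)) * (1 + D)) \<le> 1 / 4"
    and e6: "a / D * ((B + 1) * (1 + \<gamma> * D) + 2 * (B + 1 + ln D)) + 4 * (B + C) / D \<le> \<kappa>"
begin

definition w :: "nat \<Rightarrow> real" where "w k = exp (B * real k) * (l * A)"
text \<open>Windows are open below and closed above, hence a ceiling minus one.\<close>

definition cl :: "nat \<Rightarrow> nat" where "cl p = nat (\<lceil>ln (real p / (l * A)) / B\<rceil> - 1)"
definition P :: "nat set" where "P = {p. prime p \<and> w 1 < real p \<and> real p \<le> w (Suc K)}"
text \<open>A step version of a coefficient proportional to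
  \<open>1 / (sqrt p * ln (p / (l * A)))\<close>, whose logarithm is about \<open>B * k\<close> on
  window \<open>k\<close>. The squares of \<open>f\<close> then have mass of order
  \<open>1 / k^2\<close> on the window, which the cap \<open>\<alpha>\<close> follows, and
  \<open>f p / sqrt p\<close> has mass of order \<open>1 / k\<close>.\<close>

definition f :: "nat \<Rightarrow> real" where "f p = \<beta> * sqrt (l * A / D) / (real (cl p) * sqrt (real p))"
definition \<alpha> :: "nat \<Rightarrow> real" where "\<alpha> k = a * l / ((real k)\<^sup>2 * D)"
definition win :: "nat \<Rightarrow> nat set" where "win k = {p. prime p \<and> w k < real p \<and> real p \<le> w (Suc k)}"

lemma pos: "l > 0" "A > 0" "D > 0" "B > 0" "l * A > 0" "C > 0"
proof -
  show "l > 0" "A > 0" "D > 0" "B > 0" "C > 0" using l(2) A(2) D(2) BC by linarith+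
  thus "l * A > 0" by simp
qed

lemma w_mono: "i \<le> j \<Longrightarrow> w i \<le> w j"
  using pos by (auto simp: w_def)

lemma w_ge: "w k \<ge> l * A"
proof -
  have "1 * (l * A) \<le> exp (B * real k) * (l * A)" using pos by (intro mult_right_mono) auto
  thus ?thesis by (simp add: w_def)
qed

lemma lA_ge_1: "l * A \<ge> 1" using mult_mono[of 1 l 1 A] l A by simp

lemma finite_P: "finite P"
  by (rule finite_subset[of _ "{..nat \<lfloor>w (Suc K)\<rfloor>}"]) (auto simp: P_def le_nat_floor)

lemma prime_P: "p \<in> P \<Longrightarrow> prime p" by (simp add: P_def)

lemma cl_eq:
  assumes "w k < real p" "real p \<le> w (Suc k)"
  shows "cl p = k"
proof -
  have p: "real p > 0" using assms(1) w_ge[of k] pos by linarith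
  have "exp (B * real k) < real p / (l * A)" using assms(1) pos by (simp add: w_def field_simps)
  hence "ln (exp (B * real k)) < ln (real p / (l * A))" using p pos by (subst ln_less_cancel_iff) auto
  hence 1: "real k < ln (real p / (l * A)) / B" using pos by (simp add: field_simps)
  have "real p / (l * A) \<le> exp (B * real (Suc k))" using assms(2) pos by (simp add: w_def field_simps del: of_nat_Suc)
  hence "ln (real p / (l * A)) \<le> ln (exp (B * real (Suc k)))" using p pos by (subst ln_le_cancel_iff) auto
  hence 2: "ln (real p / (l * A)) / B \<le> real k + 1" using pos by (simp add: field_simps)
  have "\<lceil>ln (real p / (l * A)) / B\<rceil> = int k + 1" using 1 2 by (intro ceiling_unique) auto
  thus ?thesis by (simp add: cl_def)
qed

lemma P_in_win:
  assumes "p \<in> P" shows "cl p \<in> {1..K}" "p \<in> win (cl p)"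
proof -
  define k where "k = (LEAST k. real p \<le> w (Suc k))"
  have ex: "real p \<le> w (Suc K)" using assms by (simp add: P_def)
  have 1: "real p \<le> w (Suc k)" unfolding k_def using ex by (rule LeastI)
  have 2: "k \<le> K" unfolding k_def using ex by (rule Least_le)
  have "k \<noteq> 0" using 1 assms by (intro notI) (auto simp: P_def)
  moreover have "\<not> real p \<le> w (Suc (k - 1))" using not_less_Least[of "k - 1" "\<lambda>k. real p \<le> w (Suc k)"] \<open>k \<noteq> 0\<close> by (simp add: k_def)
  ultimately have 3: "w k < real p" by simp
  have "cl p = k" by (rule cl_eq[OF 3 1])
  thus "cl p \<in> {1..K}" "p \<in> win (cl p)" using 1 2 3 \<open>k \<noteq> 0\<close> assms by (auto simp: win_def P_def)
qed

lemma win_eq: "k \<in> {1..K} \<Longrightarrow> {p\<in>P. cl p = k} = win k"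
proof -
  assume k: "k \<in> {1..K}"
  have "w 1 \<le> w k" "w (Suc k) \<le> w (Suc K)" using k by (auto intro!: w_mono)
  thus ?thesis using P_in_win(2) cl_eq by (auto simp: win_def P_def)
qed

lemma sum_P: "(\<Sum>p\<in>P. h p) = (\<Sum>k=1..K. \<Sum>p\<in>win k. h p)" for h :: "nat \<Rightarrow> real"
proof -
  have "(\<Sum>p\<in>P. h p) = (\<Sum>k=1..K. \<Sum>p\<in>{p\<in>P. cl p = k}. h p)"
    using P_in_win(1) by (intro sum.group[symmetric] finite_P) auto
  thus ?thesis using win_eq by simp
qed

lemma K_le: "real K \<le> A powr \<gamma>" "A powr \<gamma> \<le> real K + 1" "real K \<le> A"
proof -
  show "real K \<le> A powr \<gamma>" unfolding K by (simp add: floor_less_iff)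
  moreover have "A powr \<gamma> \<le> A powr 1" using A \<gamma> by (intro powr_mono) auto
  ultimately show "real K \<le> A" using A by simp
  show "A powr \<gamma> \<le> real K + 1" unfolding K by linarith
qed

lemma win_prime:
  assumes p: "p \<in> win k"
  shows "real p \<ge> l * A" "real p > 0" "ln (real p) \<ge> A" "k \<in> {1..K} \<Longrightarrow> ln (real p) \<le> (1 + \<tau>) * A" "prime p" "cl p = k"
proof -
  show p1: "real p \<ge> l * A" using p w_ge[of k] by (simp add: win_def)
  show p0: "real p > 0" using p1 pos by linarith
  have "A = ln l" by (rule A)
  also have "l \<le> real p" using p1 mult_left_mono[OF A(2), of l] pos by linarith
  hence "ln l \<le> ln (real p)" using p0 pos by (subst ln_le_cancel_iff) auto
  finally show "ln (real p) \<ge> A" .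
  show "prime p" using p by (simp add: win_def)
  show "cl p = k" using p by (intro cl_eq) (auto simp: win_def)
  assume k: "k \<in> {1..K}"
  have "ln (real p) \<le> ln (w (Suc k))" using p p0 by (subst ln_le_cancel_iff) (auto simp: win_def)
  also have "\<dots> = B * (real k + 1) + (ln l + ln A)" using pos by (simp add: w_def ln_mult)
  also have "\<dots> = A + D + B * (real k + 1)" using A D by simp
  also have "\<dots> \<le> A + D + B * (A powr \<gamma> + 1)" using k K_le pos by (intro add_left_mono mult_left_mono) auto
  also have "\<dots> \<le> (1 + \<tau>) * A" by (rule e1)
  finally show "ln (real p) \<le> (1 + \<tau>) * A" .
qed

lemma win_mertens:
  "B - C \<le> (\<Sum>p\<in>win k. ln (real p) / real p)" "(\<Sum>p\<in>win k. ln (real p) / real p) \<le> B + C"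
proof -
  have "w (Suc k) / w k = exp B" using pos by (simp add: w_def distrib_left exp_add)
  hence "ln (w (Suc k) / w k) = B" by simp
  moreover have "1 \<le> w k" using w_ge[of k] lA_ge_1 by linarith
  ultimately have "\<bar>(\<Sum>p\<in>win k. ln (real p) / real p) - B\<bar> \<le> C"
    using mertens[of "w k" "w (Suc k)"] w_mono[of k "Suc k"] by (simp add: win_def)
  thus "B - C \<le> (\<Sum>p\<in>win k. ln (real p) / real p)" "(\<Sum>p\<in>win k. ln (real p) / real p) \<le> B + C" by linarith+
qed

lemma win_sum_inverse:
  shows "(\<Sum>p\<in>win k. 1 / real p) \<le> (B + C) / A"
    and "k \<in> {1..K} \<Longrightarrow> (B - C) / ((1 + \<tau>) * A) \<le> (\<Sum>p\<in>win k. 1 / real p)"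
proof -
  have "A * (\<Sum>p\<in>win k. 1 / real p) = (\<Sum>p\<in>win k. A / real p)" by (simp add: sum_distrib_left)
  also have "\<dots> \<le> (\<Sum>p\<in>win k. ln (real p) / real p)"
    by (intro sum_mono divide_right_mono win_prime) (auto dest: win_prime(2))
  also have "\<dots> \<le> B + C" by (rule win_mertens)
  finally show "(\<Sum>p\<in>win k. 1 / real p) \<le> (B + C) / A" using pos by (simp add: field_simps)
  assume k: "k \<in> {1..K}"
  have "B - C \<le> (\<Sum>p\<in>win k. ln (real p) / real p)" by (rule win_mertens)
  also have "\<dots> \<le> (\<Sum>p\<in>win k. (1 + \<tau>) * A / real p)"
    by (intro sum_mono divide_right_mono win_prime(4)[OF _ k]) auto
  also have "\<dots> = ((1 + \<tau>) * A) * (\<Sum>p\<in>win k. 1 / real p)" by (simp add: sum_distrib_left)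
  finally show "(B - C) / ((1 + \<tau>) * A) \<le> (\<Sum>p\<in>win k. 1 / real p)"
    using pos \<tau> by (subst pos_divide_le_eq) (auto simp: mult_ac)
qed

text \<open>Each prime of the window contributes at least \<open>A / w (Suc k)\<close> to a sum that
  Mertens bounds by \<open>B + C\<close>.\<close>

lemma card_win_le: "real (card (win k)) \<le> (B + C) * exp (B * real (Suc k)) * l"
proof -
  have "real (card (win k)) * (1 / (exp (B * real (Suc k)) * l)) = (\<Sum>p\<in>win k. A / w (Suc k))"
    using pos by (simp add: w_def del: of_nat_Suc)
  also have "\<dots> \<le> (\<Sum>p\<in>win k. ln (real p) / real p)"
  proof (intro sum_mono frac_le)
    fix p assume p: "p \<in> win k"
    show "A \<le> ln (real p)" "0 < real p" using win_prime[OF p] by auto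
    thus "0 \<le> ln (real p)" using pos by linarith
    show "real p \<le> w (Suc k)" using p by (simp add: win_def)
  qed
  also have "\<dots> \<le> B + C" by (rule win_mertens)
  finally show ?thesis using pos by (simp add: field_simps del: of_nat_Suc)
qed

definition x :: "nat \<Rightarrow> real" where "x p = (f p)\<^sup>2"
definition y :: "nat \<Rightarrow> real" where "y p = f p / sqrt (real p)"

lemma f_nonneg: "f p \<ge> 0" unfolding f_def using \<beta> pos by (intro divide_nonneg_nonneg mult_nonneg_nonneg) auto

lemma win_xy:
  assumes "p \<in> win k"
  shows "x p = \<beta>\<^sup>2 * (l * A / D) / (real k)\<^sup>2 * (1 / real p)" "y p = \<beta> * sqrt (l * A / D) / real k * (1 / real p)"
proof -
  have "(sqrt (l * A / D))\<^sup>2 = l * A / D" using pos by simp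
  moreover have "(sqrt (real p))\<^sup>2 = real p" by simp
  ultimately show "x p = \<beta>\<^sup>2 * (l * A / D) / (real k)\<^sup>2 * (1 / real p)"
    unfolding x_def f_def win_prime(6)[OF assms] power_divide power_mult_distrib by simp
  have "sqrt (real p) * sqrt (real p) = real p" by simp
  thus "y p = \<beta> * sqrt (l * A / D) / real k * (1 / real p)"
    unfolding y_def f_def win_prime(6)[OF assms] by (simp add: divide_divide_eq_left mult.assoc)
qed

lemma xy_le:
  assumes p: "p \<in> win k" "k \<in> {1..K}"
  shows "x p + y p \<le> \<tau>"
proof -
  have k: "real k \<ge> 1" using p by auto
  have ip: "1 / real p \<le> 1 / (l * A)" using win_prime(1)[OF p(1)] pos by (intro frac_le) auto
  have k2: "(real k)\<^sup>2 \<ge> 1" using k by (rule one_le_power)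
  have "\<beta>\<^sup>2 * (l * A / D) / (real k)\<^sup>2 \<le> \<beta>\<^sup>2 * (l * A / D) / 1" using k2 pos by (intro frac_le) auto
  hence "x p \<le> \<beta>\<^sup>2 * (l * A / D) / 1 * (1 / (l * A))"
    unfolding win_xy[OF p(1)] using pos ip by (intro mult_mono) auto
  also have "\<dots> = \<beta>\<^sup>2 / D" using pos by simp
  finally have 1: "x p \<le> \<tau> / 2" using e2 by linarith
  have "l * A / D \<le> l * A / 1" using pos D by (intro divide_left_mono) auto
  hence "\<beta> * sqrt (l * A / D) \<le> \<beta> * sqrt (l * A)" using \<beta> by (intro mult_left_mono real_sqrt_le_mono) auto
  hence "\<beta> * sqrt (l * A / D) / real k \<le> \<beta> * sqrt (l * A) / 1" using k \<beta> pos by (intro frac_le) auto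
  hence "y p \<le> \<beta> * sqrt (l * A) / 1 * (1 / (l * A))"
    unfolding win_xy[OF p(1)] using pos ip \<beta> by (intro mult_mono) auto
  also have "\<dots> = \<beta> / sqrt (l * A)"
  proof -
    have "sqrt (l * A) * sqrt (l * A) = l * A" using pos by simp
    thus ?thesis using pos by (simp add: field_simps)
  qed
  finally show ?thesis using 1 e2 by linarith
qed

lemma sum_win_x: "(\<Sum>p\<in>win k. x p) \<le> \<beta>\<^sup>2 * (B + C) * (l / ((real k)\<^sup>2 * D))"
proof -
  have "(\<Sum>p\<in>win k. x p) = \<beta>\<^sup>2 * (l * A / D) / (real k)\<^sup>2 * (\<Sum>p\<in>win k. 1 / real p)"
    by (simp add: win_xy sum_distrib_left)
  also have "\<dots> \<le> \<beta>\<^sup>2 * (l * A / D) / (real k)\<^sup>2 * ((B + C) / A)"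
    using pos by (intro mult_left_mono win_sum_inverse) auto
  also have "\<dots> = \<beta>\<^sup>2 * (B + C) * ((l * A / D * (1 / A)) / (real k)\<^sup>2)"
    by (simp only: divide_inverse mult_ac mult_1_left)
  also have "l * A / D * (1 / A) = l / D" using pos by simp
  also have "l / D / (real k)\<^sup>2 = l / ((real k)\<^sup>2 * D)" by (simp add: mult.commute)
  finally show ?thesis .
qed

lemma sqrt_lAD: "sqrt (l * A / D) / A = sqrt (l / (A * D))" "sqrt (l * A / D) * (D / A) = sqrt (l * D / A)"
proof -
  have "sqrt (l * A / D) / A = sqrt (l * A / D) / sqrt (A\<^sup>2)" using pos by simp
  also have "\<dots> = sqrt (l * A / D / A\<^sup>2)" by (rule real_sqrt_divide[symmetric])
  also have "l * A / D / A\<^sup>2 = l / (A * D)" using pos by (simp add: power2_eq_square)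
  finally show 1: "sqrt (l * A / D) / A = sqrt (l / (A * D))" .
  have "sqrt (l * A / D) * (D / A) = (sqrt (l * A / D) / A) * D" by simp
  also have "\<dots> = sqrt (l / (A * D)) * sqrt (D\<^sup>2)" unfolding 1 using pos by simp
  also have "\<dots> = sqrt (l / (A * D) * D\<^sup>2)" by (rule real_sqrt_mult[symmetric])
  also have "l / (A * D) * D\<^sup>2 = l * D / A" using pos by (simp add: power2_eq_square)
  finally show "sqrt (l * A / D) * (D / A) = sqrt (l * D / A)" .
qed

lemma sum_win_y: "(\<Sum>p\<in>win k. y p) \<le> \<beta> * (B + C) * sqrt (l / (A * D)) * (1 / real k)"
proof -
  have "(\<Sum>p\<in>win k. y p) = \<beta> * sqrt (l * A / D) / real k * (\<Sum>p\<in>win k. 1 / real p)"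
    by (simp add: win_xy sum_distrib_left)
  also have "\<dots> \<le> \<beta> * sqrt (l * A / D) / real k * ((B + C) / A)"
    using pos \<beta> by (intro mult_left_mono win_sum_inverse) auto
  also have "\<dots> = \<beta> * (B + C) * (sqrt (l * A / D) / A) * (1 / real k)" by (simp only: divide_inverse mult_ac mult_1_left)
  finally show ?thesis unfolding sqrt_lAD .
qed

text \<open>The squares use at most \<open>(1 - \<tau>)^2\<close> of the cap and the linear weights
  at most \<open>\<tau>\<close> of it. The remaining fraction of at least \<open>\<tau> / 2\<close>
  is the room needed by Rankin's trick.\<close>

lemma sum_win_xy:
  assumes k: "k \<in> {1..K}"
  shows "(\<Sum>p\<in>win k. x p + y p) \<le> \<alpha> k * (1 - \<tau> / 2)"
proof -
  define s where "s = sqrt (l * A / D)"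
  have s: "s > 0" "s * s = l * A / D" using pos by (auto simp: s_def)
  have k1: "real k \<ge> 1" "real k \<le> A" using k K_le by auto
  have q: "l / ((real k)\<^sup>2 * D) = s * s / (A * (real k)\<^sup>2)" unfolding s(2) using pos by simp
  have "(\<Sum>p\<in>win k. x p) \<le> a * (1 - \<tau>)\<^sup>2 * (l / ((real k)\<^sup>2 * D))"
    using sum_win_x[of k] mult_right_mono[OF \<beta>a, of "l / ((real k)\<^sup>2 * D)"] pos by fastforce
  also have "\<dots> = \<alpha> k * (1 - \<tau>)\<^sup>2" by (simp add: \<alpha>_def)
  finally have 1: "(\<Sum>p\<in>win k. x p) \<le> \<alpha> k * (1 - \<tau>)\<^sup>2" .
  have "\<beta> * (B + C) * real k \<le> \<beta> * (B + C) * A" using k1 \<beta> pos by (intro mult_left_mono) auto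
  also have "\<dots> \<le> a * \<tau> * s" using e3 by (simp add: s_def)
  finally have "\<beta> * (B + C) * real k * (s / (A * (real k)\<^sup>2)) \<le> a * \<tau> * s * (s / (A * (real k)\<^sup>2))"
    using s pos by (intro mult_right_mono) auto
  also have "\<dots> = a * \<tau> * (s * s / (A * (real k)\<^sup>2))" by simp
  also have "\<dots> = a * \<tau> * (l / ((real k)\<^sup>2 * D))" by (simp only: q)
  also have "\<dots> = \<alpha> k * \<tau>" by (simp add: \<alpha>_def)
  also have "\<beta> * (B + C) * real k * (s / (A * (real k)\<^sup>2)) = \<beta> * (B + C) * (s / A) * (1 / real k)"
    using k1 pos by (simp add: power2_eq_square)
  finally have 2: "(\<Sum>p\<in>win k. y p) \<le> \<alpha> k * \<tau>"
    using sum_win_y[of k] sqrt_lAD(1) by (simp add: s_def)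
  have \<alpha>0: "\<alpha> k \<ge> 0" using a pos by (simp add: \<alpha>_def)
  have "(\<Sum>p\<in>win k. x p + y p) \<le> \<alpha> k * ((1 - \<tau>)\<^sup>2 + \<tau>)" using 1 2 by (simp add: sum.distrib distrib_left)
  also have "\<dots> \<le> \<alpha> k * (1 - \<tau> / 2)"
  proof (intro mult_left_mono \<alpha>0)
    have "\<tau> * \<tau> \<le> \<tau> * (1 / 2)" using \<tau> by (intro mult_left_mono) auto
    thus "(1 - \<tau>)\<^sup>2 + \<tau> \<le> 1 - \<tau> / 2" by (simp add: power2_eq_square algebra_simps)
  qed
  finally show ?thesis .
qed

lemma sum_inverse_bounds:
  "(\<Sum>k=1..K. 1 / real k) \<le> 1 + \<gamma> * D" "\<gamma> * D \<le> (\<Sum>k=1..K. 1 / real k)"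
  "(\<Sum>k=1..K. 1 / (real k)\<^sup>2) \<le> 2"
proof -
  have g: "ln (A powr \<gamma>) = \<gamma> * D" using pos D by (simp add: ln_powr)
  show "(\<Sum>k=1..K. 1 / real k) \<le> 1 + \<gamma> * D"
  proof (cases "K = 0")
    case False
    hence "(\<Sum>k=1..K. 1 / real k) \<le> 1 + ln (real K)" by (intro harm_bound) auto
    also have "ln (real K) \<le> ln (A powr \<gamma>)" using False K_le pos by (subst ln_le_cancel_iff) auto
    finally show ?thesis unfolding g by simp
  qed (use \<gamma> pos in auto)
  have h: "ln (real n + 1) \<le> (\<Sum>k=1..n. 1 / real k)" for n
  proof (induction n)
    case (Suc n)
    have "ln (real (Suc n) + 1) - ln (real n + 1) = ln (1 + 1 / real (Suc n))"
    proof -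
      have "1 + 1 / real (Suc n) = (real (Suc n) + 1) / (real n + 1)" by (simp add: field_simps)
      thus ?thesis by (simp only:) (simp add: ln_div del: of_nat_Suc)
    qed
    also have "\<dots> \<le> 1 / real (Suc n)" by (intro ln_add_one_self_le_self) simp
    finally show ?case using Suc.IH by simp
  qed simp
  have "\<gamma> * D \<le> ln (real K + 1)" unfolding g[symmetric] using K_le pos by (subst ln_le_cancel_iff) auto
  thus "\<gamma> * D \<le> (\<Sum>k=1..K. 1 / real k)" using h[of K] by linarith
  have "(\<Sum>k=1..Suc n. 1 / (real k)\<^sup>2) \<le> 2 - 1 / real (Suc n)" for n
  proof (induction n)
    case (Suc n)
    define m where "m = real (Suc n)"
    have m: "m > 0" "real (Suc (Suc n)) = m + 1" by (simp_all add: m_def)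
    have "1 / (m + 1)\<^sup>2 \<le> 1 / (m * (m + 1))" using m by (intro divide_left_mono) (auto simp: power2_eq_square)
    also have "\<dots> = 1 / m - 1 / (m + 1)" using m by (simp add: field_simps)
    finally show ?case using Suc.IH unfolding m(2) m_def[symmetric] by (simp add: m(2) del: of_nat_Suc)
  qed simp
  from this[of "K - 1"] show "(\<Sum>k=1..K. 1 / (real k)\<^sup>2) \<le> 2"
    by (cases K) (auto intro: order_trans simp del: sum.cl_ivl_Suc)
qed

text \<open>With \<open>u = \<tau> / 4\<close> and inflation \<open>1 + u\<close>, the bound
  \<open>u * (1 - u)\<close> for \<open>ln (1 + u)\<close> meets a mass of at most
  \<open>(1 - 2 * u) * \<alpha> k\<close>, which leaves the exponent
  \<open>- u^2 * \<alpha> k\<close>. The smallest cap that can occur is of order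
  \<open>l / (D * A^2)\<close>.\<close>

lemma overfull_small:
  "(\<Sum>k=1..K. exp (- \<alpha> k * ln (1 + \<tau> / 4) + ((1 + \<tau> / 4) - 1) * (\<Sum>p\<in>{p\<in>P. cl p = k}. x p + y p))) \<le> 1 / 4"
proof -
  have "exp (- \<alpha> k * ln (1 + \<tau> / 4) + ((1 + \<tau> / 4) - 1) * (\<Sum>p\<in>{p\<in>P. cl p = k}. x p + y p)) \<le>
    exp (- (a * \<tau>\<^sup>2 / 16) * l / (D * A\<^sup>2))" if k: "k \<in> {1..K}" for k
  proof -
    define u where "u = \<tau> / 4"
    have u: "0 < u" "\<tau> = 4 * u" using \<tau> by (auto simp: u_def)
    have \<alpha>0: "\<alpha> k \<ge> 0" using a pos by (simp add: \<alpha>_def)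
    have "1 - u \<le> 1 / (1 + u)" using u by (simp add: field_simps)
    hence "u * (1 - u) \<le> u * (1 / (1 + u))" using u by (intro mult_left_mono) auto
    also have "\<dots> = 1 - 1 / (1 + u)" using u by (simp add: field_simps)
    also have "\<dots> \<le> ln (1 + u)" using ln_le_minus_one[of "1 / (1 + u)"] u by (simp add: ln_div)
    finally have ln: "u * (1 - u) \<le> ln (1 + u)" .
    have "- \<alpha> k * ln (1 + u) + u * (\<Sum>p\<in>win k. x p + y p) \<le> - \<alpha> k * (u * (1 - u)) + u * (\<alpha> k * (1 - \<tau> / 2))"
      using mult_left_mono[OF ln \<alpha>0] mult_left_mono[OF sum_win_xy[OF k] less_imp_le[OF u(1)]]
      unfolding mult_minus_left by linarith
    also have "\<dots> = - (u * u) * \<alpha> k" unfolding u(2) by (simp add: algebra_simps)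
    also have "\<dots> \<le> - (u * u) * (a * l / (A\<^sup>2 * D))"
    proof -
      have "(real k)\<^sup>2 \<le> A\<^sup>2" using k K_le by (intro power_mono) auto
      hence "a * l / (A\<^sup>2 * D) \<le> \<alpha> k" unfolding \<alpha>_def using k a pos by (intro divide_left_mono mult_right_mono) auto
      thus ?thesis by (intro mult_left_mono_neg) auto
    qed
    also have "\<dots> = - (a * \<tau>\<^sup>2 / 16) * l / (D * A\<^sup>2)" unfolding u(2) by (simp add: power2_eq_square mult_ac)
    finally show ?thesis unfolding win_eq[OF k] u_def by simp
  qed
  hence "(\<Sum>k=1..K. exp (- \<alpha> k * ln (1 + \<tau> / 4) + ((1 + \<tau> / 4) - 1) * (\<Sum>p\<in>{p\<in>P. cl p = k}. x p + y p))) \<le>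
     (\<Sum>k=1..K. exp (- (a * \<tau>\<^sup>2 / 16) * l / (D * A\<^sup>2)))" by (intro sum_mono)
  also have "\<dots> = real K * exp (- (a * \<tau>\<^sup>2 / 16) * l / (D * A\<^sup>2))" by simp
  also have "\<dots> \<le> A * exp (- (a * \<tau>\<^sup>2 / 16) * l / (D * A\<^sup>2))" using K_le by (intro mult_right_mono) auto
  finally show ?thesis using e4 by linarith
qed

text \<open>With exponent \<open>1 / A\<close> every \<open>p\<close> in \<open>P\<close> has
  \<open>p powr (1 / A) \<le> exp 2\<close>, so the mass stays of order
  \<open>sqrt (l * D / A)\<close>, far below the \<open>3 / 2 * l / A\<close> gained from the
  threshold.\<close>

lemma large_small:
  "exp (- (1 / A) * ln (T powr (3 / 2)) + (\<Sum>p\<in>P. real p powr (1 / A) * y p)) \<le> 1 / 4"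
proof -
  have y0: "y p \<ge> 0" for p using f_nonneg by (simp add: y_def)
  have "(\<Sum>p\<in>P. real p powr (1 / A) * y p) \<le> (\<Sum>k=1..K. \<Sum>p\<in>win k. exp 2 * y p)"
    unfolding sum_P
  proof (intro sum_mono mult_right_mono y0)
    fix k p assume k: "k \<in> {1..K}" and p: "p \<in> win k"
    have "real p powr (1 / A) = exp (ln (real p) / A)" using win_prime(2)[OF p] by (simp add: powr_def)
    also have "ln (real p) / A \<le> 2"
    proof -
      have "ln (real p) \<le> (1 + \<tau>) * A" by (rule win_prime(4)[OF p k])
      also have "\<dots> \<le> 2 * A" using \<tau> pos by (intro mult_right_mono) auto
      finally show ?thesis using pos by (simp add: pos_divide_le_eq)
    qed
    hence "exp (ln (real p) / A) \<le> exp 2" by simp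
    finally show "real p powr (1 / A) \<le> exp 2" .
  qed
  also have "\<dots> = exp 2 * (\<Sum>k=1..K. \<Sum>p\<in>win k. y p)" by (simp add: sum_distrib_left)
  also have "\<dots> \<le> exp 2 * (\<Sum>k=1..K. \<beta> * (B + C) * sqrt (l / (A * D)) * (1 / real k))"
    by (intro mult_left_mono sum_mono sum_win_y) auto
  also have "\<dots> = exp 2 * (\<beta> * (B + C) * sqrt (l / (A * D)) * (\<Sum>k=1..K. 1 / real k))" by (simp add: sum_distrib_left)
  also have "\<dots> \<le> exp 2 * (\<beta> * (B + C) * sqrt (l / (A * D)) * (1 + D))"
  proof (intro mult_left_mono)
    have "\<gamma> * D \<le> 1 * D" using \<gamma> pos by (intro mult_right_mono) auto
    thus "(\<Sum>k=1..K. 1 / real k) \<le> 1 + D" using sum_inverse_bounds(1) by linarith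
  qed (use pos \<beta> in auto)
  finally have "(\<Sum>p\<in>P. real p powr (1 / A) * y p) \<le> exp 2 * \<beta> * (B + C) * sqrt (l / (A * D)) * (1 + D)" by (simp add: mult.assoc)
  moreover have "ln (T powr (3 / 2)) = 3 / 2 * l" using T l by (simp add: ln_powr)
  ultimately show ?thesis using e5 by (intro order_trans[OF _ e5]) simp
qed

lemma card_le: "real (card (few_per_class P cl {1..K} \<alpha>)) \<le> T powr \<kappa>"
proof -
  \<comment> \<open>Window \<open>k\<close> has at most
    \<open>(B + C) * exp (B * (k + 1)) * l\<close> primes, so these weights add up to
    O(\<open>l / D\<close>) over all windows. Their logarithms grow like \<open>(B + 1) * k\<close>;
    against the caps this gives \<open>a * (B + 1) * \<gamma> * l\<close> as the main term.\<close>
  define \<xi> where "\<xi> = (\<lambda>k. exp (- (B + 1) * (real k + 1)) / D)"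
  have \<xi>1: "\<xi> k \<le> 1" for k
  proof -
    have "exp (- (B + 1) * (real k + 1)) \<le> exp 0" using pos by (subst exp_le_cancel_iff) (auto intro!: mult_nonpos_nonneg)
    also have "exp 0 \<le> D" using D(2) by simp
    finally show ?thesis using pos(3) unfolding \<xi>_def by (simp add: pos_divide_le_eq)
  qed
  have "real (card (few_per_class P cl {1..K} \<alpha>)) \<le> exp ((\<Sum>k\<in>{1..K}. \<alpha> k * ln (1 / \<xi> k)) + (\<Sum>p\<in>P. \<xi> (cl p)))"
    by (rule card_few_per_class_le) (use P_in_win finite_P \<xi>1 pos in \<open>auto simp: \<xi>_def\<close>)
  also have "\<dots> \<le> exp (\<kappa> * l)"
  proof (subst exp_le_cancel_iff)
    have "(\<Sum>k\<in>{1..K}. \<alpha> k * ln (1 / \<xi> k)) = (\<Sum>k=1..K. a * l / D * ((B + 1) * (1 / real k) + (B + 1 + ln D) * (1 / (real k)\<^sup>2)))"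
    proof (intro sum.cong refl)
      fix k assume k: "k \<in> {1..K}"
      have "ln (1 / \<xi> k) = (B + 1) * (real k + 1) + ln D" using pos by (simp add: \<xi>_def ln_div algebra_simps)
      moreover have "(B + 1) * (real k + 1) + ln D = (B + 1) * real k + (B + 1 + ln D)" by (simp add: algebra_simps)
      moreover have "1 / (real k)\<^sup>2 * ((B + 1) * real k + (B + 1 + ln D)) = (B + 1) * (1 / real k) + (B + 1 + ln D) * (1 / (real k)\<^sup>2)"
        using k by (simp add: field_simps power2_eq_square)
      moreover have "\<alpha> k = a * l / D * (1 / (real k)\<^sup>2)" by (simp add: \<alpha>_def mult.commute)
      ultimately show "\<alpha> k * ln (1 / \<xi> k) = a * l / D * ((B + 1) * (1 / real k) + (B + 1 + ln D) * (1 / (real k)\<^sup>2))"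
        by (simp only: mult.assoc)
    qed
    also have "\<dots> = a * l / D * ((B + 1) * (\<Sum>k=1..K. 1 / real k) + (B + 1 + ln D) * (\<Sum>k=1..K. 1 / (real k)\<^sup>2))"
      by (simp only: sum_distrib_left[symmetric] sum.distrib)
    also have "\<dots> \<le> a * l / D * ((B + 1) * (1 + \<gamma> * D) + (B + 1 + ln D) * 2)"
      using a pos D by (intro mult_left_mono add_mono sum_inverse_bounds) auto
    finally have 1: "(\<Sum>k\<in>{1..K}. \<alpha> k * ln (1 / \<xi> k)) \<le> l * (a / D * ((B + 1) * (1 + \<gamma> * D) + 2 * (B + 1 + ln D)))"
      by (simp add: mult_ac)
    have "(\<Sum>p\<in>P. \<xi> (cl p)) = (\<Sum>k=1..K. real (card (win k)) * \<xi> k)"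
      unfolding sum_P by (intro sum.cong refl) (simp add: win_prime(6))
    also have "\<dots> \<le> (\<Sum>k=1..K. (B + C) * l / D * (2 * (1 / (real k)\<^sup>2)))"
    proof (intro sum_mono)
      fix k assume k: "k \<in> {1..K}"
      have "real (card (win k)) * \<xi> k \<le> (B + C) * exp (B * real (Suc k)) * l * \<xi> k"
        using card_win_le[of k] pos by (intro mult_right_mono) (auto simp: \<xi>_def)
      also have "\<dots> = (B + C) * l / D * (exp (B * (real k + 1)) * exp (- (B + 1) * (real k + 1)))" by (simp add: \<xi>_def mult_ac add_ac)
      also have "exp (B * (real k + 1)) * exp (- (B + 1) * (real k + 1)) = exp (- (real k + 1))"
        by (simp add: mult_exp_exp algebra_simps)
      also have "exp (- (real k + 1)) \<le> 2 * (1 / (real k)\<^sup>2)"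
      proof -
        have "(real k)\<^sup>2 / 2 \<le> exp (real k)" using exp_lower_Taylor_quadratic[of "real k"] by simp
        also have "\<dots> \<le> exp (real k + 1)" by simp
        finally have "1 / exp (real k + 1) \<le> 1 / ((real k)\<^sup>2 / 2)" using k by (intro frac_le) auto
        moreover have "1 / ((real k)\<^sup>2 / 2) = 2 * (1 / (real k)\<^sup>2)" by simp
        ultimately show ?thesis by (simp only: exp_minus inverse_eq_divide)
      qed
      finally show "real (card (win k)) * \<xi> k \<le> (B + C) * l / D * (2 * (1 / (real k)\<^sup>2))" using pos by (simp add: mult_left_mono divide_right_mono)
    qed
    also have "\<dots> = (B + C) * l / D * (2 * (\<Sum>k=1..K. 1 / (real k)\<^sup>2))" by (simp only: sum_distrib_left)
    also have "\<dots> \<le> (B + C) * l / D * (2 * 2)" using pos by (intro mult_left_mono sum_inverse_bounds) auto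
    finally have 2: "(\<Sum>p\<in>P. \<xi> (cl p)) \<le> l * (4 * (B + C) / D)" by (simp add: mult_ac)
    have "(\<Sum>k\<in>{1..K}. \<alpha> k * ln (1 / \<xi> k)) + (\<Sum>p\<in>P. \<xi> (cl p)) \<le>
      l * (a / D * ((B + 1) * (1 + \<gamma> * D) + 2 * (B + 1 + ln D)) + 4 * (B + C) / D)"
      using 1 2 by (simp add: distrib_left)
    also have "\<dots> \<le> l * \<kappa>" using pos by (intro mult_left_mono e6) auto
    finally show "(\<Sum>k\<in>{1..K}. \<alpha> k * ln (1 / \<xi> k)) + (\<Sum>p\<in>P. \<xi> (cl p)) \<le> \<kappa> * l" by (simp add: mult.commute)
  qed
  also have "\<dots> = T powr \<kappa>" using T l by (simp add: powr_def)
  finally show ?thesis .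
qed

text \<open>Window \<open>k\<close> contributes about
  \<open>\<beta> * B * sqrt (l * A / D) / (A * k)\<close>. Summing \<open>1 / k\<close> up to
  \<open>A powr \<gamma>\<close> yields \<open>\<gamma> * D\<close>, and this moves \<open>D\<close>
  into the numerator under the root: the origin of the triple logarithm in the theorem.\<close>

lemma gain_ge: "\<beta> * (B - C) * \<gamma> / (1 + \<tau>)\<^sup>2 * sqrt (l * D / A) \<le> (\<Sum>p\<in>P. y p / (1 + x p + y p))"
proof -
  define s where "s = sqrt (l * A / D)"
  have s0: "s \<ge> 0" using pos by (simp add: s_def)
  have "\<beta> * (B - C) * \<gamma> / (1 + \<tau>)\<^sup>2 * sqrt (l * D / A) = \<beta> * s * ((B - C) / ((1 + \<tau>) * A)) / (1 + \<tau>) * (\<gamma> * D)"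
    unfolding sqrt_lAD(2)[symmetric] s_def
    by (simp only: power2_eq_square divide_inverse inverse_mult_distrib mult_ac)
  also have "\<dots> \<le> \<beta> * s * ((B - C) / ((1 + \<tau>) * A)) / (1 + \<tau>) * (\<Sum>k=1..K. 1 / real k)"
    using pos \<tau> \<beta> s0 BC by (intro mult_left_mono sum_inverse_bounds) (auto intro!: divide_nonneg_nonneg mult_nonneg_nonneg)
  also have "\<dots> = (\<Sum>k=1..K. \<beta> * s / real k * ((B - C) / ((1 + \<tau>) * A)) / (1 + \<tau>))"
    unfolding sum_distrib_left by (intro sum.cong refl) (simp only: divide_inverse mult_ac mult_1_left)
  also have "\<dots> \<le> (\<Sum>k=1..K. \<Sum>p\<in>win k. y p / (1 + x p + y p))"
  proof (rule sum_mono)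
    fix k assume k: "k \<in> {1..K}"
    have "\<beta> * s / real k * ((B - C) / ((1 + \<tau>) * A)) / (1 + \<tau>) \<le> \<beta> * s / real k * (\<Sum>p\<in>win k. 1 / real p) / (1 + \<tau>)"
      using \<beta> s0 \<tau> by (intro divide_right_mono mult_left_mono win_sum_inverse(2)[OF k]) auto
    also have "\<dots> = (\<Sum>p\<in>win k. y p / (1 + \<tau>))"
      unfolding sum_distrib_left sum_divide_distrib by (intro sum.cong refl) (simp add: win_xy s_def)
    also have "\<dots> \<le> (\<Sum>p\<in>win k. y p / (1 + x p + y p))"
    proof (intro sum_mono divide_left_mono)
      fix p assume p: "p \<in> win k"
      have xy0: "x p \<ge> 0" "y p \<ge> 0" using f_nonneg by (auto simp: x_def y_def)
      show "1 + x p + y p \<le> 1 + \<tau>" using xy_le[OF p k] by simp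
      show "0 \<le> y p" by (rule xy0)
      show "0 < (1 + \<tau>) * (1 + x p + y p)" using xy0 \<tau> by (intro mult_pos_pos) auto
    qed
    finally show "\<beta> * s / real k * ((B - C) / ((1 + \<tau>) * A)) / (1 + \<tau>) \<le> (\<Sum>p\<in>win k. y p / (1 + x p + y p))" .
  qed
  finally show ?thesis by (simp only: sum_P)
qed

sublocale rankin P cl "{1..K}" \<alpha> x y
  by standard (use finite_P P_in_win prime_P prime_gt_0_nat f_nonneg in \<open>auto simp: x_def y_def\<close>)

lemma main_sum_ge:
  "(\<Sum>U\<in>few_per_class P cl {1..K} \<alpha>. \<Sum>K\<in>{K\<in>Pow U. real (\<Prod>K) \<le> T powr (3 / 2)}. (\<Prod>p\<in>K. f p / sqrt (real p)) * (\<Prod>p\<in>U - K. (f p)\<^sup>2)) \<ge>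
   1 / 2 * exp (\<beta> * (B - C) * \<gamma> / (1 + \<tau>)\<^sup>2 * sqrt (l * D / A)) * (\<Sum>U\<in>few_per_class P cl {1..K} \<alpha>. \<Prod>p\<in>U. (f p)\<^sup>2)"
proof -
  have "(\<Sum>U\<in>few_per_class P cl {1..K} \<alpha>. \<Sum>K\<in>{K\<in>Pow U. real (\<Prod>K) \<le> T powr (3 / 2)}. wt U K) \<ge> tot / 2"
    by (rule restricted_sum_ge[OF _ _ _ overfull_small large_small]) (use \<tau> A(2) T in auto)
  moreover have "tot \<ge> (\<Sum>U\<in>few_per_class P cl {1..K} \<alpha>. \<Prod>p\<in>U. x p) * exp (\<beta> * (B - C) * \<gamma> / (1 + \<tau>)\<^sup>2 * sqrt (l * D / A))"
  proof (rule order_trans[OF mult_left_mono tot_ge])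
    show "exp (\<beta> * (B - C) * \<gamma> / (1 + \<tau>)\<^sup>2 * sqrt (l * D / A)) \<le> exp (\<Sum>p\<in>P. y p / (1 + x p + y p))" using gain_ge by simp
    show "0 \<le> (\<Sum>U\<in>few_per_class P cl {1..K} \<alpha>. \<Prod>p\<in>U. x p)" by (intro sum_nonneg prod_nonneg) (simp add: x_def)
  qed
  ultimately show ?thesis unfolding wt_def x_def y_def by (simp add: mult_ac)
qed

lemma empty_in: "{} \<in> few_per_class P cl {1..K} \<alpha>"
  using a l(2) D(2) by (auto simp: few_per_class_def \<alpha>_def intro!: divide_nonneg_nonneg mult_nonneg_nonneg)

end

text \<open>Putting \<open>l = exp A\<close> and \<open>D = ln A\<close> turns every side condition
  into asymptotics in the single variable \<open>A\<close>. The last left side tends to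
  \<open>a * (B + 1) * \<gamma>\<close>, whence the assumption on \<open>\<kappa>\<close>.\<close>

lemma eventually_parameters:
  fixes B C \<tau> \<beta> a \<gamma> \<kappa> :: real
  assumes "0 < C" "C < B" "0 < \<tau>" "\<beta> > 0" "a > 0" "0 < \<gamma>" "\<gamma> < 1" and \<kappa>: "a * (B + 1) * \<gamma> < \<kappa>"
  shows "\<forall>\<^sub>F A in at_top. A + ln A + B * (A powr \<gamma> + 1) \<le> (1 + \<tau>) * A"
    and "\<forall>\<^sub>F A in at_top. \<beta>\<^sup>2 / ln A \<le> \<tau> / 2"
    and "\<forall>\<^sub>F A in at_top. \<beta> / sqrt (exp A * A) \<le> \<tau> / 2"
    and "\<forall>\<^sub>F A in at_top. \<beta> * (B + C) * A \<le> a * \<tau> * sqrt (exp A * A / ln A)"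
    and "\<forall>\<^sub>F A in at_top. A * exp (- (a * \<tau>\<^sup>2 / 16) * exp A / (ln A * A\<^sup>2)) \<le> 1 / 4"
    and "\<forall>\<^sub>F A in at_top. exp (- (1 / A) * (3 / 2 * exp A) + exp 2 * \<beta> * (B + C) * sqrt (exp A / (A * ln A)) * (1 + ln A)) \<le> 1 / 4"
    and "\<forall>\<^sub>F A in at_top. a / ln A * ((B + 1) * (1 + \<gamma> * ln A) + 2 * (B + 1 + ln (ln A))) + 4 * (B + C) / ln A \<le> \<kappa>"
proof -
  have B: "B > 0" "B + C > 0" using assms by linarith+
  show "\<forall>\<^sub>F A in at_top. A + ln A + B * (A powr \<gamma> + 1) \<le> (1 + \<tau>) * A"
  proof -
    have "((\<lambda>A. (A + ln A + B * (A powr \<gamma> + 1)) / A) \<longlongrightarrow> 1) at_top" using assms B by real_asymp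
    from order_tendstoD(2)[OF this, of "1 + \<tau>"] assms have "\<forall>\<^sub>F A in at_top. (A + ln A + B * (A powr \<gamma> + 1)) / A < 1 + \<tau>" by simp
    thus ?thesis using eventually_gt_at_top[of 0] by eventually_elim (simp add: pos_divide_less_eq)
  qed
  show "\<forall>\<^sub>F A in at_top. \<beta>\<^sup>2 / ln A \<le> \<tau> / 2"
  proof -
    have "((\<lambda>A::real. \<beta>\<^sup>2 / ln A) \<longlongrightarrow> 0) at_top" using assms by real_asymp
    from order_tendstoD(2)[OF this, of "\<tau> / 2"] assms show ?thesis by (auto elim: eventually_mono)
  qed
  show "\<forall>\<^sub>F A in at_top. \<beta> / sqrt (exp A * A) \<le> \<tau> / 2"
  proof -
    have "((\<lambda>A::real. \<beta> / sqrt (exp A * A)) \<longlongrightarrow> 0) at_top" using assms by real_asymp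
    from order_tendstoD(2)[OF this, of "\<tau> / 2"] assms show ?thesis by (auto elim: eventually_mono)
  qed
  show "\<forall>\<^sub>F A in at_top. \<beta> * (B + C) * A \<le> a * \<tau> * sqrt (exp A * A / ln A)"
  proof -
    define c d where "c = \<beta> * (B + C)" and "d = a * \<tau>"
    have "c > 0" "d > 0" using assms B by (auto simp: c_def d_def)
    hence "\<forall>\<^sub>F A::real in at_top. c * A \<le> d * sqrt (exp A * A / ln A)" by real_asymp
    thus ?thesis by (simp only: c_def d_def)
  qed
  show "\<forall>\<^sub>F A in at_top. A * exp (- (a * \<tau>\<^sup>2 / 16) * exp A / (ln A * A\<^sup>2)) \<le> 1 / 4"
  proof -
    define c where "c = a * \<tau>\<^sup>2 / 16"
    have "c > 0" using assms by (simp add: c_def)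
    hence "((\<lambda>A::real. A * exp (- c * exp A / (ln A * A\<^sup>2))) \<longlongrightarrow> 0) at_top" by real_asymp
    from order_tendstoD(2)[OF this, of "1 / 4"] show ?thesis by (auto simp: c_def elim: eventually_mono)
  qed
  show "\<forall>\<^sub>F A in at_top. exp (- (1 / A) * (3 / 2 * exp A) + exp 2 * \<beta> * (B + C) * sqrt (exp A / (A * ln A)) * (1 + ln A)) \<le> 1 / 4"
  proof -
    define c where "c = exp 2 * \<beta> * (B + C)"
    have "c > 0" using assms B by (simp add: c_def)
    hence "((\<lambda>A::real. exp (- (1 / A) * (3 / 2 * exp A) + c * sqrt (exp A / (A * ln A)) * (1 + ln A))) \<longlongrightarrow> 0) at_top" by real_asymp
    from order_tendstoD(2)[OF this, of "1 / 4"] show ?thesis by (auto simp: c_def elim: eventually_mono)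
  qed
  show "\<forall>\<^sub>F A in at_top. a / ln A * ((B + 1) * (1 + \<gamma> * ln A) + 2 * (B + 1 + ln (ln A))) + 4 * (B + C) / ln A \<le> \<kappa>"
  proof -
    define b c where "b = B + 1" and "c = 4 * (B + C)"
    have "b > 0" "c > 0" using B by (auto simp: b_def c_def)
    hence "((\<lambda>A::real. a / ln A * (b * (1 + \<gamma> * ln A) + 2 * (b + ln (ln A))) + c / ln A) \<longlongrightarrow> a * b * \<gamma>) at_top"
      using assms by real_asymp
    from order_tendstoD(2)[OF this, of \<kappa>] \<kappa> show ?thesis by (auto simp: b_def c_def elim: eventually_mono)
  qed
qed

lemma exists_resonator:
  fixes \<epsilon> :: real
  assumes \<epsilon>: "\<epsilon> > 0"
  shows "\<exists>\<kappa><1/4. \<forall>\<^sub>F T :: real in at_top. \<exists>(M :: nat set set) f. finite M \<and> {} \<in> M \<and>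
    (\<forall>U\<in>M. finite U \<and> (\<forall>p\<in>U. prime p)) \<and> (\<forall>U\<in>M. \<forall>V\<subseteq>U. V \<in> M) \<and> (\<forall>p. f p \<ge> 0) \<and> real (card M) \<le> T powr \<kappa> \<and>
    1 / 2 * exp ((1 / 2 - \<epsilon>) * sqrt (ln T * ln (ln (ln T)) / ln (ln T))) * (\<Sum>U\<in>M. \<Prod>p\<in>U. (f p)\<^sup>2) \<le>
      (\<Sum>U\<in>M. \<Sum>K\<in>{K\<in>Pow U. real (\<Prod>K) \<le> T powr (3 / 2)}. (\<Prod>p\<in>K. f p / sqrt (real p)) * (\<Prod>p\<in>U - K. (f p)\<^sup>2))"
proof -
  obtain C where C: "C \<ge> 1" and mertens: "\<And>x y. 1 \<le> x \<Longrightarrow> x \<le> y \<Longrightarrow>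
       \<bar>(\<Sum>p | prime p \<and> x < real p \<and> real p \<le> y. ln (real p) / real p) - ln (y / x)\<bar> \<le> C"
    using mertens_window by blast
  define \<tau> where "\<tau> = min (\<epsilon> / 5) (1 / 10)"
  have \<tau>: "0 < \<tau>" "\<tau> \<le> 1 / 10" "5 * \<tau> \<le> \<epsilon>" using \<epsilon> by (auto simp: \<tau>_def)
  \<comment> \<open>Windows so wide that the error in Mertens' theorem is the fraction
    \<open>\<tau> / 2\<close> of their mass.\<close>
  define B where "B = 2 * C / \<tau>"
  have "2 * C \<le> B * \<tau>" "C * \<tau> \<le> C * (1 / 10)" using \<tau> C by (auto simp: B_def)
  have B: "B > C" "(1 - \<tau>) * (B + C) \<le> B - C"
  proof -
    have "C * 1 < C * (2 / \<tau>)" using C \<tau> by (intro mult_strict_left_mono) (auto simp: field_simps)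
    thus "B > C" by (simp add: B_def mult_ac)
    have "(1 - \<tau>) * (B + C) = B + C - B * \<tau> - C * \<tau>" by (simp add: algebra_simps)
    also have "\<dots> \<le> B - C" using \<open>2 * C \<le> B * \<tau>\<close> mult_nonneg_nonneg[of C \<tau>] C \<tau> by linarith
    finally show "(1 - \<tau>) * (B + C) \<le> B - C" .
  qed
  \<comment> \<open>This makes \<open>a * (B + 1) * \<gamma>\<close> equal to
    \<open>(1 - \<tau>) / 4\<close>, just below \<open>\<kappa>\<close>. Then \<open>\<beta>\<close>
    is about as large as the caps allow, and \<open>\<beta> * B * \<gamma>\<close> tends to 1/2 with
    \<open>\<tau>\<close> tending to 0.\<close>
  define a where "a = 1 / (4 * (B + 1))"
  define \<beta> where "\<beta> = (1 - \<tau>) / (2 * (B + C))"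
  define \<gamma> where "\<gamma> = 1 - \<tau>"
  define \<kappa> where "\<kappa> = (1 - \<tau> / 2) / 4"
  have p: "a > 0" "\<beta> > 0" "0 < \<gamma>" "\<gamma> < 1" "B > 0" "B + C > 0" using B C \<tau> by (auto simp: a_def \<beta>_def \<gamma>_def)
  have aB: "a * (B + 1) * \<gamma> < \<kappa>" 
  proof -
    have "a * (B + 1) = 1 / 4" using p(5) by (simp add: a_def)
    thus ?thesis using \<tau> by (simp only:) (simp add: \<gamma>_def \<kappa>_def)
  qed
  have \<beta>a: "\<beta>\<^sup>2 * (B + C) \<le> a * (1 - \<tau>)\<^sup>2"
  proof -
    have "\<beta>\<^sup>2 * (B + C) = (1 - \<tau>)\<^sup>2 * (1 / (4 * (B + C)))" 
    proof -
      have "((1 - \<tau>) / (2 * s))\<^sup>2 * s = (1 - \<tau>)\<^sup>2 * (1 / (4 * s))" if "s > 0" for s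
        using that by (simp add: power_divide power2_eq_square)
      thus ?thesis unfolding \<beta>_def using p(6) by blast
    qed
    also have "\<dots> \<le> (1 - \<tau>)\<^sup>2 * (1 / (4 * (B + 1)))" using p C by (intro mult_left_mono frac_le) auto
    finally show ?thesis by (simp add: a_def mult.commute)
  qed
  have gain: "1 / 2 - \<epsilon> \<le> \<beta> * (B - C) * \<gamma> / (1 + \<tau>)\<^sup>2"
  proof -
    \<comment> \<open>Five factors \<open>1 - \<tau>\<close> are lost: three in
      \<open>\<beta> * (B - C) * \<gamma>\<close> and two in \<open>1 / (1 + \<tau>)^2\<close>.
      Hence the choice \<open>\<tau> \<le> \<epsilon> / 5\<close>.\<close>
    have "1 + real 5 * (- \<tau>) \<le> (1 + (- \<tau>)) ^ 5" using \<tau> by (intro Bernoulli_inequality) auto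
    hence "1 / 2 - \<epsilon> \<le> 1 / 2 * (1 - \<tau>) ^ 5" using \<tau> by simp
    also have "\<dots> = (1 / 2 * (1 - \<tau>) ^ 3) * (1 - \<tau>)\<^sup>2" by (simp add: eval_nat_numeral)
    also have "\<dots> \<le> (1 / 2 * (1 - \<tau>) ^ 3) * (1 / (1 + \<tau>)\<^sup>2)"
    proof (intro mult_left_mono)
      have "(1 - \<tau>) * (1 + \<tau>) \<le> 1" by (simp add: algebra_simps)
      hence "((1 - \<tau>) * (1 + \<tau>))\<^sup>2 \<le> 1" using \<tau> by (intro power_le_one) auto
      thus "(1 - \<tau>)\<^sup>2 \<le> 1 / (1 + \<tau>)\<^sup>2" using \<tau> by (simp add: pos_le_divide_eq power_mult_distrib)
    qed (use \<tau> in auto)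
    also have "1 / 2 * (1 - \<tau>) ^ 3 \<le> \<beta> * (B - C) * \<gamma>"
    proof -
      have "1 / 2 * (1 - \<tau>) ^ 3 = \<beta> * ((1 - \<tau>) * (B + C)) * \<gamma>" 
      proof -
        have "1 / 2 * (1 - \<tau>) ^ 3 = (1 - \<tau>) / (2 * s) * ((1 - \<tau>) * s) * (1 - \<tau>)" if "s > 0" for s
          using that by (simp add: eval_nat_numeral)
        thus ?thesis unfolding \<beta>_def \<gamma>_def using p(6) by blast
      qed
      also have "\<dots> \<le> \<beta> * (B - C) * \<gamma>" using p B by (intro mult_right_mono mult_left_mono) auto
      finally show ?thesis .
    qed
    hence "1 / 2 * (1 - \<tau>) ^ 3 * (1 / (1 + \<tau>)\<^sup>2) \<le> \<beta> * (B - C) * \<gamma> * (1 / (1 + \<tau>)\<^sup>2)" by (intro mult_right_mono) auto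
    finally show ?thesis by simp
  qed
  have "0 < C" using C by simp
  note ev = eventually_parameters[OF this B(1) \<tau>(1) p(2) p(1) p(3) p(4) aB]
  have "\<forall>\<^sub>F A::real in at_top. ln A \<ge> 1" by real_asymp
  note ev' = eventually_conj[OF this eventually_conj[OF ev(1) eventually_conj[OF ev(2) eventually_conj[OF ev(3)
     eventually_conj[OF ev(4) eventually_conj[OF ev(5) eventually_conj[OF ev(6) ev(7)]]]]]]]
  have "filterlim (\<lambda>T::real. ln (ln T)) at_top at_top" by real_asymp
  from eventually_compose_filterlim[OF ev' this]
  have ev'': "\<forall>\<^sub>F T::real in at_top. \<exists>(M :: nat set set) f. finite M \<and> {} \<in> M \<and>
    (\<forall>U\<in>M. finite U \<and> (\<forall>p\<in>U. prime p)) \<and> (\<forall>U\<in>M. \<forall>V\<subseteq>U. V \<in> M) \<and> (\<forall>p. f p \<ge> 0) \<and> real (card M) \<le> T powr \<kappa> \<and>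
    1 / 2 * exp ((1 / 2 - \<epsilon>) * sqrt (ln T * ln (ln (ln T)) / ln (ln T))) * (\<Sum>U\<in>M. \<Prod>p\<in>U. (f p)\<^sup>2) \<le>
      (\<Sum>U\<in>M. \<Sum>K\<in>{K\<in>Pow U. real (\<Prod>K) \<le> T powr (3 / 2)}. (\<Prod>p\<in>K. f p / sqrt (real p)) * (\<Prod>p\<in>U - K. (f p)\<^sup>2))"
    using eventually_ge_at_top[of "exp (exp (exp 1))"]
  proof eventually_elim
    case (elim T)
    define A where "A = ln (ln T)"
    have "1 \<le> exp (exp (exp (1::real)))" "1 \<le> exp (exp (1::real))" "1 \<le> exp (1::real)" by simp_all
    hence T1: "T \<ge> 1" using elim(2) by linarith
    have "exp (exp 1) \<le> ln T" using elim(2) T1 by (subst ln_ge_iff) auto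
    hence lT: "ln T \<ge> 1" using \<open>1 \<le> exp (exp (1::real))\<close> by linarith
    have "exp 1 \<le> A" unfolding A_def using \<open>exp (exp 1) \<le> ln T\<close> lT by (subst ln_ge_iff) auto
    hence A1: "A \<ge> 1" using \<open>1 \<le> exp (1::real)\<close> by linarith
    have eA: "exp A = ln T" using lT by (simp add: A_def)
    have E: "ln A \<ge> 1" "A + ln A + B * (A powr \<gamma> + 1) \<le> (1 + \<tau>) * A" "\<beta>\<^sup>2 / ln A \<le> \<tau> / 2"
       "\<beta> / sqrt (ln T * A) \<le> \<tau> / 2" "\<beta> * (B + C) * A \<le> a * \<tau> * sqrt (ln T * A / ln A)"
       "A * exp (- (a * \<tau>\<^sup>2 / 16) * ln T / (ln A * A\<^sup>2)) \<le> 1 / 4"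
       "exp (- (1 / A) * (3 / 2 * ln T) + exp 2 * \<beta> * (B + C) * sqrt (ln T / (A * ln A)) * (1 + ln A)) \<le> 1 / 4"
       "a / ln A * ((B + 1) * (1 + \<gamma> * ln A) + 2 * (B + 1 + ln (ln A))) + 4 * (B + C) / ln A \<le> \<kappa>"
      using elim(1)[folded A_def, unfolded eA] by blast+
    have "\<tau> \<le> 1 / 2" using \<tau> by linarith
    interpret prime_windows T B C \<tau> \<beta> a \<gamma> \<kappa> "ln T" A "ln A" "nat \<lfloor>A powr \<gamma>\<rfloor>"
      by standard (fact C B \<tau> p \<beta>a T1 lT A1 A_def E \<open>\<tau> \<le> 1 / 2\<close> refl | rule mertens; assumption)+
    define M where "M = few_per_class P cl {1..nat \<lfloor>A powr \<gamma>\<rfloor>} \<alpha>"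
    have sub: "V \<in> M" if "U \<in> M" "V \<subseteq> U" for U V
    proof -
      have U: "U \<subseteq> P" using that by (auto simp: M_def few_per_class_def)
      have "card {p\<in>V. cl p = k} \<le> card {p\<in>U. cl p = k}" for k
        using that U finite_subset[OF U finite_P] by (intro card_mono) auto
      hence le: "real (card {p\<in>V. cl p = k}) \<le> real (card {p\<in>U. cl p = k})" for k by simp
      have "real (card {p\<in>V. cl p = k}) \<le> \<alpha> k" if "k \<in> {1..nat \<lfloor>A powr \<gamma>\<rfloor>}" for k
        by (rule order_trans[OF le]) (use \<open>U \<in> M\<close> that in \<open>simp add: M_def few_per_class_def\<close>)
      thus ?thesis using U \<open>V \<subseteq> U\<close> unfolding M_def few_per_class_def by simp
    qed
    have "exp ((1 / 2 - \<epsilon>) * sqrt (ln T * ln A / A)) \<le> exp (\<beta> * (B - C) * \<gamma> / (1 + \<tau>)\<^sup>2 * sqrt (ln T * ln A / A))"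
      using gain lT A1 by (subst exp_le_cancel_iff, intro mult_right_mono) auto
    hence "1 / 2 * exp ((1 / 2 - \<epsilon>) * sqrt (ln T * ln A / A)) * (\<Sum>U\<in>M. \<Prod>p\<in>U. (f p)\<^sup>2) \<le>
       1 / 2 * exp (\<beta> * (B - C) * \<gamma> / (1 + \<tau>)\<^sup>2 * sqrt (ln T * ln A / A)) * (\<Sum>U\<in>M. \<Prod>p\<in>U. (f p)\<^sup>2)"
      by (intro mult_right_mono mult_left_mono sum_nonneg prod_nonneg) auto
    also note main_sum_ge[folded M_def]
    finally have main: "1 / 2 * exp ((1 / 2 - \<epsilon>) * sqrt (ln T * ln A / A)) * (\<Sum>U\<in>M. \<Prod>p\<in>U. (f p)\<^sup>2) \<le>
      (\<Sum>U\<in>M. \<Sum>K\<in>{K\<in>Pow U. real (\<Prod>K) \<le> T powr (3 / 2)}. (\<Prod>p\<in>K. f p / sqrt (real p)) * (\<Prod>p\<in>U - K. (f p)\<^sup>2))" .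
    show ?case
    proof (intro exI[of _ M] exI[of _ f] conjI ballI allI impI)
      have MP: "U \<subseteq> P" if "U \<in> M" for U using that by (auto simp: M_def few_per_class_def)
      show "finite M" by (rule finite_subset[of _ "Pow P"]) (use MP finite_P in auto)
      show "finite U" if "U \<in> M" for U using MP[OF that] finite_P finite_subset by blast
      show "prime p" if "U \<in> M" "p \<in> U" for U p using MP[OF that(1)] that(2) prime_P by blast
      show "{} \<in> M" "real (card M) \<le> T powr \<kappa>" unfolding M_def by (fact empty_in card_le)+
      show "V \<in> M" if "U \<in> M" "V \<subseteq> U" for U V by (rule sub[OF that])
      show "0 \<le> f p" for p by (rule f_nonneg)
    qed (use main in \<open>simp only: A_def\<close>)
  qed
  have "\<kappa> < 1 / 4" using \<tau> by (simp add: \<kappa>_def)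
  thus ?thesis using ev'' by (intro exI[of _ \<kappa>]) simp
qed

section \<open>The resonance argument\<close>

lemma inj_on_prod_primes:
  assumes "\<And>U. U \<in> M \<Longrightarrow> finite U \<and> (\<forall>p\<in>U. prime (p :: nat))"
  shows "inj_on Prod M"
proof (rule inj_onI)
  have "prime_factors (\<Prod>U) = U" if "U \<in> M" for U
  proof -
    have U: "finite U" "\<And>p. p \<in> U \<Longrightarrow> prime p" using assms[OF that] by auto
    have "prime_factors (\<Prod>p\<in>U. p) = \<Union> ((prime_factors \<circ> (\<lambda>p. p)) ` U)"
      using U by (intro prime_factors_prod) (auto dest: prime_gt_0_nat)
    also have "\<dots> = U" using U by (auto simp: prime_prime_factors)
    finally show ?thesis by simp
  qed
  thus "U = V" if "U \<in> M" "V \<in> M" "\<Prod>U = \<Prod>V" for U V using that by metis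
qed

text \<open>Closure under subsets puts both \<open>K\<close> and \<open>U - K\<close> into
  \<open>M\<close> whenever \<open>K \<subseteq> U\<close> and \<open>U\<close> is in
  \<open>M\<close>, so that every pair \<open>(U, K)\<close> of the resonance sum comes from a pair
  of resonator terms.\<close>

locale zeta_resonance =
  fixes M :: "nat set set" and f :: "nat \<Rightarrow> real" and T :: real
  assumes M: "finite M" "{} \<in> M" "\<And>U. U \<in> M \<Longrightarrow> finite U \<and> (\<forall>p\<in>U. prime p)" "\<And>U V. U \<in> M \<Longrightarrow> V \<subseteq> U \<Longrightarrow> V \<in> M"
    and f: "\<And>p. f p \<ge> 0" and T3: "T \<ge> 3"
begin

definition Y :: real where "Y = T powr (3 / 4)"
definition X :: nat where "X = nat \<lceil>T powr (3 / 2)\<rceil>"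

sublocale resonator M "\<lambda>U. \<Prod>p\<in>U. f p" "\<lambda>U. \<Sum>p\<in>U. ln (real p)" T
  by standard (use M f T3 in \<open>auto intro: prod_nonneg\<close>)

abbreviation w :: "real \<Rightarrow> real" where "w t \<equiv> 1 - t / T"
abbreviation E :: real where "E \<equiv> card M * S0"

lemma Y: "1 \<le> Y" "Y \<le> T" "0 < T"
proof -
  show "1 \<le> Y" unfolding Y_def using T3 by (intro ge_one_powr_ge_zero) auto
  have "Y \<le> T powr 1" unfolding Y_def using T3 by (intro powr_mono) auto
  thus "Y \<le> T" "0 < T" using T3 by auto
qed

lemma S0_eq: "S0 = (\<Sum>U\<in>M. \<Prod>p\<in>U. (f p)\<^sup>2)"
  by (simp add: S0_def prod_power_distrib)

lemma S0_pos: "S0 > 0"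
proof -
  have "(\<Sum>U\<in>{{}}. \<Prod>p\<in>U. (f p)\<^sup>2) \<le> (\<Sum>U\<in>M. \<Prod>p\<in>U. (f p)\<^sup>2)"
    using M by (intro sum_mono2) (auto intro!: prod_nonneg)
  thus ?thesis by (simp add: S0_eq)
qed

text \<open>Every \<open>k\<close> up to \<open>X\<close> contributes a nonnegative amount. Only the
  products \<open>\<Prod>K\<close> with \<open>K\<close> in \<open>M\<close> are kept, distinct by
  unique factorization; for these the map from \<open>V\<close> to \<open>V \<union> K\<close>
  matches resonator frequencies that differ by exactly \<open>ln (\<Prod>K)\<close>.\<close>

lemma dsum_P_ge:
  "Re (integral {0..T} (\<lambda>t. dsum X t * of_real (P t) * of_real (w t))) \<ge>
    T / 4 * (\<Sum>U\<in>M. \<Sum>K\<in>{K\<in>Pow U. real (\<Prod>K) \<le> T powr (3 / 2)}. (\<Prod>p\<in>K. f p / sqrt (real p)) * (\<Prod>p\<in>U - K. (f p)\<^sup>2))"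
proof -
  define H where "H = (\<lambda>\<xi>. integral {0..T} (\<lambda>t. cis (- \<xi> * t) * of_real (P t) * of_real (w t)))"
  define F where "F = {K\<in>M. real (\<Prod>K) \<le> T powr (3 / 2)}"
  define A where "A = (\<lambda>K. {V\<in>M. V \<inter> K = {} \<and> V \<union> K \<in> M})"
  define g where "g = (\<lambda>U. \<Prod>p\<in>U. f p)"
  have int: "(\<lambda>t. cis (- \<xi> * t) * of_real (P t) * of_real (w t)) integrable_on {0..T}" for \<xi>
    by (intro integrable_continuous_interval continuous_intros continuous_P) (use Y in auto)
  \<comment> \<open>Keeping no pair at all leaves the bare nonnegativity.\<close>
  have H0: "Re (H \<xi>) \<ge> 0" for \<xi>
    using fejer_P_ge[of "{}" id \<xi>] unfolding H_def by simp
  have pr: "prime p" if "K \<in> M" "p \<in> K" for K p using M(3)[OF that(1)] that(2) by blast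
  have pos: "real p > 0" if "K \<in> M" "p \<in> K" for K p using pr[OF that] prime_gt_0_nat by simp
  have HK: "Re (H (ln (real (\<Prod>K)))) \<ge> T / 4 * (\<Sum>V\<in>A K. g V * g (V \<union> K))" if K: "K \<in> F" for K
    unfolding H_def g_def
  proof (rule fejer_P_ge)
    show "A K \<subseteq> M" "(\<lambda>V. V \<union> K) ` A K \<subseteq> M" by (auto simp: A_def)
    show "inj_on (\<lambda>V. V \<union> K) (A K)" by (rule inj_onI) (auto simp: A_def)
    fix V assume V: "V \<in> A K"
    have "ln (real (\<Prod>K)) = (\<Sum>p\<in>K. ln (real p))"
      using K pos M(3) unfolding of_nat_prod by (intro ln_prod) (auto simp: F_def)
    moreover have "(\<Sum>p\<in>V \<union> K. ln (real p)) = (\<Sum>p\<in>V. ln (real p)) + (\<Sum>p\<in>K. ln (real p))"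
      using V K M(3) by (intro sum.union_disjoint) (auto simp: A_def F_def)
    ultimately show "(\<Sum>p\<in>V \<union> K. ln (real p)) = (\<Sum>p\<in>V. ln (real p)) + ln (real (\<Prod>K))" by simp
  qed
  have "((\<lambda>t. \<Sum>k=1..X. of_real (1 / sqrt (real k)) * (cis (- ln (real k) * t) * of_real (P t) * of_real (w t))) has_integral
     (\<Sum>k=1..X. of_real (1 / sqrt (real k)) * H (ln (real k)))) {0..T}"
    unfolding H_def by (intro has_integral_sum has_integral_mult_right integrable_integral int) auto
  moreover have "dsum X t * of_real (P t) * of_real (w t) =
     (\<Sum>k=1..X. of_real (1 / sqrt (real k)) * (cis (- ln (real k) * t) * of_real (P t) * of_real (w t)))" for t
    unfolding dsum_eq sum_distrib_right by (simp only: mult.assoc)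
  ultimately have "integral {0..T} (\<lambda>t. dsum X t * of_real (P t) * of_real (w t)) = (\<Sum>k=1..X. of_real (1 / sqrt (real k)) * H (ln (real k)))"
    by (simp only: integral_unique)
  hence "Re (integral {0..T} (\<lambda>t. dsum X t * of_real (P t) * of_real (w t))) = (\<Sum>k=1..X. 1 / sqrt (real k) * Re (H (ln (real k))))"
    by (simp only: Re_sum times_complex.sel Re_complex_of_real Im_complex_of_real mult_zero_left diff_0_right)
  also have "\<dots> \<ge> (\<Sum>k\<in>Prod ` F. 1 / sqrt (real k) * Re (H (ln (real k))))"
  proof (rule sum_mono2)
    show "Prod ` F \<subseteq> {1..X}"
    proof
      fix k assume "k \<in> Prod ` F"
      then obtain K where K: "K \<in> M" "real k \<le> T powr (3 / 2)" "k = \<Prod>K" by (auto simp: F_def)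
      have "k > 0" unfolding K(3) by (rule prod_pos) (use pr[OF K(1)] prime_gt_0_nat in blast)
      moreover have "real k \<le> real X" using K(2) unfolding X_def by linarith
      ultimately show "k \<in> {1..X}" by simp
    qed
  qed (use H0 in auto)
  also have "(\<Sum>k\<in>Prod ` F. 1 / sqrt (real k) * Re (H (ln (real k)))) = (\<Sum>K\<in>F. 1 / sqrt (real (\<Prod>K)) * Re (H (ln (real (\<Prod>K)))))"
    by (subst sum.reindex) (auto intro!: inj_on_subset[OF inj_on_prod_primes[of M]] M simp: F_def)
  also have "\<dots> \<ge> (\<Sum>K\<in>F. 1 / sqrt (real (\<Prod>K)) * (T / 4 * (\<Sum>V\<in>A K. g V * g (V \<union> K))))"
    by (intro sum_mono mult_left_mono HK) (auto intro: prod_nonneg)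
  also have "(\<Sum>K\<in>F. 1 / sqrt (real (\<Prod>K)) * (T / 4 * (\<Sum>V\<in>A K. g V * g (V \<union> K)))) =
     T / 4 * (\<Sum>K\<in>F. \<Sum>V\<in>A K. 1 / sqrt (real (\<Prod>K)) * (g V * g (V \<union> K)))"
    by (simp add: sum_distrib_left mult_ac)
  also have "(\<Sum>K\<in>F. \<Sum>V\<in>A K. 1 / sqrt (real (\<Prod>K)) * (g V * g (V \<union> K))) =
     (\<Sum>U\<in>M. \<Sum>K\<in>{K\<in>Pow U. real (\<Prod>K) \<le> T powr (3 / 2)}. (\<Prod>p\<in>K. f p / sqrt (real p)) * (\<Prod>p\<in>U - K. (f p)\<^sup>2))"
  proof -
    have "(\<Sum>K\<in>F. \<Sum>V\<in>A K. 1 / sqrt (real (\<Prod>K)) * (g V * g (V \<union> K))) = (\<Sum>(K, V)\<in>Sigma F A. 1 / sqrt (real (\<Prod>K)) * (g V * g (V \<union> K)))"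
      using M(1) by (intro sum.Sigma) (auto simp: F_def A_def)
    also have "\<dots> = (\<Sum>(U, K)\<in>Sigma M (\<lambda>U. {K\<in>Pow U. real (\<Prod>K) \<le> T powr (3 / 2)}). (\<Prod>p\<in>K. f p / sqrt (real p)) * (\<Prod>p\<in>U - K. (f p)\<^sup>2))"
    proof (rule sum.reindex_bij_witness[of _ "\<lambda>q. (snd q, fst q - snd q)" "\<lambda>q. (snd q \<union> fst q, fst q)"])
      fix q assume "q \<in> Sigma F A"
      then obtain K V where q: "q = (K, V)" and KV: "K \<in> M" "real (\<Prod>K) \<le> T powr (3 / 2)" "V \<in> M" "V \<inter> K = {}" "V \<union> K \<in> M"
        unfolding F_def A_def by blast
      have VK: "V \<union> K - K = V" using KV(4) by blast
      show "(snd (snd q \<union> fst q, fst q), fst (snd q \<union> fst q, fst q) - snd (snd q \<union> fst q, fst q)) = q"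
        unfolding q fst_conv snd_conv VK ..
      show "(snd q \<union> fst q, fst q) \<in> Sigma M (\<lambda>U. {K\<in>Pow U. real (\<Prod>K) \<le> T powr (3 / 2)})"
        using KV unfolding q by simp
      have fin: "finite V" "finite K" using KV M(3) by blast+
      have s: "sqrt (real (\<Prod>K)) = (\<Prod>p\<in>K. sqrt (real p))"
        using fin(2) by (induction K rule: finite_induct) (simp_all add: real_sqrt_mult)
      have gVK: "g (V \<union> K) = g V * g K" unfolding g_def using KV(4) fin by (intro prod.union_disjoint) auto
      have "(\<Prod>p\<in>K. f p / sqrt (real p)) * (\<Prod>p\<in>V. (f p)\<^sup>2) = g K / sqrt (real (\<Prod>K)) * (g V)\<^sup>2"
        unfolding s g_def prod_dividef prod_power_distrib ..
      also have "\<dots> = 1 / sqrt (real (\<Prod>K)) * (g V * (g V * g K))" by (simp add: power2_eq_square)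
      finally show "(case (snd q \<union> fst q, fst q) of (U, K) \<Rightarrow> (\<Prod>p\<in>K. f p / sqrt (real p)) * (\<Prod>p\<in>U - K. (f p)\<^sup>2)) =
          (case q of (K, V) \<Rightarrow> 1 / sqrt (real (\<Prod>K)) * (g V * g (V \<union> K)))"
        unfolding q fst_conv snd_conv prod.case VK gVK .
    next
      fix q assume "q \<in> Sigma M (\<lambda>U. {K\<in>Pow U. real (\<Prod>K) \<le> T powr (3 / 2)})"
      then obtain U K where q: "q = (U, K)" and U: "U \<in> M" "K \<subseteq> U" "real (\<Prod>K) \<le> T powr (3 / 2)" by blast
      have eq: "U - K \<union> K = U" using U(2) by blast
      show "(snd (snd q, fst q - snd q) \<union> fst (snd q, fst q - snd q), fst (snd q, fst q - snd q)) = q"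
        unfolding q fst_conv snd_conv eq ..
      have "K \<in> M" "U - K \<in> M" using M(4)[OF U(1)] U(2) by blast+
      thus "(snd q, fst q - snd q) \<in> Sigma F A"
        using U unfolding q F_def A_def fst_conv snd_conv by (simp add: Un_absorb2 Int_commute)
    qed
    also have "\<dots> = (\<Sum>U\<in>M. \<Sum>K\<in>{K\<in>Pow U. real (\<Prod>K) \<le> T powr (3 / 2)}. (\<Prod>p\<in>K. f p / sqrt (real p)) * (\<Prod>p\<in>U - K. (f p)\<^sup>2))"
      using M by (intro sum.Sigma[symmetric]) auto
    finally show ?thesis .
  qed
  finally show ?thesis .
qed

lemma weighted_osc:
  assumes ab: "0 \<le> a" "a \<le> b" "b \<le> T" and F: "continuous_on {a..b} F"
    and Q: "\<And>x \<mu>. x \<in> {a..b} \<Longrightarrow> norm (integral {a..x} (\<lambda>t. F t * cis (\<mu> * t))) \<le> Q"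
  shows "norm (integral {a..b} (\<lambda>t. F t * of_real (P t) * of_real (w t))) \<le> Q * E"
proof -
  have cw: "continuous_on S (\<lambda>t. complex_of_real (w t))" for S by (intro continuous_intros) (use Y in simp)
  have cc: "continuous_on S (\<lambda>t. cis (\<mu> * t))" for S \<mu> by (intro continuous_intros)
  have "norm (integral {a..b} (\<lambda>t. (F t * of_real (w t)) * of_real (P t))) \<le> Q * E"
  proof (rule norm_integral_mult_P_le)
    show "continuous_on {a..b} (\<lambda>t. F t * of_real (w t))" by (rule continuous_on_mult[OF F cw])
    fix \<mu>
    have "norm (integral {a..b} (\<lambda>t. (F t * cis (\<mu> * t)) * of_real (w t))) \<le> Q"
      by (rule norm_integral_mult_decreasing_le[OF ab(2,3,1) continuous_on_mult[OF F cc] Q])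
    thus "norm (integral {a..b} (\<lambda>t. F t * of_real (w t) * cis (\<mu> * t))) \<le> Q" by (simp only: mult_ac)
  qed
  thus ?thesis by (simp only: mult_ac)
qed

text \<open>The function \<open>\<bar>Z\<bar> + s * Z\<close> is 0 or \<open>2 * s * Z\<close>,
  hence at most \<open>2 * m\<close>. Its weighted integral is nearly that of
  \<open>\<bar>Z\<bar>\<close>, since the integral of \<open>Z\<close> itself is only an error, and
  so it inherits the lower bound \<open>W\<close> obtained from zeta; \<open>V\<close> stands for
  the gain.\<close>

lemma max_ge:
  assumes s: "s = 1 \<or> s = - 1" and m: "m \<ge> 0" "\<And>t. t \<in> {Y..T} \<Longrightarrow> s * hardy_Z t \<le> m"
    and W: "V / 2 * S0 \<le> (\<Sum>U\<in>M. \<Sum>K\<in>{K\<in>Pow U. real (\<Prod>K) \<le> T powr (3 / 2)}. (\<Prod>p\<in>K. f p / sqrt (real p)) * (\<Prod>p\<in>U - K. (f p)\<^sup>2))"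
  shows "m \<ge> V / 128 - 2240 * (Y * ln T) * card M / T"
proof -
  define W where "W = (\<Sum>U\<in>M. \<Sum>K\<in>{K\<in>Pow U. real (\<Prod>K) \<le> T powr (3 / 2)}. (\<Prod>p\<in>K. f p / sqrt (real p)) * (\<Prod>p\<in>U - K. (f p)\<^sup>2))"
  define L where "L = Y * ln T"
  have lT: "ln T \<ge> 1" by (rule dsum_length_bounds(5)[OF T3 refl])
  have E0: "E \<ge> 0" using S0_pos by simp
  have w01: "0 \<le> w t" "w t \<le> 1" if "t \<in> {0..T}" for t using that Y by auto
  define \<zeta> where "\<zeta> = (\<lambda>t. zeta (critical t))"
  have c\<zeta>: "continuous_on S \<zeta>" for S unfolding \<zeta>_def by (rule continuous_on_zeta_critical)
  have cw: "continuous_on S (\<lambda>t. complex_of_real (w t))" "continuous_on S (\<lambda>t. complex_of_real (P t))" for S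
    using Y by (intro continuous_intros continuous_P; simp)+
  note ci = integrable_continuous_interval continuous_on_mult continuous_on_diff continuous_on_dsum c\<zeta> cw
  have I1: "Re (integral {0..T} (\<lambda>t. dsum X t * of_real (P t) * of_real (w t))) \<ge> T / 4 * W"
    unfolding W_def by (rule dsum_P_ge)
  have I2: "norm (integral {0..Y} (\<lambda>t. dsum X t * of_real (P t) * of_real (w t))) \<le> 200 * L * E"
    using Y dsum_short_integral_le[OF T3 X_def, folded Y_def]
    by (intro weighted_osc continuous_on_dsum) (auto simp: L_def mult.assoc)
  have I3: "norm (integral {Y..T} (\<lambda>t. (\<zeta> t - dsum X t) * of_real (P t) * of_real (w t))) \<le> 40 * L * E"
  proof -
    have "norm (integral {Y..T} (\<lambda>t. (\<zeta> t - dsum X t) * of_real (P t) * of_real (w t))) \<le> integral {Y..T} (\<lambda>t. norm (\<zeta> t - dsum X t) * E)"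
    proof (rule integral_norm_bound_integral)
      fix t assume t: "t \<in> {Y..T}"
      have "norm ((\<zeta> t - dsum X t) * of_real (P t) * of_real (w t)) = norm (\<zeta> t - dsum X t) * P t * w t"
        using w01(1)[of t] t Y P_nonneg[of t] by (simp only: norm_mult norm_of_real) simp
      also have "\<dots> \<le> norm (\<zeta> t - dsum X t) * E * 1"
        by (intro mult_mono mult_nonneg_nonneg norm_ge_zero P_nonneg P_le w01 E0) (use t Y in auto)
      finally show "norm ((\<zeta> t - dsum X t) * of_real (P t) * of_real (w t)) \<le> norm (\<zeta> t - dsum X t) * E" by simp
    qed (intro ci continuous_on_norm continuous_on_const)+
    also have "\<dots> = integral {Y..T} (\<lambda>t. norm (\<zeta> t - dsum X t)) * E" by (rule integral_mult_left)
    also have "\<dots> \<le> integral {0..T} (\<lambda>t. norm (\<zeta> t - dsum X t)) * E"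
      using Y E0 by (intro mult_right_mono integral_subset_le ci continuous_on_norm) auto
    also have "\<dots> \<le> 40 * L * E"
      using integral_zeta_minus_dsum_le[OF T3 X_def] E0 by (intro mult_right_mono) (auto simp: \<zeta>_def L_def Y_def mult.assoc)
    finally show ?thesis .
  qed
  have I4: "norm (integral {Y..T} (\<lambda>t. complex_of_real (hardy_Z t) * of_real (P t) * of_real (w t))) \<le> 2000 * L * E"
    using Y hardy_Z_integral_le[OF T3, folded Y_def] continuous_hardy_Z
    by (intro weighted_osc) (auto simp: L_def mult.assoc intro!: continuous_intros elim: continuous_on_subset)
  have c1: "integral {0..T} (\<lambda>t. dsum X t * of_real (P t) * of_real (w t)) =
     integral {0..Y} (\<lambda>t. dsum X t * of_real (P t) * of_real (w t)) + integral {Y..T} (\<lambda>t. dsum X t * of_real (P t) * of_real (w t))"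
    using Y by (intro Henstock_Kurzweil_Integration.integral_combine[symmetric] ci) auto
  have c2: "integral {Y..T} (\<lambda>t. \<zeta> t * of_real (P t) * of_real (w t)) =
     integral {Y..T} (\<lambda>t. dsum X t * of_real (P t) * of_real (w t)) + integral {Y..T} (\<lambda>t. (\<zeta> t - dsum X t) * of_real (P t) * of_real (w t))"
  proof -
    have e: "\<zeta> t * of_real (P t) * of_real (w t) =
        dsum X t * of_real (P t) * of_real (w t) + (\<zeta> t - dsum X t) * of_real (P t) * of_real (w t)" for t
      by (simp only: left_diff_distrib add_diff_eq add_diff_cancel_left')
    show ?thesis unfolding e by (rule integral_add) (intro ci)+
  qed
  have cZ: "continuous_on {Y..T} hardy_Z" by (rule continuous_on_subset[OF continuous_hardy_Z]) simp
  have cPw: "continuous_on {Y..T} (\<lambda>t. P t * w t)" by (intro continuous_on_mult continuous_P continuous_intros) (use Y in simp)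
  have hZint: "(\<lambda>t. hardy_Z t * (P t * w t)) integrable_on {Y..T}" "(\<lambda>t. \<bar>hardy_Z t\<bar> * (P t * w t)) integrable_on {Y..T}"
    by (rule integrable_continuous_interval[OF continuous_on_mult[OF cZ cPw]],
        rule integrable_continuous_interval[OF continuous_on_mult[OF continuous_on_rabs[OF cZ] cPw]])
  \<comment> \<open>The loss is 200 for the stretch below \<open>Y\<close> and 40 for replacing the
    Dirichlet polynomial by zeta; the integral of \<open>Z\<close> later adds 2000.\<close>
  have "T / 4 * W - 240 * L * E \<le> Re (integral {Y..T} (\<lambda>t. \<zeta> t * of_real (P t) * of_real (w t)))"
    using I1 order_trans[OF abs_Re_le_cmod I2] order_trans[OF abs_Re_le_cmod I3]
    unfolding c1 c2 plus_complex.sel by (simp add: abs_le_iff)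
  moreover have "norm (integral {Y..T} (\<lambda>t. \<zeta> t * of_real (P t) * of_real (w t))) \<le> integral {Y..T} (\<lambda>t. \<bar>hardy_Z t\<bar> * (P t * w t))"
  proof (rule integral_norm_bound_integral)
    show "(\<lambda>t. \<zeta> t * of_real (P t) * of_real (w t)) integrable_on {Y..T}"
      by (rule integrable_continuous_interval[OF continuous_on_mult[OF continuous_on_mult[OF c\<zeta> cw(2)] cw(1)]])
    show "(\<lambda>t. \<bar>hardy_Z t\<bar> * (P t * w t)) integrable_on {Y..T}" by (rule hZint(2))
    fix t assume t: "t \<in> {Y..T}"
    hence "norm (of_real (w t) :: complex) = w t" "norm (of_real (P t) :: complex) = P t"
      using w01(1)[of t] Y P_nonneg[of t] by (simp_all only: norm_of_real) simp_all
    thus "norm (\<zeta> t * of_real (P t) * of_real (w t)) \<le> \<bar>hardy_Z t\<bar> * (P t * w t)"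
      by (simp only: norm_mult abs_hardy_Z \<zeta>_def mult.assoc order_refl)
  qed
  ultimately have lower: "T / 4 * W - 240 * L * E \<le> integral {Y..T} (\<lambda>t. \<bar>hardy_Z t\<bar> * (P t * w t))"
    using complex_Re_le_cmod[of "integral {Y..T} (\<lambda>t. \<zeta> t * of_real (P t) * of_real (w t))"] by linarith
  have "integral {Y..T} (\<lambda>t. complex_of_real (hardy_Z t * (P t * w t))) = of_real (integral {Y..T} (\<lambda>t. hardy_Z t * (P t * w t)))"
    by (rule integral_unique[OF has_integral_of_real[OF integrable_integral[OF hZint(1)]]])
  hence "norm (integral {Y..T} (\<lambda>t. complex_of_real (hardy_Z t) * of_real (P t) * of_real (w t))) =
      \<bar>integral {Y..T} (\<lambda>t. hardy_Z t * (P t * w t))\<bar>"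
    by (simp only: of_real_mult mult.assoc norm_of_real)
  with I4 have "\<bar>integral {Y..T} (\<lambda>t. hardy_Z t * (P t * w t))\<bar> \<le> 2000 * L * E" by linarith
  hence "s * integral {Y..T} (\<lambda>t. hardy_Z t * (P t * w t)) \<ge> - (2000 * L * E)" using s by auto
  moreover have "integral {Y..T} (\<lambda>t. \<bar>hardy_Z t\<bar> * (P t * w t) + s * (hardy_Z t * (P t * w t))) =
     integral {Y..T} (\<lambda>t. \<bar>hardy_Z t\<bar> * (P t * w t)) + s * integral {Y..T} (\<lambda>t. hardy_Z t * (P t * w t))"
    by (simp only: integral_add[OF hZint(2) integrable_on_mult_right[OF hZint(1)]] integral_mult_right)
  moreover have "integral {Y..T} (\<lambda>t. \<bar>hardy_Z t\<bar> * (P t * w t) + s * (hardy_Z t * (P t * w t))) \<le> integral {Y..T} (\<lambda>t. 2 * m * P t)"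
  proof (rule integral_le)
    show "(\<lambda>t. \<bar>hardy_Z t\<bar> * (P t * w t) + s * (hardy_Z t * (P t * w t))) integrable_on {Y..T}"
      by (rule integrable_add[OF hZint(2) integrable_on_mult_right[OF hZint(1)]])
    show "(\<lambda>t. 2 * m * P t) integrable_on {Y..T}"
      by (rule integrable_continuous_interval[OF continuous_on_mult[OF continuous_on_const continuous_P]])
    fix t assume t: "t \<in> {Y..T}"
    have hm: "\<bar>hardy_Z t\<bar> + s * hardy_Z t \<le> 2 * m" using m(1) m(2)[OF t] s by auto
    have "t \<in> {0..T}" using t Y by simp
    hence Pw: "0 \<le> P t * w t" "P t * w t \<le> P t"
      using mult_nonneg_nonneg[OF P_nonneg w01(1)] mult_left_le[OF w01(2) P_nonneg] by blast+
    have "(\<bar>hardy_Z t\<bar> + s * hardy_Z t) * (P t * w t) \<le> 2 * m * P t"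
      by (rule mult_mono[OF hm Pw(2) _ Pw(1)]) (use m(1) in simp)
    thus "\<bar>hardy_Z t\<bar> * (P t * w t) + s * (hardy_Z t * (P t * w t)) \<le> 2 * m * P t" by (simp only: distrib_right mult.assoc)
  qed
  moreover have "integral {Y..T} (\<lambda>t. 2 * m * P t) = 2 * m * integral {Y..T} P" by (rule integral_mult_right)
  ultimately have "T / 4 * W - 2240 * L * E \<le> 2 * m * integral {Y..T} P" using lower by linarith
  \<comment> \<open>As \<open>P\<close> is nonnegative, the interval is enlarged to a full period,
    where the integral is known exactly.\<close>
  also have "\<dots> \<le> 2 * m * (2 * pi * T * S0)"
  proof (intro mult_left_mono)
    have "1 * T \<le> (2 * pi) * T" using Y pi_gt3 by (intro mult_right_mono) auto
    hence "integral {Y..T} P \<le> integral {0..2 * pi * T} P"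
      using Y P_nonneg by (intro integral_subset_le integrable_continuous_interval continuous_P) auto
    thus "integral {Y..T} P \<le> 2 * pi * T * S0" using integral_unique[OF integral_P] by simp
  qed (use m in auto)
  also have "\<dots> \<le> 2 * m * (2 * 4 * T * S0)"
    using m Y S0_pos pi_less_4 by (intro mult_left_mono mult_right_mono) auto
  finally have "T / 4 * W - 2240 * L * E \<le> 16 * m * T * S0" by simp
  moreover have "T / 4 * (V / 2 * S0) \<le> T / 4 * W" using W Y unfolding W_def by (intro mult_left_mono) auto
  ultimately have "T / 4 * (V / 2 * S0) - 2240 * L * E \<le> 16 * m * T * S0" by linarith
  hence "S0 * (T * V / 8 - 2240 * L * card M) \<le> S0 * (16 * m * T)" by (simp add: algebra_simps)
  hence "T * V / 8 - 2240 * L * card M \<le> 16 * m * T" using S0_pos by simp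
  hence "(T * V / 8 - 2240 * L * card M) / (16 * T) \<le> m" using Y by (simp add: pos_divide_le_eq mult_ac)
  moreover have "(T * V / 8 - 2240 * L * card M) / (16 * T) = V / 128 - 140 * L * card M / T"
    using Y by (simp add: field_simps)
  moreover have "140 * L * card M / T \<le> 2240 * L * card M / T"
    using Y lT by (intro divide_right_mono mult_right_mono) (auto simp: L_def)
  ultimately show ?thesis unfolding L_def by linarith
qed

end

theorem theorem1:
  fixes \<epsilon> :: real
  assumes "\<epsilon> > 0"
  shows "\<exists>c>0. \<forall>\<^sub>F T :: real in at_top.
    (SUP t\<in>{T powr (3 / 4)..T}. Z_plus t)
      \<ge> c * exp ((1 / 2 - \<epsilon>) * sqrt (ln T * ln (ln (ln T)) / ln (ln T))) \<and>
    (SUP t\<in>{T powr (3 / 4)..T}. Z_minus t)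
      \<ge> c * exp ((1 / 2 - \<epsilon>) * sqrt (ln T * ln (ln (ln T)) / ln (ln T)))"
proof -
  \<comment> \<open>The cap keeps \<open>1 / 2 - \<delta>\<close> positive, so that
    \<open>V \<ge> 1\<close> and half of \<open>V / 128\<close> absorbs an error below 1/256. For
    larger \<open>\<epsilon>\<close> the claim follows by monotonicity.\<close>
  define \<delta> where "\<delta> = min \<epsilon> (1 / 4)"
  have \<delta>: "\<delta> > 0" "\<delta> \<le> \<epsilon>" "\<delta> \<le> 1 / 2" using assms by (auto simp: \<delta>_def)
  obtain \<kappa> where \<kappa>: "\<kappa> < 1 / 4" and ev: "\<forall>\<^sub>F T :: real in at_top. \<exists>(M :: nat set set) f. finite M \<and> {} \<in> M \<and>
    (\<forall>U\<in>M. finite U \<and> (\<forall>p\<in>U. prime p)) \<and> (\<forall>U\<in>M. \<forall>V\<subseteq>U. V \<in> M) \<and> (\<forall>p. f p \<ge> 0) \<and> real (card M) \<le> T powr \<kappa> \<and>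
    1 / 2 * exp ((1 / 2 - \<delta>) * sqrt (ln T * ln (ln (ln T)) / ln (ln T))) * (\<Sum>U\<in>M. \<Prod>p\<in>U. (f p)\<^sup>2) \<le>
      (\<Sum>U\<in>M. \<Sum>K\<in>{K\<in>Pow U. real (\<Prod>K) \<le> T powr (3 / 2)}. (\<Prod>p\<in>K. f p / sqrt (real p)) * (\<Prod>p\<in>U - K. (f p)\<^sup>2))"
    using exists_resonator[OF \<delta>(1)] by blast
  \<comment> \<open>The error is of order \<open>T powr (\<kappa> - 1 / 4) * ln T\<close>, which is
    where \<open>\<kappa> < 1 / 4\<close> is decisive.\<close>
  have "((\<lambda>T::real. 2240 * (T powr (3 / 4) * ln T) * T powr \<kappa> / T) \<longlongrightarrow> 0) at_top" using \<kappa> by real_asymp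
  from order_tendstoD(2)[OF this, of "1 / 256"]
  have small: "\<forall>\<^sub>F T::real in at_top. 2240 * (T powr (3 / 4) * ln T) * T powr \<kappa> / T < 1 / 256" by simp
  have nn: "\<forall>\<^sub>F T::real in at_top. ln T * ln (ln (ln T)) / ln (ln T) \<ge> 0" by real_asymp
  show ?thesis
  proof (intro exI[of _ "1 / 256"] conjI)
    show "\<forall>\<^sub>F T :: real in at_top.
      (SUP t\<in>{T powr (3 / 4)..T}. Z_plus t) \<ge> 1 / 256 * exp ((1 / 2 - \<epsilon>) * sqrt (ln T * ln (ln (ln T)) / ln (ln T))) \<and>
      (SUP t\<in>{T powr (3 / 4)..T}. Z_minus t) \<ge> 1 / 256 * exp ((1 / 2 - \<epsilon>) * sqrt (ln T * ln (ln (ln T)) / ln (ln T)))"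
      using ev small nn eventually_ge_at_top[of 3]
    proof eventually_elim
      case (elim T)
      define V where "V = exp ((1 / 2 - \<delta>) * sqrt (ln T * ln (ln (ln T)) / ln (ln T)))"
      obtain M :: "nat set set" and f where Mf: "finite M" "{} \<in> M" "\<forall>U\<in>M. finite U \<and> (\<forall>p\<in>U. prime p)" "\<forall>U\<in>M. \<forall>V\<subseteq>U. V \<in> M"
        "\<forall>p. f p \<ge> 0" "real (card M) \<le> T powr \<kappa>"
        and W: "1 / 2 * V * (\<Sum>U\<in>M. \<Prod>p\<in>U. (f p)\<^sup>2) \<le>
        (\<Sum>U\<in>M. \<Sum>K\<in>{K\<in>Pow U. real (\<Prod>K) \<le> T powr (3 / 2)}. (\<Prod>p\<in>K. f p / sqrt (real p)) * (\<Prod>p\<in>U - K. (f p)\<^sup>2))"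
        using elim(1) unfolding V_def by blast
      interpret zeta_resonance M f T by standard (use Mf elim(4) in blast)+
      have V1: "V \<ge> 1" using \<delta> elim(3) by (simp add: V_def)
      have VE: "exp ((1 / 2 - \<epsilon>) * sqrt (ln T * ln (ln (ln T)) / ln (ln T))) \<le> V"
        unfolding V_def using \<delta> elim(3) by (subst exp_le_cancel_iff, intro mult_right_mono) auto
      have "2240 * (Y * ln T) * card M / T \<le> 2240 * (T powr (3 / 4) * ln T) * T powr \<kappa> / T"
        unfolding Y_def using Mf(6) elim(4) by (intro divide_right_mono mult_left_mono) auto
      hence err: "V / 128 - 2240 * (Y * ln T) * card M / T \<ge> V / 256" using elim(2) V1 by simp
      have key: "V / 256 \<le> (SUP t\<in>{Y..T}. max 0 (s * hardy_Z t))" if s: "s = 1 \<or> s = - 1" for s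
      proof -
        have c: "continuous_on {Y..T} (\<lambda>t. max 0 (s * hardy_Z t))"
          by (intro continuous_intros continuous_on_subset[OF continuous_hardy_Z]) auto
        obtain t where t: "t \<in> {Y..T}" "max 0 (s * hardy_Z t) = (SUP t\<in>{Y..T}. max 0 (s * hardy_Z t))"
          "\<And>u. u \<in> {Y..T} \<Longrightarrow> max 0 (s * hardy_Z u) \<le> max 0 (s * hardy_Z t)"
          using SUP_attained[OF c Y(2)] that by metis
        have le: "s * hardy_Z u \<le> max 0 (s * hardy_Z t)" if "u \<in> {Y..T}" for u
          using t(3)[OF that] by linarith
        have W': "V / 2 * S0 \<le> (\<Sum>U\<in>M. \<Sum>K\<in>{K\<in>Pow U. real (\<Prod>K) \<le> T powr (3 / 2)}. (\<Prod>p\<in>K. f p / sqrt (real p)) * (\<Prod>p\<in>U - K. (f p)\<^sup>2))"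
          using W unfolding S0_eq by linarith
        have "max 0 (s * hardy_Z t) \<ge> V / 128 - 2240 * (Y * ln T) * card M / T"
          by (rule max_ge[OF s max.cobounded1 le W'])
        thus ?thesis using err t(2) by linarith
      qed
      have "(SUP t\<in>{Y..T}. Z_plus t) \<ge> V / 256" "(SUP t\<in>{Y..T}. Z_minus t) \<ge> V / 256"
        using key[of 1] key[of "- 1"] by (simp_all add: Z_plus_def Z_minus_def)
      thus ?case using VE by (simp add: Y_def)
    qed
  qed simp
qed

end
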